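(* Let $\mathcal{D}$ be a triangulated category closed with respect to small coproducts. Assume that $\mathcal{D}=\mathcal{T}^{\coprod}$, where $\mathcal{T}\subset\mathcal{D}$ is a triangulated subcategory whose objects are compact in $\mathcal{D}$, and let $(\mathcal{T}_i)$, $0\le i\le n$ (where $n\ge 1$), be a (length $n$) semi-orthogonal decomposition of $\mathcal{T}$. I.1. The family $(\mathcal{T}_i^{\coprod})$ is a semi-orthogonal decomposition of $\mathcal{D}$. I.2. Assume in addition that $\mathcal{T}$ is essentially small (consequently, $\mathcal{D}$ is compactly generated by it). Then the family $$(\hat{\mathcal{T}}_i)=\bigl((\mathcal{T}_{\le n-i-1})^{\perp}_{\mathcal{T}_{\le n-i}^{\coprod}}\bigr),\quad 0\le i\le n,$$ is a semi-orthogonal decomposition of $\mathcal{D}$ as well (note that $\mathcal{T}_{\le -1}=\{0\}$). Moreover, the corresponding ascending chain $(\hat{\mathcal{T}}_{\le i-1})_{1\le i\le n}$ of left admissible (resp. $(\hat{\mathcal{T}}_{\ge n+1-i})_{1\le i\le n}$ of right admissible) subcategories of $\mathcal{D}$ equals $((\mathcal{T}_{\le n-i})^{\perp}_{\mathcal{D}})_{1\le i\le n}$ (resp. $(\mathcal{T}_{\le i-1}^{\coprod})_{1\le i\le n}$). I.3. Assume that $\mathcal{T}$ is essentially small and $\mathcal{T}_0'$ is a triangulated subcategory of $\mathcal{D}$ such that the family $(\hat{\mathcal{T}}_i)$ restricts to a semi-orthogonal decomposition $D_0=(\hat{\mathcal{T}}_i\cap\mathcal{T}_0')$ of $\mathcal{T}_0'$.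 Then the family $(\hat{\mathcal{T}}_i)$ also restricts to the category $\mathcal{T}_0'^{\coprod}$, and this restriction equals $D_0^{\coprod}=((\hat{\mathcal{T}}_i\cap\mathcal{T}_0')^{\coprod})$. II. Assume that $\mathcal{T}$ is essentially small, $R$ is a commutative unital ring, $\mathcal{D}$ is $R$-linear, and $\underline{A}$ is an exact abelian subcategory of the category $R\text{-Mod}^{\mathbb{Z}}$ of $\mathbb{Z}$-graded $R$-modules that is stable with respect to shifts (that is, $M=\bigoplus M^i$ belongs to $\underline{A}$ if and only if $M[1]=\bigoplus M^{i+1}$ does). Let $\mathcal{T}_{\underline{A}}$ be the full subcategory of $\mathcal{D}$ of those $N$ such that for any $M\in\operatorname{Obj}\mathcal{T}$ the graded module $\bigoplus_j\mathcal{D}(M[-j],N)$ belongs to $\underline{A}$. Then the family $(\hat{\mathcal{T}}_i)$ restricts to a semi-orthogonal decomposition of the (triangulated) category $\mathcal{T}_{\underline{A}}$.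
   Context: All subcategories are strictly full. $\mathcal{D}(X,Y)$ is the set of morphisms from $X$ to $Y$. An object $M$ of $\mathcal{D}$ is compact if $\mathcal{D}(M,-)$ respects small coproducts. $\mathcal{T}^{\coprod}$ is the smallest strictly full triangulated subcategory of $\mathcal{D}$ closed with respect to $\mathcal{D}$-coproducts and containing $\mathcal{T}$. $\mathcal{T}$ compactly generates $\mathcal{D}$ if it is essentially small, its objects are compact, and $\mathcal{D}=\mathcal{T}^{\coprod}$. For triangulated subcategories $\mathcal{C},\mathcal{T}'\subset\mathcal{D}$, $\mathcal{C}^{\perp}_{\mathcal{T}'}$ is the full subcategory of those $Y\in\mathcal{T}'$ with $\mathcal{D}(X,Y)=\{0\}$ for all $X\in\mathcal{C}$. Given strictly full triangulated subcategories $\mathcal{T}_i$, $0\le i\le n$, of a triangulated category $\mathcal{T}$, $\mathcal{T}_{\le j}$ (resp. $\mathcal{T}_{\ge j}$) is the smallest strictly full triangulated subcategory of $\mathcal{T}$ containing $\mathcal{T}_i$ for all $i\le j$ (resp. $i\ge j$); so $\mathcal{T}_{\le-1}=\mathcal{T}_{\ge n+1}=\{0\}$. The family $(\mathcal{T}_i)$ is a (length $n$) semi-orthogonal decomposition of $\mathcal{T}$ if there are no non-zero morphisms from objects of $\mathcal{T}_j$ to objects of $\mathcal{T}_i$ whenever $0\le i<j\le n$, and $\mathcal{T}_{\le n}=\mathcal{T}$. It restricts to a triangulated subcategory $\mathcal{T}'\subset\mathcal{T}$ if $(\mathcal{T}_i\cap\mathcal{T}')$ is a semi-orthogonal decomposition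 of $\mathcal{T}'$. For any length $n$ semi-orthogonal decomposition $(\mathcal{S}_i)$ of a triangulated category, the subcategories $\mathcal{S}_{\le i-1}$ (resp. $\mathcal{S}_{\ge n+1-i}$), $1\le i\le n$, form an ascending chain of left (resp. right) admissible subcategories, where a triangulated subcategory is left (resp. right) admissible if its embedding admits a left (resp. right) adjoint. "Exact abelian subcategory" of an abelian category means a strictly full subcategory closed under kernels, cokernels, and extensions. *)

theory Defs
  imports "HOL-Algebra.Module" "HOL-Algebra.Free_Abelian_Groups"
begin

section \<open>Categories, functors and adjunctions\<close>

record ('o, 'm) cat_data =
  obj :: "'o set"
  arr :: "'m set"
  src :: "'m \<Rightarrow> 'o"
  tgt :: "'m \<Rightarrow> 'o"
  ident :: "'o \<Rightarrow> 'm"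
  cmp :: "'m \<Rightarrow> 'm \<Rightarrow> 'm"  (* cmp C g f: first f, then g *)

definition Hom :: "('o, 'm, 'z) cat_data_scheme \<Rightarrow> 'o \<Rightarrow> 'o \<Rightarrow> 'm set" where
  "Hom C X Y = {f \<in> arr C. src C f = X \<and> tgt C f = Y}"

locale is_category =
  fixes C :: "('o, 'm, 'z) cat_data_scheme"
  assumes src_obj: "f \<in> arr C \<Longrightarrow> src C f \<in> obj C"
    and tgt_obj: "f \<in> arr C \<Longrightarrow> tgt C f \<in> obj C"
    and ident_Hom: "X \<in> obj C \<Longrightarrow> ident C X \<in> Hom C X X"
    and cmp_Hom: "f \<in> Hom C X Y \<Longrightarrow> g \<in> Hom C Y Z \<Longrightarrow> cmp C g f \<in> Hom C X Z"
    and cmp_ident_right: "f \<in> Hom C X Y \<Longrightarrow> cmp C f (ident C X) = f"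
    and cmp_ident_left: "f \<in> Hom C X Y \<Longrightarrow> cmp C (ident C Y) f = f"
    and cmp_assoc: "f \<in> Hom C W X \<Longrightarrow> g \<in> Hom C X Y \<Longrightarrow> h \<in> Hom C Y Z \<Longrightarrow>
          cmp C h (cmp C g f) = cmp C (cmp C h g) f"

definition iso_arr :: "('o, 'm, 'z) cat_data_scheme \<Rightarrow> 'o \<Rightarrow> 'o \<Rightarrow> 'm \<Rightarrow> bool" where
  "iso_arr C X Y f \<longleftrightarrow> f \<in> Hom C X Y \<and>
     (\<exists>g \<in> Hom C Y X. cmp C g f = ident C X \<and> cmp C f g = ident C Y)"

definition isomorphic :: "('o, 'm, 'z) cat_data_scheme \<Rightarrow> 'o \<Rightarrow> 'o \<Rightarrow> bool" where
  "isomorphic C X Y \<longleftrightarrow> (\<exists>f. iso_arr C X Y f)"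

definition zero_obj :: "('o, 'm, 'z) cat_data_scheme \<Rightarrow> 'o \<Rightarrow> bool" where
  "zero_obj C Z \<longleftrightarrow> Z \<in> obj C \<and>
     (\<forall>X \<in> obj C. (\<exists>!f. f \<in> Hom C X Z) \<and> (\<exists>!f. f \<in> Hom C Z X))"

definition is_functor ::
  "('o, 'm, 'z) cat_data_scheme \<Rightarrow> ('p, 'l, 'y) cat_data_scheme \<Rightarrow> ('o \<Rightarrow> 'p) \<Rightarrow> ('m \<Rightarrow> 'l) \<Rightarrow> bool"
  where
  "is_functor C D Fo Fm \<longleftrightarrow>
     (\<forall>X \<in> obj C. Fo X \<in> obj D \<and> Fm (ident C X) = ident D (Fo X)) \<and>
     (\<forall>X Y. \<forall>f \<in> Hom C X Y. Fm f \<in> Hom D (Fo X) (Fo Y)) \<and>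
     (\<forall>X Y Z. \<forall>f \<in> Hom C X Y. \<forall>g \<in> Hom C Y Z. Fm (cmp C g f) = cmp D (Fm g) (Fm f))"

text \<open>The functor \<open>(Fo, Fm)\<close> from \<open>C\<close> to \<open>D\<close> is left adjoint to \<open>(Go, Gm)\<close>.\<close>

definition adjoint_functors ::
  "('o, 'm, 'z) cat_data_scheme \<Rightarrow> ('p, 'l, 'y) cat_data_scheme \<Rightarrow>
   ('o \<Rightarrow> 'p) \<Rightarrow> ('m \<Rightarrow> 'l) \<Rightarrow> ('p \<Rightarrow> 'o) \<Rightarrow> ('l \<Rightarrow> 'm) \<Rightarrow> bool" where
  "adjoint_functors C D Fo Fm Go Gm \<longleftrightarrow>
     is_functor C D Fo Fm \<and> is_functor D C Go Gm \<and>
     (\<exists>\<phi>. (\<forall>X \<in> obj C. \<forall>Y \<in> obj D. bij_betw (\<phi> X Y) (Hom D (Fo X) Y) (Hom C X (Go Y))) \<and>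
          (\<forall>X' X Y Y'. \<forall>a \<in> Hom C X' X. \<forall>f \<in> Hom D (Fo X) Y. \<forall>b \<in> Hom D Y Y'.
             \<phi> X' Y' (cmp D b (cmp D f (Fm a))) = cmp C (Gm b) (cmp C (\<phi> X Y f) a)))"


section \<open>Additive categories\<close>

record ('o, 'm) ab_cat_data = "('o, 'm) cat_data" +
  add_arr :: "'m \<Rightarrow> 'm \<Rightarrow> 'm"
  zero_arr :: "'o \<Rightarrow> 'o \<Rightarrow> 'm"

definition hom_group :: "('o, 'm, 'z) ab_cat_data_scheme \<Rightarrow> 'o \<Rightarrow> 'o \<Rightarrow> 'm monoid" where
  "hom_group C X Y = \<lparr>carrier = Hom C X Y, mult = add_arr C, one = zero_arr C X Y\<rparr>"

definition neg_arr :: "('o, 'm, 'z) ab_cat_data_scheme \<Rightarrow> 'm \<Rightarrow> 'm" where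
  "neg_arr C f = inv\<^bsub>hom_group C (src C f) (tgt C f)\<^esub> f"

locale additive_category = is_category C
  for C :: "('o, 'm, 'z) ab_cat_data_scheme" +
  assumes hom_comm_group: "X \<in> obj C \<Longrightarrow> Y \<in> obj C \<Longrightarrow> comm_group (hom_group C X Y)"
    and cmp_add_right: "f \<in> Hom C X Y \<Longrightarrow> f' \<in> Hom C X Y \<Longrightarrow> g \<in> Hom C Y Z \<Longrightarrow>
          cmp C g (add_arr C f f') = add_arr C (cmp C g f) (cmp C g f')"
    and cmp_add_left: "f \<in> Hom C X Y \<Longrightarrow> g \<in> Hom C Y Z \<Longrightarrow> g' \<in> Hom C Y Z \<Longrightarrow>
          cmp C (add_arr C g g') f = add_arr C (cmp C g f) (cmp C g' f)"
    and zero_obj_exists: "\<exists>Z. zero_obj C Z"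
    and biproduct_exists: "X \<in> obj C \<Longrightarrow> Y \<in> obj C \<Longrightarrow>
          \<exists>P \<in> obj C. \<exists>i \<in> Hom C X P. \<exists>j \<in> Hom C Y P. \<exists>p \<in> Hom C P X. \<exists>q \<in> Hom C P Y.
            cmp C p i = ident C X \<and> cmp C q j = ident C Y \<and>
            cmp C p j = zero_arr C Y X \<and> cmp C q i = zero_arr C X Y \<and>
            add_arr C (cmp C i p) (cmp C j q) = ident C P"


section \<open>Triangulated categories\<close>

text \<open>
  A triangle \<open>X \<rightarrow> Y \<rightarrow> Z \<rightarrow> X[1]\<close> is given by its three morphisms.  The shift is an
  automorphism of the category, so that the objects \<open>X[j]\<close> are defined for all integers \<open>j\<close>.
\<close>

record ('o, 'm) tri_cat_data = "('o, 'm) ab_cat_data" +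
  shift_obj :: "'o \<Rightarrow> 'o"
  shift_arr :: "'m \<Rightarrow> 'm"
  dist :: "('m \<times> 'm \<times> 'm) set"

definition triangle ::
  "('o, 'm, 'z) tri_cat_data_scheme \<Rightarrow> 'o \<Rightarrow> 'o \<Rightarrow> 'o \<Rightarrow> 'm \<Rightarrow> 'm \<Rightarrow> 'm \<Rightarrow> bool" where
  "triangle C X Y Z f g h \<longleftrightarrow> f \<in> Hom C X Y \<and> g \<in> Hom C Y Z \<and> h \<in> Hom C Z (shift_obj C X)"

definition dist_triangle ::
  "('o, 'm, 'z) tri_cat_data_scheme \<Rightarrow> 'o \<Rightarrow> 'o \<Rightarrow> 'o \<Rightarrow> 'm \<Rightarrow> 'm \<Rightarrow> 'm \<Rightarrow> bool" where
  "dist_triangle C X Y Z f g h \<longleftrightarrow> triangle C X Y Z f g h \<and> (f, g, h) \<in> dist C"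

locale triangulated_category = additive_category C
  for C :: "('o, 'm, 'z) tri_cat_data_scheme" +
  assumes shift_functor: "is_functor C C (shift_obj C) (shift_arr C)"
    and shift_obj_bij: "bij_betw (shift_obj C) (obj C) (obj C)"
    and shift_arr_bij: "bij_betw (shift_arr C) (arr C) (arr C)"
    and shift_add: "f \<in> Hom C X Y \<Longrightarrow> f' \<in> Hom C X Y \<Longrightarrow>
          shift_arr C (add_arr C f f') = add_arr C (shift_arr C f) (shift_arr C f')"
    and dist_iso: "dist_triangle C X Y Z f g h \<Longrightarrow> triangle C X' Y' Z' f' g' h' \<Longrightarrow>
          iso_arr C X X' a \<Longrightarrow> iso_arr C Y Y' b \<Longrightarrow> iso_arr C Z Z' c \<Longrightarrow>
          cmp C f' a = cmp C b f \<Longrightarrow> cmp C g' b = cmp C c g \<Longrightarrow>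
          cmp C h' c = cmp C (shift_arr C a) h \<Longrightarrow> dist_triangle C X' Y' Z' f' g' h'"
    and dist_ident: "X \<in> obj C \<Longrightarrow> zero_obj C Z \<Longrightarrow>
          dist_triangle C X X Z (ident C X) (zero_arr C X Z) (zero_arr C Z (shift_obj C X))"
    and cone_exists: "f \<in> Hom C X Y \<Longrightarrow> \<exists>Z g h. dist_triangle C X Y Z f g h"
    and dist_rotate: "triangle C X Y Z f g h \<Longrightarrow>
          dist_triangle C X Y Z f g h \<longleftrightarrow>
          dist_triangle C Y Z (shift_obj C X) g h (neg_arr C (shift_arr C f))"
    and dist_morphism: "dist_triangle C X Y Z f g h \<Longrightarrow> dist_triangle C X' Y' Z' f' g' h' \<Longrightarrow>
          a \<in> Hom C X X' \<Longrightarrow> b \<in> Hom C Y Y' \<Longrightarrow> cmp C f' a = cmp C b f \<Longrightarrow>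
          \<exists>c \<in> Hom C Z Z'. cmp C g' b = cmp C c g \<and> cmp C h' c = cmp C (shift_arr C a) h"
    and octahedron: "dist_triangle C X Y Z' f u1 v1 \<Longrightarrow> dist_triangle C Y Z X' g u3 v3 \<Longrightarrow>
          dist_triangle C X Z Y' (cmp C g f) u2 v2 \<Longrightarrow>
          \<exists>a b. dist_triangle C Z' Y' X' a b (cmp C (shift_arr C u1) v3) \<and>
                cmp C a u1 = cmp C u2 g \<and> cmp C v2 a = v1 \<and>
                cmp C b u2 = u3 \<and> cmp C v3 b = cmp C (shift_arr C f) v2"

definition shift_pow :: "('o, 'm, 'z) tri_cat_data_scheme \<Rightarrow> int \<Rightarrow> 'o \<Rightarrow> 'o" where
  "shift_pow C j X =
     (if 0 \<le> j then (shift_obj C ^^ nat j) X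
      else (inv_into (obj C) (shift_obj C) ^^ nat (- j)) X)"


section \<open>Triangulated subcategories and semi-orthogonal decompositions\<close>

text \<open>Strictly full subcategories are identified with their sets of objects.\<close>

definition full_sub ::
  "('o, 'm, 'z) tri_cat_data_scheme \<Rightarrow> 'o set \<Rightarrow> ('o, 'm, 'z) tri_cat_data_scheme" where
  "full_sub C S = C\<lparr>obj := S,
                    arr := {f \<in> arr C. src C f \<in> S \<and> tgt C f \<in> S},
                    dist := {(f, g, h) \<in> dist C. src C f \<in> S \<and> tgt C f \<in> S \<and> tgt C g \<in> S}\<rparr>"

definition tri_subcat :: "('o, 'm, 'z) tri_cat_data_scheme \<Rightarrow> 'o set \<Rightarrow> bool" where
  "tri_subcat C S \<longleftrightarrow> S \<subseteq> obj C \<and> (\<exists>Z \<in> S. zero_obj C Z) \<and>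
     (\<forall>X \<in> S. \<forall>Y \<in> obj C. isomorphic C X Y \<longrightarrow> Y \<in> S) \<and>
     (\<forall>X \<in> obj C. shift_obj C X \<in> S \<longleftrightarrow> X \<in> S) \<and>
     (\<forall>X \<in> S. \<forall>Y \<in> S. \<forall>Z f g h. dist_triangle C X Y Z f g h \<longrightarrow> Z \<in> S)"

definition tri_hull :: "('o, 'm, 'z) tri_cat_data_scheme \<Rightarrow> 'o set \<Rightarrow> 'o set" where
  "tri_hull C G = \<Inter>{S. tri_subcat C S \<and> G \<subseteq> S}"

text \<open>The bound \<open>j\<close> is an integer because \<open>j = -1\<close> occurs.\<close>

definition tri_le ::
  "('o, 'm, 'z) tri_cat_data_scheme \<Rightarrow> nat \<Rightarrow> (nat \<Rightarrow> 'o set) \<Rightarrow> int \<Rightarrow> 'o set" where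
  "tri_le C n S j = tri_hull C (\<Union>i \<in> {i. i \<le> n \<and> int i \<le> j}. S i)"

definition tri_ge ::
  "('o, 'm, 'z) tri_cat_data_scheme \<Rightarrow> nat \<Rightarrow> (nat \<Rightarrow> 'o set) \<Rightarrow> int \<Rightarrow> 'o set" where
  "tri_ge C n S j = tri_hull C (\<Union>i \<in> {i. i \<le> n \<and> int i \<ge> j}. S i)"

definition semi_orth_dec ::
  "('o, 'm, 'z) tri_cat_data_scheme \<Rightarrow> nat \<Rightarrow> (nat \<Rightarrow> 'o set) \<Rightarrow> bool" where
  "semi_orth_dec C n S \<longleftrightarrow>
     (\<forall>i \<le> n. tri_subcat C (S i)) \<and>
     (\<forall>i j. i < j \<and> j \<le> n \<longrightarrow> (\<forall>X \<in> S j. \<forall>Y \<in> S i. Hom C X Y = {zero_arr C X Y})) \<and>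
     tri_le C n S (int n) = obj C"

definition restricts_to ::
  "('o, 'm, 'z) tri_cat_data_scheme \<Rightarrow> nat \<Rightarrow> (nat \<Rightarrow> 'o set) \<Rightarrow> 'o set \<Rightarrow> bool" where
  "restricts_to C n S T' \<longleftrightarrow>
     tri_subcat C T' \<and> semi_orth_dec (full_sub C T') n (\<lambda>i. S i \<inter> T')"

text \<open>\<open>right_perp D C T'\<close> is the orthogonal of \<open>C\<close> inside \<open>T'\<close>.\<close>

definition right_perp ::
  "('o, 'm, 'z) tri_cat_data_scheme \<Rightarrow> 'o set \<Rightarrow> 'o set \<Rightarrow> 'o set" where
  "right_perp D C T' = {Y \<in> T'. \<forall>X \<in> C. Hom D X Y = {zero_arr D X Y}}"

definition left_admissible :: "('o, 'm, 'z) tri_cat_data_scheme \<Rightarrow> 'o set \<Rightarrow> bool" where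
  "left_admissible D S \<longleftrightarrow> tri_subcat D S \<and>
     (\<exists>Lo Lm. adjoint_functors D (full_sub D S) Lo Lm (\<lambda>X. X) (\<lambda>f. f))"

definition right_admissible :: "('o, 'm, 'z) tri_cat_data_scheme \<Rightarrow> 'o set \<Rightarrow> bool" where
  "right_admissible D S \<longleftrightarrow> tri_subcat D S \<and>
     (\<exists>Ro Rm. adjoint_functors (full_sub D S) D (\<lambda>X. X) (\<lambda>f. f) Ro Rm)"


section \<open>Smallness, coproducts and compact objects\<close>

text \<open>
  Smallness is relative to a cardinal \<open>\<kappa>\<close>: a set is small if its cardinality is less than \<open>\<kappa>\<close>.
  The usual convention is the case where \<open>\<kappa>\<close> is the cardinality of a Grothendieck universe
  (an inaccessible cardinal); only uncountability and regularity of \<open>\<kappa>\<close> are required here.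
  Each small set is in bijection with a subset of the type \<open>'u\<close> underlying \<open>\<kappa>\<close>, so it suffices
  to index coproducts by subsets of that type.
\<close>

definition universe_card :: "'u rel \<Rightarrow> bool" where
  "universe_card \<kappa> \<longleftrightarrow> Card_order \<kappa> \<and> natLeq <o \<kappa> \<and> regularCard \<kappa>"

text \<open>
  Smallness of the sets of morphisms is required only for sources in a given class \<open>T\<close>
  (\<open>T = obj D\<close> is the usual notion).  This weaker condition also admits cardinals \<open>\<kappa>\<close> that are
  not inaccessible: finite-dimensional spaces \<open>T\<close> inside the countable-dimensional vector spaces over
  a countable field satisfy it for \<open>\<kappa> = \<aleph>\<^sub>1\<close>, while \<open>D(\<Coprod>\<^sub>i X\<^sub>i, Y) = \<Prod>\<^sub>i D(X\<^sub>i, Y)\<close> need not be small.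
\<close>

definition locally_small_from :: "'u rel \<Rightarrow> ('o, 'm, 'z) cat_data_scheme \<Rightarrow> 'o set \<Rightarrow> bool" where
  "locally_small_from \<kappa> D T \<longleftrightarrow> (\<forall>M \<in> T. \<forall>X \<in> obj D. |Hom D M X| <o \<kappa>)"

definition essentially_small :: "'u rel \<Rightarrow> ('o, 'm, 'z) cat_data_scheme \<Rightarrow> 'o set \<Rightarrow> bool" where
  "essentially_small \<kappa> D T \<longleftrightarrow> (\<exists>S \<subseteq> T. |S| <o \<kappa> \<and> (\<forall>X \<in> T. \<exists>Y \<in> S. isomorphic D X Y))"

definition is_coproduct ::
  "('o, 'm, 'z) cat_data_scheme \<Rightarrow> 'u set \<Rightarrow> ('u \<Rightarrow> 'o) \<Rightarrow> 'o \<Rightarrow> ('u \<Rightarrow> 'm) \<Rightarrow> bool" where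
  "is_coproduct D I X P \<iota> \<longleftrightarrow> P \<in> obj D \<and> (\<forall>i \<in> I. \<iota> i \<in> Hom D (X i) P) \<and>
     (\<forall>Y \<in> obj D. \<forall>g. (\<forall>i \<in> I. g i \<in> Hom D (X i) Y) \<longrightarrow>
        (\<exists>!h. h \<in> Hom D P Y \<and> (\<forall>i \<in> I. cmp D h (\<iota> i) = g i)))"

definition has_small_coproducts :: "'u rel \<Rightarrow> ('o, 'm, 'z) cat_data_scheme \<Rightarrow> bool" where
  "has_small_coproducts \<kappa> D \<longleftrightarrow>
     (\<forall>(I :: 'u set) X. |I| <o \<kappa> \<and> (\<forall>i \<in> I. X i \<in> obj D) \<longrightarrow> (\<exists>P \<iota>. is_coproduct D I X P \<iota>))"

definition coproduct_closed :: "'u rel \<Rightarrow> ('o, 'm, 'z) cat_data_scheme \<Rightarrow> 'o set \<Rightarrow> bool" where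
  "coproduct_closed \<kappa> D S \<longleftrightarrow>
     (\<forall>(I :: 'u set) X P \<iota>. |I| <o \<kappa> \<and> (\<forall>i \<in> I. X i \<in> S) \<and> is_coproduct D I X P \<iota> \<longrightarrow> P \<in> S)"

definition coproduct_hull ::
  "'u rel \<Rightarrow> ('o, 'm, 'z) tri_cat_data_scheme \<Rightarrow> 'o set \<Rightarrow> 'o set" where
  "coproduct_hull \<kappa> D G = \<Inter>{S. tri_subcat D S \<and> coproduct_closed \<kappa> D S \<and> G \<subseteq> S}"

text \<open>
  An object \<open>M\<close> is compact if, for every small coproduct, the canonical map from the direct sum
  of the groups \<open>D(M, X\<^sub>i)\<close> to \<open>D(M, P)\<close> is an isomorphism; \<^const>\<open>gfinprod\<close> is the sum of a
  finitely supported family in the (multiplicatively written) group of morphisms.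
\<close>

definition compact_obj :: "'u rel \<Rightarrow> ('o, 'm, 'z) ab_cat_data_scheme \<Rightarrow> 'o \<Rightarrow> bool" where
  "compact_obj \<kappa> D M \<longleftrightarrow> M \<in> obj D \<and>
     (\<forall>(I :: 'u set) X P \<iota>. |I| <o \<kappa> \<and> (\<forall>i \<in> I. X i \<in> obj D) \<and> is_coproduct D I X P \<iota> \<longrightarrow>
        (\<lambda>x. gfinprod (hom_group D M P) (\<lambda>i. cmp D (\<iota> i) (x i)) I)
          \<in> iso (sum_group I (\<lambda>i. hom_group D M (X i))) (hom_group D M P))"

definition compactly_generates ::
  "'u rel \<Rightarrow> ('o, 'm, 'z) tri_cat_data_scheme \<Rightarrow> 'o set \<Rightarrow> bool" where
  "compactly_generates \<kappa> D T \<longleftrightarrow>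
     essentially_small \<kappa> D T \<and> (\<forall>M \<in> T. compact_obj \<kappa> D M) \<and> coproduct_hull \<kappa> D T = obj D"

definition hat_family ::
  "'u rel \<Rightarrow> ('o, 'm, 'z) tri_cat_data_scheme \<Rightarrow> 'o set \<Rightarrow> nat \<Rightarrow> (nat \<Rightarrow> 'o set) \<Rightarrow> nat \<Rightarrow> 'o set"
  where
  "hat_family \<kappa> D T n S i =
     right_perp D (tri_le (full_sub D T) n S (int n - int i - 1))
       (coproduct_hull \<kappa> D (tri_le (full_sub D T) n S (int n - int i)))"


section \<open>Linear categories and graded modules\<close>

text \<open>Only the additive group and the scalar multiplication of a \<^const>\<open>module\<close> matter.\<close>

definition hom_module ::
  "('o, 'm, 'z) ab_cat_data_scheme \<Rightarrow> ('r \<Rightarrow> 'm \<Rightarrow> 'm) \<Rightarrow> 'o \<Rightarrow> 'o \<Rightarrow> ('r, 'm) module" where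
  "hom_module D sm X Y =
     \<lparr>carrier = Hom D X Y, mult = undefined, one = undefined,
      ring.zero = zero_arr D X Y, add = add_arr D, smult = sm\<rparr>"

text \<open>\<open>R\<close>-linearity of a triangulated category includes \<open>R\<close>-linearity of its shift functor.\<close>

definition linear_structure ::
  "('r, 'y) ring_scheme \<Rightarrow> ('o, 'm, 'z) tri_cat_data_scheme \<Rightarrow> ('r \<Rightarrow> 'm \<Rightarrow> 'm) \<Rightarrow> bool" where
  "linear_structure R D sm \<longleftrightarrow>
     (\<forall>X \<in> obj D. \<forall>Y \<in> obj D. module R (hom_module D sm X Y)) \<and>
     (\<forall>r \<in> carrier R. \<forall>X Y Z. \<forall>f \<in> Hom D X Y. \<forall>g \<in> Hom D Y Z.
        sm r (cmp D g f) = cmp D (sm r g) f \<and> sm r (cmp D g f) = cmp D g (sm r f)) \<and>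
     (\<forall>r \<in> carrier R. \<forall>f \<in> arr D. shift_arr D (sm r f) = sm r (shift_arr D f))"

definition mod_hom ::
  "('r, 'y) ring_scheme \<Rightarrow> ('r, 'a, 'z) module_scheme \<Rightarrow> ('r, 'b, 'w) module_scheme \<Rightarrow> ('a \<Rightarrow> 'b) set"
  where
  "mod_hom R M N =
     {f \<in> carrier M \<rightarrow> carrier N.
        (\<forall>x \<in> carrier M. \<forall>y \<in> carrier M. f (x \<oplus>\<^bsub>M\<^esub> y) = f x \<oplus>\<^bsub>N\<^esub> f y) \<and>
        (\<forall>r \<in> carrier R. \<forall>x \<in> carrier M. f (r \<odot>\<^bsub>M\<^esub> x) = r \<odot>\<^bsub>N\<^esub> f x)}"

text \<open>
  A graded module is the family of its homogeneous components.  The objects of \<open>R-Mod\<^sup>\<int>\<close> have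
  small components with carriers in the type \<open>'u\<close> underlying \<open>\<kappa>\<close>; every small module over \<open>R\<close> is
  isomorphic to one of these.
\<close>

type_synonym ('r, 'a) graded_module = "int \<Rightarrow> ('r, 'a) module"

definition graded_modules :: "('r, 'y) ring_scheme \<Rightarrow> 'u rel \<Rightarrow> ('r, 'u) graded_module set" where
  "graded_modules R \<kappa> = {G. \<forall>j. module R (G j) \<and> |carrier (G j)| <o \<kappa>}"

definition gmod_hom ::
  "('r, 'y) ring_scheme \<Rightarrow> ('r, 'a) graded_module \<Rightarrow> ('r, 'b) graded_module \<Rightarrow> (int \<Rightarrow> 'a \<Rightarrow> 'b) set"
  where
  "gmod_hom R G H = {f. \<forall>j. f j \<in> mod_hom R (G j) (H j)}"

definition gmod_isomorphic ::
  "('r, 'y) ring_scheme \<Rightarrow> ('r, 'a) graded_module \<Rightarrow> ('r, 'b) graded_module \<Rightarrow> bool" where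
  "gmod_isomorphic R G H \<longleftrightarrow>
     (\<exists>f \<in> gmod_hom R G H. \<forall>j. bij_betw (f j) (carrier (G j)) (carrier (H j)))"

text \<open>The sequence \<open>0 \<rightarrow> K \<rightarrow> G \<rightarrow> H\<close> is exact.\<close>

definition is_gmod_kernel ::
  "('r, 'y) ring_scheme \<Rightarrow> ('r, 'a) graded_module \<Rightarrow> ('r, 'a) graded_module \<Rightarrow> ('r, 'a) graded_module \<Rightarrow>
   (int \<Rightarrow> 'a \<Rightarrow> 'a) \<Rightarrow> (int \<Rightarrow> 'a \<Rightarrow> 'a) \<Rightarrow> bool" where
  "is_gmod_kernel R K G H k f \<longleftrightarrow> k \<in> gmod_hom R K G \<and> f \<in> gmod_hom R G H \<and>
     (\<forall>j. inj_on (k j) (carrier (K j)) \<and>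
          k j ` carrier (K j) = {x \<in> carrier (G j). f j x = \<zero>\<^bsub>H j\<^esub>})"

text \<open>The sequence \<open>G \<rightarrow> H \<rightarrow> Q \<rightarrow> 0\<close> is exact.\<close>

definition is_gmod_cokernel ::
  "('r, 'y) ring_scheme \<Rightarrow> ('r, 'a) graded_module \<Rightarrow> ('r, 'a) graded_module \<Rightarrow> ('r, 'a) graded_module \<Rightarrow>
   (int \<Rightarrow> 'a \<Rightarrow> 'a) \<Rightarrow> (int \<Rightarrow> 'a \<Rightarrow> 'a) \<Rightarrow> bool" where
  "is_gmod_cokernel R G H Q f p \<longleftrightarrow> f \<in> gmod_hom R G H \<and> p \<in> gmod_hom R H Q \<and>
     (\<forall>j. p j ` carrier (H j) = carrier (Q j) \<and>
          f j ` carrier (G j) = {y \<in> carrier (H j). p j y = \<zero>\<^bsub>Q j\<^esub>})"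

definition exact_abelian_subcat ::
  "('r, 'y) ring_scheme \<Rightarrow> 'u rel \<Rightarrow> ('r, 'u) graded_module set \<Rightarrow> bool" where
  "exact_abelian_subcat R \<kappa> A \<longleftrightarrow> A \<subseteq> graded_modules R \<kappa> \<and> A \<noteq> {} \<and>
     (\<forall>G \<in> A. \<forall>H \<in> graded_modules R \<kappa>. gmod_isomorphic R G H \<longrightarrow> H \<in> A) \<and>
     (\<forall>G \<in> A. \<forall>H \<in> A. \<forall>K \<in> graded_modules R \<kappa>. \<forall>k f. is_gmod_kernel R K G H k f \<longrightarrow> K \<in> A) \<and>
     (\<forall>G \<in> A. \<forall>H \<in> A. \<forall>Q \<in> graded_modules R \<kappa>. \<forall>f p. is_gmod_cokernel R G H Q f p \<longrightarrow> Q \<in> A) \<and>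
     (\<forall>G \<in> A. \<forall>H \<in> A. \<forall>E \<in> graded_modules R \<kappa>. \<forall>k p.
        is_gmod_kernel R G E H k p \<and> is_gmod_cokernel R G E H k p \<longrightarrow> E \<in> A)"

definition shift_stable ::
  "('r, 'y) ring_scheme \<Rightarrow> 'u rel \<Rightarrow> ('r, 'u) graded_module set \<Rightarrow> bool" where
  "shift_stable R \<kappa> A \<longleftrightarrow> (\<forall>G \<in> graded_modules R \<kappa>. G \<in> A \<longleftrightarrow> (\<lambda>i. G (i + 1)) \<in> A)"

text \<open>
  The groups of morphisms have carriers in the type \<open>'m\<close>, hence membership of a graded module of
  morphisms in \<open>A\<close> means that it is isomorphic to a member of \<open>A\<close>.
\<close>

definition T_sub ::
  "('r, 'y) ring_scheme \<Rightarrow> ('o, 'm, 'z) tri_cat_data_scheme \<Rightarrow> ('r \<Rightarrow> 'm \<Rightarrow> 'm) \<Rightarrow> 'o set \<Rightarrow>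
   ('r, 'u) graded_module set \<Rightarrow> 'o set" where
  "T_sub R D sm T A = {N \<in> obj D. \<forall>M \<in> T. \<exists>G \<in> A.
     gmod_isomorphic R (\<lambda>j. hom_module D sm (shift_pow D (- j) M) N) G}"

end

theory Submission
  imports Defs
begin

text \<open>
  For triangulated subcategories with \<open>D(B, A) = 0\<close>, the objects \<open>X\<close> in a triangle \<open>b \<rightarrow> X \<rightarrow> a \<rightarrow> b[1]\<close> form
  the triangulated subcategory \<open>B * A\<close> generated by \<open>B\<close> and \<open>A\<close>: the operation \<open>*\<close> is associative by the
  octahedral axiom, and \<open>A * B \<subseteq> B * A\<close> because the connecting morphisms \<open>b \<rightarrow> a[1]\<close> vanish.  Coproducts of
  distinguished triangles are distinguished, so \<open>B * A\<close> inherits closure under coproducts; this gives the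
  decomposition by the \<open>\<T>\<^sub>i\<^sup>\<Coprod>\<close>.

  If \<open>\<L>\<close> is a small triangulated subcategory of compact objects, cellular approximation gives for each \<open>X\<close> a
  triangle \<open>c \<rightarrow> X \<rightarrow> d\<close> with \<open>c \<in> \<L>\<^sup>\<Coprod>\<close> and \<open>d \<in> \<L>\<^sup>\<bottom>\<close>.  With \<open>\<L>\<^sub>k\<close> generated by \<open>\<T>\<^sub>i\<close>, \<open>i < k\<close>,
  one has \<open>hat i = \<L>\<^sub>n\<^sub>-\<^sub>i\<^sup>\<bottom> \<inter> \<L>\<^sub>n\<^sub>+\<^sub>1\<^sub>-\<^sub>i\<^sup>\<Coprod>\<close>, and these triangles show inductively that \<open>hat 0, \<dots>, hat (i - 1)\<close>
  generate \<open>\<L>\<^sub>n\<^sub>+\<^sub>1\<^sub>-\<^sub>i\<^sup>\<bottom>\<close>.  The argument works inside any subcategory \<open>U\<close> closed under \<open>X \<mapsto> c, d\<close>.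
  For \<open>U = \<T>\<^sub>A\<close> and \<open>M \<in> \<T>\<close> with \<open>\<L>\<^sub>k\<close>-part \<open>m\<close>, closure under \<open>N \<mapsto> c\<close> follows from
  \<open>D(M, c) \<cong> D(m, c) \<cong> D(m, N)\<close>, and then \<open>d \<in> \<T>\<^sub>A\<close> by the long exact sequence.
\<close>

section \<open>Categories, additive categories and triangles\<close>

text \<open>The chain of the \<open>T_{<k}^\<Coprod>\<close> can be split into pieces in two ways.
  The left orthogonal complement of one step in the next is \<open>T_k^\<Coprod>\<close>. The right
  complement is \<open>hat (n - k)\<close>. Passing from left to right complements reverses the
  order of the pieces, hence the reversed indices of the hat family. Left complements come from
  generators, while right complements exist only because every object can be truncated; this is
  where smallness of \<open>T\<close> enters.

  Only the sets of morphisms out of \<open>T\<close> are small, so the truncations are built by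
  hand. Each stage is attached along a coproduct indexed by pairs of a representative
  \<open>M\<close> and a morphism out of \<open>M\<close>, which is small because \<kappa> is
  regular. The stages are glued by a countable coproduct, available because \<kappa> is uncountable.

  For the coproduct closure of a subcategory, the obstacle is that
  \<open>hat i \<inter> coproduct_hull \<kappa> C U\<close> has no evident generators. It is
  identified by rigidity: a semi-orthogonal family contained termwise in another one, with an object
  in its hull, already contains every piece to which that object belongs.\<close>

context is_category
begin

abbreviation comp (infixl "\<cdot>" 70) where "g \<cdot> f \<equiv> cmp C g f"

lemma Hom_objD: "f \<in> Hom C X Y \<Longrightarrow> X \<in> obj C" "f \<in> Hom C X Y \<Longrightarrow> Y \<in> obj C"
  using src_obj tgt_obj by (auto simp: Hom_def)

lemma Hom_src_tgt: "f \<in> Hom C X Y \<Longrightarrow> src C f = X" "f \<in> Hom C X Y \<Longrightarrow> tgt C f = Y"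
  by (auto simp: Hom_def)

lemma iso_arr_ident: "X \<in> obj C \<Longrightarrow> iso_arr C X X (ident C X)"
  unfolding iso_arr_def using ident_Hom cmp_ident_left by blast

lemma isomorphic_sym: "isomorphic C X Y \<Longrightarrow> isomorphic C Y X"
  unfolding isomorphic_def iso_arr_def by blast

lemma isomorphicD:
  assumes "isomorphic C X Y"
  obtains f g where "f \<in> Hom C X Y" "g \<in> Hom C Y X" "g \<cdot> f = ident C X" "f \<cdot> g = ident C Y"
  using assms unfolding isomorphic_def iso_arr_def by blast

lemma zero_obj_in_obj: "zero_obj C Z \<Longrightarrow> Z \<in> obj C"
  by (simp add: zero_obj_def)

lemma zero_obj_unique_to: "zero_obj C Z \<Longrightarrow> f \<in> Hom C X Z \<Longrightarrow> g \<in> Hom C X Z \<Longrightarrow> f = g"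
  unfolding zero_obj_def using Hom_objD by metis

lemma zero_obj_unique_from: "zero_obj C Z \<Longrightarrow> f \<in> Hom C Z X \<Longrightarrow> g \<in> Hom C Z X \<Longrightarrow> f = g"
  unfolding zero_obj_def using Hom_objD by metis

lemma zero_obj_isomorphic:
  assumes Z: "zero_obj C Z" and W: "zero_obj C W" shows "isomorphic C Z W"
proof -
  obtain f g where f: "f \<in> Hom C Z W" and g: "g \<in> Hom C W Z"
    using Z W unfolding zero_obj_def by metis
  have "g \<cdot> f = ident C Z" "f \<cdot> g = ident C W"
    using zero_obj_unique_to[OF Z cmp_Hom[OF f g] ident_Hom[OF zero_obj_in_obj[OF Z]]]
      zero_obj_unique_to[OF W cmp_Hom[OF g f] ident_Hom[OF zero_obj_in_obj[OF W]]] by blast+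
  with f g show ?thesis unfolding isomorphic_def iso_arr_def by blast
qed

end

section \<open>Arithmetic in the groups of morphisms\<close>

context additive_category
begin

abbreviation plus_arr (infixl "\<^bold>+" 65) where "f \<^bold>+ g \<equiv> add_arr C f g"
abbreviation zr where "zr X Y \<equiv> zero_arr C X Y"
abbreviation ng where "ng f \<equiv> neg_arr C f"

lemma hom_group_simps [simp]:
  "carrier (hom_group C X Y) = Hom C X Y" "mult (hom_group C X Y) = add_arr C"
  "one (hom_group C X Y) = zr X Y"
  by (simp_all add: hom_group_def)

lemma zero_Hom: "X \<in> obj C \<Longrightarrow> Y \<in> obj C \<Longrightarrow> zr X Y \<in> Hom C X Y"
  using hom_comm_group[of X Y] comm_group.axioms(2) group.is_monoid monoid.one_closed by fastforce

lemma hom_group_comm_group: "f \<in> Hom C X Y \<Longrightarrow> comm_group (hom_group C X Y)"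
  using hom_comm_group Hom_objD by blast

lemma hom_group_group: "f \<in> Hom C X Y \<Longrightarrow> group (hom_group C X Y)"
  using hom_group_comm_group comm_group.axioms(2) by blast

lemma add_Hom:
  assumes "f \<in> Hom C X Y" "g \<in> Hom C X Y" shows "f \<^bold>+ g \<in> Hom C X Y"
  using group.is_monoid[OF hom_group_group[OF assms(1)]] monoid.m_closed assms by fastforce

lemma add_assoc:
  assumes "f \<in> Hom C X Y" "g \<in> Hom C X Y" "h \<in> Hom C X Y"
  shows "f \<^bold>+ g \<^bold>+ h = f \<^bold>+ (g \<^bold>+ h)"
  using monoid.m_assoc[OF group.is_monoid[OF hom_group_group[OF assms(1)]], of f g h] assms by simp

lemma add_comm:
  assumes "f \<in> Hom C X Y" "g \<in> Hom C X Y" shows "f \<^bold>+ g = g \<^bold>+ f"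
  using comm_monoid.m_comm[OF comm_group.axioms(1)[OF hom_group_comm_group[OF assms(1)]], of f g] assms
      by simp

lemma add_zero:
  assumes "f \<in> Hom C X Y" shows "f \<^bold>+ zr X Y = f" "zr X Y \<^bold>+ f = f"
  using monoid.r_one[OF group.is_monoid[OF hom_group_group[OF assms]], of f]
    monoid.l_one[OF group.is_monoid[OF hom_group_group[OF assms]], of f] assms by simp_all

lemma neg_arr_eq: "f \<in> Hom C X Y \<Longrightarrow> ng f = inv\<^bsub>hom_group C X Y\<^esub> f"
  by (simp add: neg_arr_def Hom_src_tgt)

lemma neg_Hom:
  assumes "f \<in> Hom C X Y" shows "ng f \<in> Hom C X Y"
  using group.inv_closed[OF hom_group_group[OF assms], of f] assms by (simp add: neg_arr_eq)

lemma add_neg: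
  assumes "f \<in> Hom C X Y" shows "f \<^bold>+ ng f = zr X Y" "ng f \<^bold>+ f = zr X Y"
  using group.r_inv[OF hom_group_group[OF assms], of f]
    group.l_inv[OF hom_group_group[OF assms], of f] assms by (simp_all add: neg_arr_eq)

lemma add_left_cancel:
  assumes "f \<in> Hom C X Y" "g \<in> Hom C X Y" "h \<in> Hom C X Y" "f \<^bold>+ g = f \<^bold>+ h" shows "g = h"
  using group.right_cancel[OF hom_group_group[OF assms(1)], of f g h] assms add_comm by simp

lemma add_self_zero:
  assumes "f \<in> Hom C X Y" "f \<^bold>+ f = f" shows "f = zr X Y"
  using add_left_cancel[OF assms(1) assms(1) zero_Hom] add_zero assms Hom_objD by metis

lemma neg_unique:
  assumes "f \<in> Hom C X Y" "g \<in> Hom C X Y" "f \<^bold>+ g = zr X Y" shows "g = ng f"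
  using add_left_cancel[OF assms(1,2) neg_Hom[OF assms(1)]] add_neg assms by simp

lemma neg_neg: "f \<in> Hom C X Y \<Longrightarrow> ng (ng f) = f"
  using neg_unique[OF neg_Hom] add_neg by metis

lemma neg_zero: "X \<in> obj C \<Longrightarrow> Y \<in> obj C \<Longrightarrow> ng (zr X Y) = zr X Y"
  using neg_unique[OF zero_Hom zero_Hom] add_zero zero_Hom by metis

lemma diff_zero_eq:
  assumes "f \<in> Hom C X Y" "g \<in> Hom C X Y" "f \<^bold>+ ng g = zr X Y" shows "f = g"
  using neg_unique[OF neg_Hom[OF assms(2)] assms(1)] add_comm neg_neg neg_Hom assms by metis

lemma cmp_zero_right:
  assumes "g \<in> Hom C Y Z" "X \<in> obj C" shows "g \<cdot> zr X Y = zr X Z"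
proof -
  have z: "zr X Y \<in> Hom C X Y" using assms Hom_objD zero_Hom by blast
  show ?thesis
    using add_self_zero[OF cmp_Hom[OF z assms(1)]] cmp_add_right[OF z z assms(1)] add_zero[OF z] by simp
qed

lemma cmp_zero_left:
  assumes "f \<in> Hom C X Y" "Z \<in> obj C" shows "zr Y Z \<cdot> f = zr X Z"
proof -
  have z: "zr Y Z \<in> Hom C Y Z" using assms Hom_objD zero_Hom by blast
  show ?thesis
    using add_self_zero[OF cmp_Hom[OF assms(1) z]] cmp_add_left[OF assms(1) z z] add_zero[OF z] by simp
qed

lemma cmp_neg_right:
  assumes "f \<in> Hom C X Y" "g \<in> Hom C Y Z" shows "g \<cdot> ng f = ng (g \<cdot> f)"
proof (rule neg_unique[OF cmp_Hom[OF assms] cmp_Hom[OF neg_Hom[OF assms(1)] assms(2)]])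
  show "g \<cdot> f \<^bold>+ g \<cdot> ng f = zr X Z"
    using cmp_add_right[OF assms(1) neg_Hom[OF assms(1)] assms(2)] add_neg[OF assms(1)]
      cmp_zero_right[OF assms(2) Hom_objD(1)[OF assms(1)]] by simp
qed

lemma cmp_neg_left:
  assumes "f \<in> Hom C X Y" "g \<in> Hom C Y Z" shows "ng g \<cdot> f = ng (g \<cdot> f)"
proof (rule neg_unique[OF cmp_Hom[OF assms] cmp_Hom[OF assms(1) neg_Hom[OF assms(2)]]])
  show "g \<cdot> f \<^bold>+ ng g \<cdot> f = zr X Z"
    using cmp_add_left[OF assms(1,2) neg_Hom[OF assms(2)]] add_neg[OF assms(2)]
      cmp_zero_left[OF assms(1) Hom_objD(2)[OF assms(2)]] by simp
qed

lemma zero_objI: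
  assumes X: "X \<in> obj C" and i: "ident C X = zr X X" shows "zero_obj C X"
proof -
  have "f = zr X Y" if "f \<in> Hom C X Y" for f Y
    using cmp_ident_right[OF that] cmp_zero_right[OF that X] i by simp
  moreover have "f = zr Y X" if "f \<in> Hom C Y X" for f Y
    using cmp_ident_left[OF that] cmp_zero_left[OF that X] i by simp
  ultimately show ?thesis unfolding zero_obj_def using X zero_Hom[OF X] zero_Hom[OF _ X] by metis
qed

lemma Hom_from_zero_obj: "zero_obj C Z \<Longrightarrow> f \<in> Hom C Z X \<Longrightarrow> f = zr Z X"
  using zero_obj_unique_from zero_Hom Hom_objD by blast

lemma Hom_to_zero_obj: "zero_obj C Z \<Longrightarrow> f \<in> Hom C X Z \<Longrightarrow> f = zr X Z"
  using zero_obj_unique_to zero_Hom Hom_objD by blast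

lemma Hom_zeroI: "X \<in> obj C \<Longrightarrow> Y \<in> obj C \<Longrightarrow> (\<And>f. f \<in> Hom C X Y \<Longrightarrow> f = zr X Y) \<Longrightarrow> Hom C X Y = {zr X Y}"
  using zero_Hom by blast

lemma cmp_zeroD_iso:
  assumes "f \<in> Hom C X Y" "g \<in> Hom C Y X" "g \<cdot> f = ident C X" "W \<in> Hom C A X" "f \<cdot> W = zr A Y"
  shows "W = zr A X"
proof -
  have "W = g \<cdot> (f \<cdot> W)" using cmp_assoc[OF assms(4,1,2)] cmp_ident_left[OF assms(4)] assms(3) by simp
  then show ?thesis using cmp_zero_right[OF assms(2) Hom_objD(1)[OF assms(4)]] assms(5) by simp
qed

end

section \<open>Shifts, rotations and exactness of \<open>Hom\<close> along distinguished
  triangles\<close>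

context triangulated_category
begin

abbreviation sh where "sh X \<equiv> shift_obj C X"
abbreviation sa where "sa f \<equiv> shift_arr C f"

lemma shift_obj_in: "X \<in> obj C \<Longrightarrow> sh X \<in> obj C"
  using shift_functor by (simp add: is_functor_def)

lemma shift_Hom: "f \<in> Hom C X Y \<Longrightarrow> sa f \<in> Hom C (sh X) (sh Y)"
  using shift_functor by (simp add: is_functor_def)

lemma shift_cmp: "f \<in> Hom C X Y \<Longrightarrow> g \<in> Hom C Y Z \<Longrightarrow> sa (g \<cdot> f) = sa g \<cdot> sa f"
  using shift_functor unfolding is_functor_def by blast

lemma shift_ident: "X \<in> obj C \<Longrightarrow> sa (ident C X) = ident C (sh X)"
  using shift_functor by (simp add: is_functor_def)

lemma shift_obj_inj: "X \<in> obj C \<Longrightarrow> Y \<in> obj C \<Longrightarrow> sh X = sh Y \<Longrightarrow> X = Y"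
  using shift_obj_bij by (meson bij_betw_def inj_on_def)

lemma shift_obj_surj: "X \<in> obj C \<Longrightarrow> \<exists>Y \<in> obj C. sh Y = X"
  using shift_obj_bij by (metis bij_betw_def image_iff)

lemma shift_arr_inj: "f \<in> Hom C X Y \<Longrightarrow> g \<in> Hom C X' Y' \<Longrightarrow> sa f = sa g \<Longrightarrow> f = g"
  using shift_arr_bij unfolding bij_betw_def inj_on_def Hom_def by blast

lemma shift_arr_surj:
  assumes "g \<in> Hom C (sh X) (sh Y)" "X \<in> obj C" "Y \<in> obj C"
  shows "\<exists>f \<in> Hom C X Y. sa f = g"
proof -
  have "g \<in> arr C" using assms by (simp add: Hom_def)
  then obtain f where f: "f \<in> arr C" "sa f = g"
    using shift_arr_bij by (metis bij_betw_def image_iff)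
  have "f \<in> Hom C (src C f) (tgt C f)" using f by (simp add: Hom_def)
  then have "f \<in> Hom C X Y"
    using shift_Hom Hom_src_tgt f assms Hom_objD shift_obj_inj by metis
  with f show ?thesis by blast
qed

lemma shift_zero: "X \<in> obj C \<Longrightarrow> Y \<in> obj C \<Longrightarrow> sa (zr X Y) = zr (sh X) (sh Y)"
  by (rule add_self_zero) (metis shift_Hom shift_add add_zero zero_Hom)+

lemma shift_zero_iff: "f \<in> Hom C X Y \<Longrightarrow> sa f = zr (sh X) (sh Y) \<longleftrightarrow> f = zr X Y"
  by (metis shift_arr_inj shift_zero zero_Hom Hom_objD)

lemma zero_obj_shift:
  assumes "zero_obj C Z" shows "zero_obj C (sh Z)"
proof (rule zero_objI)
  have Z: "Z \<in> obj C" using assms zero_obj_in_obj by blast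
  then show "sh Z \<in> obj C" by (rule shift_obj_in)
  show "ident C (sh Z) = zr (sh Z) (sh Z)"
    using Hom_from_zero_obj[OF assms ident_Hom[OF Z]] shift_ident shift_zero Z by metis
qed

lemma dist_Hom:
  "dist_triangle C X Y Z f g h \<Longrightarrow> f \<in> Hom C X Y"
  "dist_triangle C X Y Z f g h \<Longrightarrow> g \<in> Hom C Y Z"
  "dist_triangle C X Y Z f g h \<Longrightarrow> h \<in> Hom C Z (sh X)"
  by (simp_all add: dist_triangle_def triangle_def)

lemma dist_obj:
  assumes "dist_triangle C X Y Z f g h" shows "X \<in> obj C" "Y \<in> obj C" "Z \<in> obj C"
  using dist_Hom[OF assms] Hom_objD by blast+

lemma dist_rot: "dist_triangle C X Y Z f g h \<Longrightarrow> dist_triangle C Y Z (sh X) g h (ng (sa f))"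
  using dist_rotate unfolding dist_triangle_def by blast

text \<open>The rotation axiom can be read backwards only when the first morphism is already at
  hand. It is recovered from \<open>k\<close> by desuspending, with the sign of the axiom
  absorbed.\<close>

lemma dist_unrot:
  assumes d: "dist_triangle C Y Z (sh X) g h k" and X: "X \<in> obj C"
  shows "\<exists>f. dist_triangle C X Y Z f g h \<and> k = ng (sa f)"
proof -
  have k: "k \<in> Hom C (sh X) (sh Y)" and Y: "Y \<in> obj C" using dist_Hom[OF d] dist_obj[OF d] by blast+
  obtain f where f: "f \<in> Hom C X Y" "sa f = ng k" using shift_arr_surj[OF neg_Hom[OF k] X Y] by blast
  then have k': "k = ng (sa f)" using neg_neg k by metis
  have "triangle C X Y Z f g h" using f dist_Hom[OF d] by (simp add: triangle_def)
  then show ?thesis using dist_rotate d k' by blast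
qed

lemma dist_zero_left:
  assumes W: "W \<in> obj C" shows "\<exists>Z f. zero_obj C Z \<and> dist_triangle C Z W W f (ident C W) (zr W (sh Z))"
proof -
  obtain Z where Z: "zero_obj C Z" using zero_obj_exists by blast
  have sZ: "zero_obj C (sh Z)" by (rule zero_obj_shift[OF Z])
  show ?thesis using dist_unrot[OF dist_ident[OF W sZ] zero_obj_in_obj[OF Z]] Z by blast
qed

text \<open>The trivial triangle on \<open>X\<close> maps to the given one by the identity and
  \<open>f\<close>. The induced third component starts at a zero object, so the composite factors
  through zero; rotation gives the second identity.\<close>

lemma dist_cmp_zero:
  assumes d: "dist_triangle C X Y Z f g h"
  shows "g \<cdot> f = zr X Z" "h \<cdot> g = zr Y (sh X)"
proof -
  have 1: "g \<cdot> f = zr X Z" if d: "dist_triangle C X Y Z f g h" for X Y Z f g h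
  proof -
    note H = dist_Hom[OF d] and O = dist_obj[OF d]
    obtain W where W: "zero_obj C W" using zero_obj_exists by blast
    obtain c where c: "c \<in> Hom C W Z" "g \<cdot> f = c \<cdot> zr X W"
      using dist_morphism[OF dist_ident[OF O(1) W] d ident_Hom[OF O(1)] H(1)] by blast
    then show ?thesis using cmp_zero_right O by simp
  qed
  show "g \<cdot> f = zr X Z" by (rule 1[OF d])
  show "h \<cdot> g = zr Y (sh X)" by (rule 1[OF dist_rot[OF d]])
qed

text \<open>Covariant exactness at \<open>Y\<close>. The rotated trivial triangle
  \<open>W -> 0 -> W[1]\<close> is mapped to the rotated given triangle by \<open>w\<close>; the
  third component \<open>W[1] -> X[1]\<close> desuspends to the lift. Each rotation contributes one
  sign, and the two cancel.\<close>

lemma dist_lift: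
  assumes d: "dist_triangle C X Y Z f g h" and w: "w \<in> Hom C W Y" "g \<cdot> w = zr W Z"
  shows "\<exists>v \<in> Hom C W X. f \<cdot> v = w"
proof -
  note H = dist_Hom[OF d] and O = dist_obj[OF d]
  have W: "W \<in> obj C" using Hom_objD w by blast
  obtain U where U: "zero_obj C U" using zero_obj_exists by blast
  note UO = zero_obj_in_obj[OF U]
  note dW = dist_rot[OF dist_ident[OF W U]]
  have z: "zr U Z \<in> Hom C U Z" by (rule zero_Hom[OF UO O(3)])
  have eq: "g \<cdot> w = zr U Z \<cdot> zr W U" using w(2) cmp_zero_right[OF z W] by simp
  obtain c where c: "c \<in> Hom C (sh W) (sh X)" "ng (sa f) \<cdot> c = sa w \<cdot> ng (sa (ident C W))"
    using dist_morphism[OF dW dist_rot[OF d] w(1) z eq] by blast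
  obtain v where v: "v \<in> Hom C W X" "sa v = c" using shift_arr_surj c(1) W O(1) by blast
  have "ng (sa f \<cdot> sa v) = ng (sa w \<cdot> ident C (sh W))"
    using c v cmp_neg_left[OF c(1) shift_Hom[OF H(1)]]
      cmp_neg_right[OF shift_Hom[OF ident_Hom[OF W]] shift_Hom[OF w(1)]] shift_ident[OF W] by simp
  then have "ng (sa (f \<cdot> v)) = ng (sa w)"
    using shift_cmp[OF v(1) H(1)] cmp_ident_right shift_Hom[OF w(1)] by simp
  then have "sa (f \<cdot> v) = sa w"
    using neg_neg shift_Hom[OF w(1)] shift_Hom[OF cmp_Hom[OF v(1) H(1)]] by metis
  then show ?thesis using v(1) shift_arr_inj[OF cmp_Hom[OF v(1) H(1)] w(1)] by blast
qed

text \<open>Contravariant exactness at \<open>Y\<close>. The comparison goes into a triangle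
  \<open>0 -> W -> W\<close> with the identity as its second map, so neither signs nor desuspension
  occur.\<close>

lemma dist_extend:
  assumes d: "dist_triangle C X Y Z f g h" and w: "w \<in> Hom C Y W" "w \<cdot> f = zr X W"
  shows "\<exists>v \<in> Hom C Z W. v \<cdot> g = w"
proof -
  note H = dist_Hom[OF d] and O = dist_obj[OF d]
  have W: "W \<in> obj C" using Hom_objD w by blast
  obtain U k where U: "zero_obj C U" and dW: "dist_triangle C U W W k (ident C W) (zr W (sh U))"
    using dist_zero_left[OF W] by blast
  have UO: "U \<in> obj C" using U zero_obj_in_obj by blast
  have eq: "k \<cdot> zr X U = w \<cdot> f" using w(2) cmp_zero_right dist_Hom(1)[OF dW] O(1) by simp
  obtain c where "c \<in> Hom C Z W" "ident C W \<cdot> w = c \<cdot> g"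
    using dist_morphism[OF d dW zero_Hom[OF O(1) UO] w(1) eq] by blast
  then show ?thesis using cmp_ident_left[OF w(1)] by auto
qed

lemma dist_extend_shift:
  assumes d: "dist_triangle C X Y Z f g h" and w: "w \<in> Hom C Z W" "w \<cdot> g = zr Y W"
  shows "\<exists>v \<in> Hom C (sh X) W. v \<cdot> h = w"
  using dist_extend[OF dist_rot[OF d]] w by blast

lemma dist_lift_mid:
  assumes d: "dist_triangle C X Y Z f g h" and w: "w \<in> Hom C W Z" "h \<cdot> w = zr W (sh X)"
  shows "\<exists>v \<in> Hom C W Y. g \<cdot> v = w"
  using dist_lift[OF dist_rot[OF d]] w by blast

lemma dist_lift_shift:
  assumes d: "dist_triangle C X Y Z f g h" and w: "w \<in> Hom C W (sh X)" "sa f \<cdot> w = zr W (sh Y)"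
  shows "\<exists>v \<in> Hom C W Z. h \<cdot> v = w"
proof -
  have "ng (sa f) \<cdot> w = zr W (sh Y)"
    using cmp_neg_left[OF w(1) shift_Hom[OF dist_Hom(1)[OF d]]] w neg_zero Hom_objD dist_obj[OF d] shift_obj_in
    by metis
  then show ?thesis using dist_lift[OF dist_rot[OF dist_rot[OF d]] w(1)] by blast
qed

lemma dist_extend_shift2:
  assumes d: "dist_triangle C X Y Z f g h" and w: "w \<in> Hom C (sh X) W" "w \<cdot> h = zr Z W"
  shows "\<exists>v \<in> Hom C (sh Y) W. v \<cdot> sa f = w"
proof -
  obtain v where v: "v \<in> Hom C (sh Y) W" "v \<cdot> ng (sa f) = w"
    using dist_extend[OF dist_rot[OF dist_rot[OF d]] w] by blast
  have "ng v \<cdot> sa f = w"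
    using v cmp_neg_left cmp_neg_right shift_Hom[OF dist_Hom(1)[OF d]] by metis
  then show ?thesis using neg_Hom v(1) by blast
qed

text \<open>Generation and extension arguments need only the vertices of a triangle. Forgetting the
  morphisms makes rotation and shift into plain equivalences without signs.\<close>

definition tri :: "'o \<Rightarrow> 'o \<Rightarrow> 'o \<Rightarrow> bool" where
  "tri X Y Z \<longleftrightarrow> (\<exists>f g h. dist_triangle C X Y Z f g h)"

lemma tri_obj: "tri X Y Z \<Longrightarrow> X \<in> obj C" "tri X Y Z \<Longrightarrow> Y \<in> obj C" "tri X Y Z \<Longrightarrow> Z \<in> obj C"
  unfolding tri_def using dist_obj by blast+

lemma tri_rot: "X \<in> obj C \<Longrightarrow> tri X Y Z \<longleftrightarrow> tri Y Z (sh X)"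
  unfolding tri_def using dist_rot dist_unrot by metis

text \<open>Three rotations shift every vertex once.\<close>

lemma tri_shift:
  assumes "X \<in> obj C" "Y \<in> obj C" "Z \<in> obj C"
  shows "tri (sh X) (sh Y) (sh Z) \<longleftrightarrow> tri X Y Z"
  using tri_rot[OF assms(1), of Y Z] tri_rot[OF assms(2), of Z "sh X"] tri_rot[OF assms(3), of "sh X" "sh Y"]
  by simp

end

section \<open>Extensions of subcategories and orthogonality\<close>

context triangulated_category
begin

lemma tri_iso_middle:
  assumes "tri X Y Z" "isomorphic C Y Y'" shows "tri X Y' Z"
proof -
  obtain f g h where d: "dist_triangle C X Y Z f g h" using assms tri_def by blast
  note H = dist_Hom[OF d] and O = dist_obj[OF d]
  obtain a b where ab: "a \<in> Hom C Y Y'" "b \<in> Hom C Y' Y" "b \<cdot> a = ident C Y" "a \<cdot> b = ident C Y'"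
    using assms(2) isomorphicD by metis
  have "triangle C X Y' Z (a \<cdot> f) (g \<cdot> b) h" using H ab cmp_Hom by (auto simp: triangle_def)
  moreover have "iso_arr C Y Y' a" using ab by (auto simp: iso_arr_def)
  moreover have "a \<cdot> f \<cdot> ident C X = a \<cdot> f" using cmp_ident_right cmp_Hom H ab by blast
  moreover have "g \<cdot> b \<cdot> a = ident C Z \<cdot> g"
    using cmp_assoc[OF ab(1,2) H(2)] cmp_ident_right cmp_ident_left H ab by metis
  moreover have "h \<cdot> ident C Z = sa (ident C X) \<cdot> h"
    using H O shift_ident cmp_ident_left cmp_ident_right by metis
  ultimately have "dist_triangle C X Y' Z (a \<cdot> f) (g \<cdot> b) h"
    using dist_iso[OF d _ iso_arr_ident[OF O(1)] _ iso_arr_ident[OF O(3)]] by blast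
  then show ?thesis using tri_def by blast
qed

lemma isomorphic_in_obj: "isomorphic C X Y \<Longrightarrow> X \<in> obj C" "isomorphic C X Y \<Longrightarrow> Y \<in> obj C"
  unfolding isomorphic_def iso_arr_def using Hom_objD by blast+

lemma tri_zero_right: "X \<in> obj C \<Longrightarrow> zero_obj C Z \<Longrightarrow> tri X X Z"
  unfolding tri_def using dist_ident by blast

lemma tri_zero_left: "X \<in> obj C \<Longrightarrow> zero_obj C Z \<Longrightarrow> tri Z X X"
  using tri_rot tri_zero_right zero_obj_shift zero_obj_in_obj by blast

lemma tri_subcatI:
  assumes sub: "S \<subseteq> obj C" and Z: "\<And>Z. zero_obj C Z \<Longrightarrow> Z \<in> S"
    and iso: "\<And>X Y. X \<in> S \<Longrightarrow> isomorphic C X Y \<Longrightarrow> Y \<in> S"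
    and s1: "\<And>X. X \<in> S \<Longrightarrow> sh X \<in> S" and s2: "\<And>X. X \<in> obj C \<Longrightarrow> sh X \<in> S \<Longrightarrow> X \<in> S"
    and tri: "\<And>X Y Z. X \<in> S \<Longrightarrow> Y \<in> S \<Longrightarrow> tri X Y Z \<Longrightarrow> Z \<in> S"
  shows "tri_subcat C S"
proof -
  obtain Z where "zero_obj C Z" using zero_obj_exists by blast
  then have 1: "\<exists>Z\<in>S. zero_obj C Z" using Z by blast
  have 2: "\<forall>X\<in>S. \<forall>Y\<in>obj C. isomorphic C X Y \<longrightarrow> Y \<in> S" using iso by simp
  have 3: "\<forall>X\<in>obj C. (sh X \<in> S) = (X \<in> S)" using s1 s2 by metis
  have 4: "\<forall>X\<in>S. \<forall>Y\<in>S. \<forall>Z f g h. dist_triangle C X Y Z f g h \<longrightarrow> Z \<in> S"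
    using tri unfolding tri_def by metis
  show ?thesis unfolding tri_subcat_def by (intro conjI sub 1 2 3 4)
qed

lemma tri_subcatD:
  assumes "tri_subcat C S"
  shows "S \<subseteq> obj C"
    "X \<in> S \<Longrightarrow> isomorphic C X Y \<Longrightarrow> Y \<in> S"
    "X \<in> S \<Longrightarrow> sh X \<in> S"
    "X \<in> obj C \<Longrightarrow> sh X \<in> S \<Longrightarrow> X \<in> S"
    "X \<in> S \<Longrightarrow> Y \<in> S \<Longrightarrow> tri X Y Z \<Longrightarrow> Z \<in> S"
    "zero_obj C Z \<Longrightarrow> Z \<in> S"
proof -
  show a: "S \<subseteq> obj C" using assms by (simp add: tri_subcat_def)
  show b: "Y \<in> S" if "X \<in> S" "isomorphic C X Y" for X Y
    using assms that isomorphic_in_obj unfolding tri_subcat_def by blast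
  show "X \<in> S \<Longrightarrow> sh X \<in> S" using assms a unfolding tri_subcat_def by blast
  show "X \<in> obj C \<Longrightarrow> sh X \<in> S \<Longrightarrow> X \<in> S" using assms unfolding tri_subcat_def by blast
  show "X \<in> S \<Longrightarrow> Y \<in> S \<Longrightarrow> tri X Y Z \<Longrightarrow> Z \<in> S" using assms unfolding tri_subcat_def tri_def by blast
  show "zero_obj C Z \<Longrightarrow> Z \<in> S"
    using assms b zero_obj_isomorphic unfolding tri_subcat_def by blast
qed

lemma tri_subcat_left:
  assumes "tri_subcat C S" "tri X Y Z" "Y \<in> S" "Z \<in> S" shows "X \<in> S"
  using tri_subcatD(4,5)[OF assms(1)] tri_rot[of X Y Z] tri_obj(1)[OF assms(2)] assms by metis

lemma tri_subcat_middle: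
  assumes "tri_subcat C S" "tri X Y Z" "X \<in> S" "Z \<in> S" shows "Y \<in> S"
  using tri_subcat_left[OF assms(1), of Y Z "sh X"] tri_subcatD(3)[OF assms(1)] tri_rot[of X Y Z]
    tri_obj(1)[OF assms(2)] assms by metis

lemma tri_subcat_obj: "tri_subcat C (obj C)"
  by (rule tri_subcatI) (use zero_obj_in_obj isomorphic_in_obj shift_obj_in tri_obj in blast)+

lemma tri_subcat_Inter:
  assumes "\<And>S. S \<in> F \<Longrightarrow> tri_subcat C S" "F \<noteq> {}" shows "tri_subcat C (\<Inter>F)"
proof (rule tri_subcatI)
  show "\<Inter>F \<subseteq> obj C" using assms tri_subcatD(1) by blast
next
  fix Z assume "zero_obj C Z" then show "Z \<in> \<Inter>F" using tri_subcatD(6)[OF assms(1)] by blast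
next
  fix X Y assume "X \<in> \<Inter>F" "isomorphic C X Y"
  then show "Y \<in> \<Inter>F" using tri_subcatD(2)[OF assms(1)] by blast
next
  fix X assume "X \<in> \<Inter>F" then show "sh X \<in> \<Inter>F" using tri_subcatD(3)[OF assms(1)] by blast
next
  fix X assume "X \<in> obj C" "sh X \<in> \<Inter>F" then show "X \<in> \<Inter>F" using tri_subcatD(4)[OF assms(1)] by blast
next
  fix X Y Z assume "X \<in> \<Inter>F" "Y \<in> \<Inter>F" "tri X Y Z"
  then show "Z \<in> \<Inter>F" using tri_subcatD(5)[OF assms(1)] by blast
qed

lemma tri_subcat_Int: "tri_subcat C S \<Longrightarrow> tri_subcat C S' \<Longrightarrow> tri_subcat C (S \<inter> S')"
  using tri_subcat_Inter[of "{S, S'}"] by auto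

lemma tri_subcat_tri_hull: "G \<subseteq> obj C \<Longrightarrow> tri_subcat C (tri_hull C G)"
  unfolding tri_hull_def by (rule tri_subcat_Inter) (use tri_subcat_obj in blast)+

lemma tri_hull_superset: "G \<subseteq> tri_hull C G"
  unfolding tri_hull_def by blast

lemma tri_hull_least: "tri_subcat C S \<Longrightarrow> G \<subseteq> S \<Longrightarrow> tri_hull C G \<subseteq> S"
  unfolding tri_hull_def by blast

lemma tri_hull_mono: "G \<subseteq> G' \<Longrightarrow> tri_hull C G \<subseteq> tri_hull C G'"
  unfolding tri_hull_def by blast

lemma tri_hull_idem: "tri_subcat C S \<Longrightarrow> tri_hull C S = S"
  using tri_hull_least tri_hull_superset by blast

text \<open>For cones: if \<open>Y\<close> is zero, the identity of \<open>Z\<close> vanishes on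
  \<open>Y\<close>, hence factors through \<open>X[1]\<close>, which is zero as well. The zero
  objects are the hull of the empty family, that is, the bottom of every filtration below.\<close>

lemma tri_subcat_zero: "tri_subcat C {Z. zero_obj C Z}"
proof (rule tri_subcatI)
  fix X Y assume X: "X \<in> {Z. zero_obj C Z}" and i: "isomorphic C X Y"
  obtain f g where "f \<in> Hom C X Y" "g \<in> Hom C Y X" "f \<cdot> g = ident C Y"
    using isomorphicD[OF i] by metis
  then have "ident C Y = zr Y Y"
    using X Hom_from_zero_obj cmp_zero_left Hom_objD by (metis mem_Collect_eq)
  then show "Y \<in> {Z. zero_obj C Z}" using zero_objI i isomorphic_in_obj by blast
next
  fix X assume X: "X \<in> obj C" and "sh X \<in> {Z. zero_obj C Z}"
  then have "sa (ident C X) = zr (sh X) (sh X)"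
    using Hom_from_zero_obj ident_Hom shift_Hom by blast
  then have "ident C X = zr X X" using shift_zero_iff ident_Hom X by blast
  then show "X \<in> {Z. zero_obj C Z}" using X zero_objI by blast
next
  fix X Y Z assume X: "X \<in> {Z. zero_obj C Z}" and Y: "Y \<in> {Z. zero_obj C Z}" and t: "tri X Y Z"
  obtain f g h where d: "dist_triangle C X Y Z f g h" using t tri_def by blast
  note H = dist_Hom[OF d] and O = dist_obj[OF d]
  have "ident C Z \<cdot> g = zr Y Z" using H(2) O(3) Y Hom_from_zero_obj cmp_Hom ident_Hom by blast
  then obtain v where v: "v \<in> Hom C (sh X) Z" "v \<cdot> h = ident C Z"
    using dist_extend_shift[OF d ident_Hom[OF O(3)]] by blast
  moreover have "h = zr Z (sh X)" using H X zero_obj_shift Hom_to_zero_obj by blast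
  ultimately have "ident C Z = zr Z Z" using cmp_zero_right O by metis
  then show "Z \<in> {Z. zero_obj C Z}" using O zero_objI by blast
qed (use zero_obj_in_obj zero_obj_shift in blast)+

lemma tri_hull_empty: "tri_hull C {} = {Z. zero_obj C Z}"
proof
  show "tri_hull C {} \<subseteq> {Z. zero_obj C Z}" using tri_hull_least[OF tri_subcat_zero] by blast
  show "{Z. zero_obj C Z} \<subseteq> tri_hull C {}" unfolding tri_hull_def using tri_subcatD(6) by blast
qed

section \<open>The extension product of Beilinson, Bernstein and Deligne\<close>

definition star :: "'o set \<Rightarrow> 'o set \<Rightarrow> 'o set" where
  "star U V = {X. \<exists>u \<in> U. \<exists>v \<in> V. tri u X v}"

lemma tri_comp_octahedron:
  assumes "dist_triangle C X Y Z' f u1 v1" "dist_triangle C Y Z X' g u3 v3"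
  shows "\<exists>Y'. tri X Z Y' \<and> tri Z' Y' X'"
proof -
  obtain Y' u2 v2 where d: "dist_triangle C X Z Y' (g \<cdot> f) u2 v2"
    using cone_exists[OF cmp_Hom[OF dist_Hom(1)[OF assms(1)] dist_Hom(1)[OF assms(2)]]] by blast
  then show ?thesis using octahedron[OF assms d] tri_def by blast
qed

text \<open>The octahedron for the composite \<open>a -> u -> X\<close>.\<close>

lemma star_assoc1:
  assumes "X \<in> star (star A B) V" shows "X \<in> star A (star B V)"
proof -
  obtain u v a b where "a \<in> A" "b \<in> B" "v \<in> V" "tri a u b" "tri u X v"
    using assms unfolding star_def by blast
  moreover then obtain Y' where "tri a X Y'" "tri b Y' v" using tri_comp_octahedron unfolding tri_def by metis
  ultimately show ?thesis unfolding star_def by blast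
qed

text \<open>The octahedron for the composite \<open>X -> u -> v\<close>. It delivers the new middle
  object as an extension \<open>w\<close> of \<open>b[1]\<close> by \<open>a[1]\<close>, which is
  then desuspended.\<close>

lemma star_assoc2:
  assumes "X \<in> star A (star B V)" "A \<subseteq> obj C" shows "X \<in> star (star A B) V"
proof -
  obtain a u b v where 1: "a \<in> A" "b \<in> B" "v \<in> V" "tri a X u" "tri b u v"
    using assms unfolding star_def by blast
  obtain w where w: "tri X v w" "tri (sh a) w (sh b)"
  proof -
    obtain f1 g1 h1 where d1: "dist_triangle C a X u f1 g1 h1" using 1 tri_def by blast
    obtain f2 g2 h2 where d2: "dist_triangle C b u v f2 g2 h2" using 1 tri_def by blast
    from tri_comp_octahedron[OF dist_rot[OF d1] dist_rot[OF d2]] that show ?thesis by blast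
  qed
  obtain w' where w': "w' \<in> obj C" "sh w' = w" using shift_obj_surj tri_obj w by blast
  have "tri a w' b" using tri_shift[of a w' b] w w' 1 tri_obj by blast
  moreover have "tri w' X v" using tri_rot[of w' X v] w w' by blast
  ultimately show ?thesis using 1 unfolding star_def by blast
qed

lemma star_mono: "U \<subseteq> U' \<Longrightarrow> V \<subseteq> V' \<Longrightarrow> star U V \<subseteq> star U' V'"
  unfolding star_def by blast

lemma star_in_obj: "star U V \<subseteq> obj C"
  unfolding star_def using tri_obj by blast

lemma star_subset_tri_subcat: "tri_subcat C S \<Longrightarrow> U \<subseteq> S \<Longrightarrow> V \<subseteq> S \<Longrightarrow> star U V \<subseteq> S"
  unfolding star_def using tri_subcat_middle by blast

lemma star_self: "tri_subcat C S \<Longrightarrow> star S S = S"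
proof
  assume S: "tri_subcat C S"
  show "star S S \<subseteq> S" using S star_subset_tri_subcat by blast
  show "S \<subseteq> star S S"
    unfolding star_def using tri_zero_left tri_subcatD(1,6)[OF S] zero_obj_exists by blast
qed

lemma star_left: "tri_subcat C A \<Longrightarrow> B \<subseteq> obj C \<Longrightarrow> B \<subseteq> star B A"
  unfolding star_def using tri_subcatD(6) zero_obj_exists tri_zero_right by blast

lemma star_right: "tri_subcat C B \<Longrightarrow> A \<subseteq> obj C \<Longrightarrow> A \<subseteq> star B A"
  unfolding star_def using tri_subcatD(6) zero_obj_exists tri_zero_left by blast

section \<open>Orthogonality and semi-orthogonal extensions\<close>

definition orth :: "'o set \<Rightarrow> 'o set \<Rightarrow> bool" where
  "orth B A \<longleftrightarrow> (\<forall>X \<in> B. \<forall>Y \<in> A. Hom C X Y = {zr X Y})"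

lemma orthD: "orth B A \<Longrightarrow> X \<in> B \<Longrightarrow> Y \<in> A \<Longrightarrow> f \<in> Hom C X Y \<Longrightarrow> f = zr X Y"
  unfolding orth_def by blast

lemma orth_mono: "orth B A \<Longrightarrow> B' \<subseteq> B \<Longrightarrow> A' \<subseteq> A \<Longrightarrow> orth B' A'"
  unfolding orth_def by blast

text \<open>A triangle whose connecting morphism vanishes splits, so its outer terms may be exchanged.\<close>

lemma star_swap:
  assumes A: "tri_subcat C A" and B: "tri_subcat C B" and o: "orth B A"
  shows "star A B \<subseteq> star B A"
proof
  fix x assume "x \<in> star A B"
  then obtain a b f p h where ab: "a \<in> A" "b \<in> B" and d: "dist_triangle C a x b f p h"
    unfolding star_def tri_def by blast
  note H = dist_Hom[OF d] and O = dist_obj[OF d]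
  have h0: "h = zr b (sh a)" using orthD[OF o ab(2) tri_subcatD(3)[OF A ab(1)]] H by blast
  obtain s where s: "s \<in> Hom C b x" "p \<cdot> s = ident C b"
    using dist_lift_mid[OF d ident_Hom[OF O(3)]] h0 cmp_ident_right H by metis
  \<comment> \<open>The octahedron for \<open>p \<cdot> s = ident C b\<close>, whose cone is zero,
    places the cone \<open>c\<close> of the section in a triangle \<open>c -> 0 -> a[1]\<close>.
    Hence \<open>c\<close> lies in \<open>A\<close>, and \<open>b -> x -> c\<close> is the exchanged
    triangle.\<close>
  obtain c u v where dc: "dist_triangle C b x c s u v" using cone_exists s by blast
  obtain Z where Z: "zero_obj C Z" using zero_obj_exists by blast
  have "dist_triangle C b b Z (p \<cdot> s) (zr b Z) (zr Z (sh b))" using dist_ident[OF O(3) Z] s by simp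
  then have "tri c Z (sh a)" using octahedron[OF dc dist_rot[OF d]] tri_def by blast
  then have "c \<in> A"
    using tri_subcat_left[OF A] tri_subcatD(6)[OF A] Z tri_subcatD(3)[OF A ab(1)] by blast
  then show "x \<in> star B A" unfolding star_def tri_def using dc ab by blast
qed

text \<open>A cone of \<open>X -> Y\<close> is an extension of \<open>X[1]\<close> by
  \<open>Y\<close>, so closure under shifts and extensions suffices. In the product of two copies of
  \<open>star B A\<close> the inner factors stand in the wrong order; after the exchange, equal
  neighbours collapse by \<open>star_self\<close>.\<close>

lemma star_tri_subcat:
  assumes A: "tri_subcat C A" and B: "tri_subcat C B" and o: "orth B A"
  shows "tri_subcat C (star B A)"
proof -
  have ext: "star (star B A) (star B A) \<subseteq> star B A"
  proof
    fix x assume "x \<in> star (star B A) (star B A)"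
    then have "x \<in> star B (star A (star B A))" by (rule star_assoc1)
    moreover have "star A (star B A) \<subseteq> star (star A B) A"
      using star_assoc2 tri_subcatD(1)[OF A] by blast
    moreover have "\<dots> \<subseteq> star (star B A) A" using star_mono star_swap assms by blast
    moreover have "\<dots> \<subseteq> star B (star A A)" using star_assoc1 by blast
    ultimately have "star A (star B A) \<subseteq> star B A" using star_self[OF A] by simp
    with \<open>x \<in> star B (star A (star B A))\<close> have "x \<in> star B (star B A)" using star_mono[of B B] by blast
    then have "x \<in> star (star B B) A" using star_assoc2 tri_subcatD(1)[OF B] by blast
    then show "x \<in> star B A" using star_self[OF B] by simp
  qed
  have s1: "sh X \<in> star B A" if X: "X \<in> star B A" for X
  proof -
    obtain b a where ba: "b \<in> B" "a \<in> A" "tri b X a" using X unfolding star_def by blast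
    then have "tri (sh b) (sh X) (sh a)" using tri_shift[OF tri_obj[OF ba(3)]] by simp
    then show ?thesis unfolding star_def using tri_subcatD(3)[OF A ba(2)] tri_subcatD(3)[OF B ba(1)] by blast
  qed
  show ?thesis
  proof (rule tri_subcatI)
    show "star B A \<subseteq> obj C" by (rule star_in_obj)
    show "Z \<in> star B A" if "zero_obj C Z" for Z
      using that star_left[OF A tri_subcatD(1)[OF B]] tri_subcatD(6)[OF B] by blast
    show "Y \<in> star B A" if "X \<in> star B A" "isomorphic C X Y" for X Y
      using that tri_iso_middle unfolding star_def by blast
    show "sh X \<in> star B A" if X: "X \<in> star B A" for X using X by (rule s1)
    show "X \<in> star B A" if X: "X \<in> obj C" "sh X \<in> star B A" for X
    proof -
      obtain b a where ba: "b \<in> B" "a \<in> A" "tri b (sh X) a" using X unfolding star_def by blast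
      obtain b' a' where b': "b' \<in> obj C" "sh b' = b" "a' \<in> obj C" "sh a' = a"
        using shift_obj_surj[OF tri_obj(1)[OF ba(3)]] shift_obj_surj[OF tri_obj(3)[OF ba(3)]] by metis
      then have "tri b' X a'" using tri_shift[of b' X a'] ba X by simp
      moreover have "b' \<in> B" "a' \<in> A"
        using b' ba tri_subcatD(4)[OF B b'(1)] tri_subcatD(4)[OF A b'(3)] by simp_all
      ultimately show ?thesis unfolding star_def by blast
    qed
    show "Z \<in> star B A" if "X \<in> star B A" "Y \<in> star B A" "tri X Y Z" for X Y Z
    proof -
      have "tri Y Z (sh X)" using that(3) tri_rot[OF tri_obj(1)[OF that(3)]] by simp
      then have "Z \<in> star (star B A) (star B A)" unfolding star_def[of "star B A"]
          using s1[OF that(1)] that(2) by blast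
      then show ?thesis using ext by blast
    qed
  qed
qed

lemma tri_hull_Un:
  assumes A: "tri_subcat C A" and B: "tri_subcat C B" and o: "orth B A"
  shows "tri_hull C (B \<union> A) = star B A"
proof
  show "tri_hull C (B \<union> A) \<subseteq> star B A"
    using tri_hull_least[OF star_tri_subcat[OF assms]] star_left[OF A tri_subcatD(1)[OF B]]
      star_right[OF B tri_subcatD(1)[OF A]] by simp
  have "B \<union> A \<subseteq> obj C" using tri_subcatD(1)[OF A] tri_subcatD(1)[OF B] by simp
  then show "star B A \<subseteq> tri_hull C (B \<union> A)"
    using star_subset_tri_subcat[OF tri_subcat_tri_hull] tri_hull_superset[of "B \<union> A"] by simp
qed

lemma tri_hull_Un_hull:
  assumes G: "G \<subseteq> obj C" and G': "G' \<subseteq> obj C"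
  shows "tri_hull C (G \<union> G') = tri_hull C (tri_hull C G \<union> tri_hull C G')"
proof
  show "tri_hull C (G \<union> G') \<subseteq> tri_hull C (tri_hull C G \<union> tri_hull C G')"
    using tri_hull_mono[of "G \<union> G'"] tri_hull_superset[of G] tri_hull_superset[of G']
        by (simp add: le_supI1 le_supI2 sup_mono)
  show "tri_hull C (tri_hull C G \<union> tri_hull C G') \<subseteq> tri_hull C (G \<union> G')"
    using tri_hull_least[OF tri_subcat_tri_hull, of "G \<union> G'"] tri_hull_mono[of G "G \<union> G'"]
      tri_hull_mono[of G' "G \<union> G'"] assms by simp
qed

section \<open>Orthogonals as triangulated subcategories\<close>

definition left_perp :: "'o set \<Rightarrow> 'o set" where
  "left_perp B = {X \<in> obj C. \<forall>Y \<in> B. Hom C X Y = {zr X Y}}"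

text \<open>A morphism from \<open>X\<close> to \<open>Y[1]\<close> desuspends to one from
  \<open>X[-1]\<close>, which lies in \<open>A\<close> again. A morphism to a cone vanishes in
  \<open>Y1[1]\<close> for this reason, hence lifts to \<open>Y2\<close>, where it is zero.\<close>

lemma tri_subcat_right_perp:
  assumes A: "tri_subcat C A" shows "tri_subcat C (right_perp C A (obj C))"
proof -
  have I: "Y \<in> right_perp C A (obj C)"
    if "Y \<in> obj C" "\<And>X f. X \<in> A \<Longrightarrow> f \<in> Hom C X Y \<Longrightarrow> f = zr X Y" for Y
    using that Hom_zeroI tri_subcatD(1)[OF A] unfolding right_perp_def by blast
  have E: "f = zr X Y" if "Y \<in> right_perp C A (obj C)" "X \<in> A" "f \<in> Hom C X Y" for X Y f
    using that unfolding right_perp_def by blast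
  have O: "Y \<in> obj C" if "Y \<in> right_perp C A (obj C)" for Y using that unfolding right_perp_def by blast
  show ?thesis
  proof (rule tri_subcatI)
    show "right_perp C A (obj C) \<subseteq> obj C" using O by blast
    show "Z \<in> right_perp C A (obj C)" if "zero_obj C Z" for Z
      using that by (intro I) (use zero_obj_in_obj Hom_to_zero_obj in blast)+
    show "Y \<in> right_perp C A (obj C)" if Y: "Y' \<in> right_perp C A (obj C)" and i: "isomorphic C Y' Y" for Y' Y
    proof (rule I)
      obtain f g where fg: "f \<in> Hom C Y Y'" "g \<in> Hom C Y' Y" "g \<cdot> f = ident C Y"
        using isomorphicD[OF isomorphic_sym[OF i]] by metis
      show "Y \<in> obj C" using fg Hom_objD by blast
      show "w = zr X Y" if w: "X \<in> A" "w \<in> Hom C X Y" for X w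
        using cmp_zeroD_iso[OF fg w(2)] E[OF Y w(1) cmp_Hom[OF w(2) fg(1)]] by blast
    qed
    show "sh Y \<in> right_perp C A (obj C)" if Y: "Y \<in> right_perp C A (obj C)" for Y
    proof (rule I)
      show "sh Y \<in> obj C" using O[OF Y] shift_obj_in by blast
      show "w = zr X (sh Y)" if w: "X \<in> A" "w \<in> Hom C X (sh Y)" for X w
      proof -
        obtain X' where X': "X' \<in> obj C" "sh X' = X" using shift_obj_surj w Hom_objD by blast
        then obtain v where v: "v \<in> Hom C X' Y" "sa v = w" using shift_arr_surj w O[OF Y] by blast
        have "X' \<in> A" using tri_subcatD(4)[OF A] X' w by blast
        then show ?thesis using E[OF Y _ v(1)] v shift_zero X' O[OF Y] by metis
      qed
    qed
    show "Y \<in> right_perp C A (obj C)" if Y: "Y \<in> obj C" "sh Y \<in> right_perp C A (obj C)" for Y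
    proof (rule I)
      show "w = zr X Y" if w: "X \<in> A" "w \<in> Hom C X Y" for X w
        using E[OF Y(2) tri_subcatD(3)[OF A w(1)] shift_Hom[OF w(2)]] shift_zero_iff w by blast
    qed (rule Y)
    show "Y3 \<in> right_perp C A (obj C)"
      if Y: "Y1 \<in> right_perp C A (obj C)" "Y2 \<in> right_perp C A (obj C)" "tri Y1 Y2 Y3" for Y1 Y2 Y3
    proof (rule I)
      show "Y3 \<in> obj C" using Y tri_obj by blast
      obtain f g h where d: "dist_triangle C Y1 Y2 Y3 f g h" using Y tri_def by blast
      show "w = zr X Y3" if w: "X \<in> A" "w \<in> Hom C X Y3" for X w
      proof -
        obtain X' where X': "X' \<in> obj C" "sh X' = X" using shift_obj_surj w Hom_objD by blast
        have X'A: "X' \<in> A" using tri_subcatD(4)[OF A] X' w by blast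
        obtain v where v: "v \<in> Hom C X' Y1" "sa v = h \<cdot> w"
          using shift_arr_surj X' O[OF Y(1)] cmp_Hom[OF w(2) dist_Hom(3)[OF d]] by blast
        have "h \<cdot> w = zr X (sh Y1)" using v E[OF Y(1) X'A v(1)] shift_zero X' O[OF Y(1)] by metis
        then obtain u where u: "u \<in> Hom C X Y2" "g \<cdot> u = w" using dist_lift_mid[OF d w(2)] by blast
        then show ?thesis using E[OF Y(2) w(1) u(1)] cmp_zero_right dist_Hom(2)[OF d] w(2) Hom_objD by metis
      qed
    qed
  qed
qed

text \<open>Dually, a morphism out of a cone vanishes on \<open>X2\<close>, hence factors through
  \<open>X1[1]\<close>; desuspending turns that factor into a morphism from \<open>X1\<close> to an
  object of \<open>B\<close>.\<close>

lemma tri_subcat_left_perp: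
  assumes B: "tri_subcat C B" shows "tri_subcat C (left_perp B)"
proof -
  have I: "X \<in> left_perp B"
    if "X \<in> obj C" "\<And>Y f. Y \<in> B \<Longrightarrow> f \<in> Hom C X Y \<Longrightarrow> f = zr X Y" for X
    using that Hom_zeroI tri_subcatD(1)[OF B] unfolding left_perp_def by blast
  have E: "f = zr X Y" if "X \<in> left_perp B" "Y \<in> B" "f \<in> Hom C X Y" for X Y f
    using that unfolding left_perp_def by blast
  have O: "X \<in> obj C" if "X \<in> left_perp B" for X using that unfolding left_perp_def by blast
  show ?thesis
  proof (rule tri_subcatI)
    show "left_perp B \<subseteq> obj C" using O by blast
    show "Z \<in> left_perp B" if "zero_obj C Z" for Z
      using that by (intro I) (use zero_obj_in_obj Hom_from_zero_obj in blast)+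
    show "X \<in> left_perp B" if X: "X' \<in> left_perp B" and i: "isomorphic C X' X" for X' X
    proof (rule I)
      obtain f g where fg: "f \<in> Hom C X' X" "g \<in> Hom C X X'" "f \<cdot> g = ident C X"
        using isomorphicD[OF i] by metis
      show "X \<in> obj C" using fg Hom_objD by blast
      show "w = zr X Y" if w: "Y \<in> B" "w \<in> Hom C X Y" for Y w
      proof -
        have "w \<cdot> f = zr X' Y" using E[OF X w(1) cmp_Hom[OF fg(1) w(2)]] .
        moreover have "w = (w \<cdot> f) \<cdot> g" using cmp_assoc[OF fg(2,1) w(2)] fg cmp_ident_right w by simp
        ultimately show ?thesis using cmp_zero_left[OF fg(2)] Hom_objD[OF w(2)] by simp
      qed
    qed
    show "sh X \<in> left_perp B" if X: "X \<in> left_perp B" for X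
    proof (rule I)
      show "sh X \<in> obj C" using O[OF X] shift_obj_in by blast
      show "w = zr (sh X) Y" if w: "Y \<in> B" "w \<in> Hom C (sh X) Y" for Y w
      proof -
        obtain Y' where Y': "Y' \<in> obj C" "sh Y' = Y" using shift_obj_surj w Hom_objD by blast
        then obtain v where v: "v \<in> Hom C X Y'" "sa v = w" using shift_arr_surj w O[OF X] by blast
        have "Y' \<in> B" using tri_subcatD(4)[OF B] Y' w by blast
        then show ?thesis using E[OF X _ v(1)] v shift_zero Y' O[OF X] by metis
      qed
    qed
    show "X \<in> left_perp B" if X: "X \<in> obj C" "sh X \<in> left_perp B" for X
    proof (rule I)
      show "w = zr X Y" if w: "Y \<in> B" "w \<in> Hom C X Y" for Y w
        using E[OF X(2) tri_subcatD(3)[OF B w(1)] shift_Hom[OF w(2)]] shift_zero_iff w by blast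
    qed (rule X)
    show "X3 \<in> left_perp B"
      if X: "X1 \<in> left_perp B" "X2 \<in> left_perp B" "tri X1 X2 X3" for X1 X2 X3
    proof (rule I)
      show "X3 \<in> obj C" using X tri_obj by blast
      obtain f g h where d: "dist_triangle C X1 X2 X3 f g h" using X tri_def by blast
      show "w = zr X3 Y" if w: "Y \<in> B" "w \<in> Hom C X3 Y" for Y w
      proof -
        have "w \<cdot> g = zr X2 Y" using E[OF X(2) w(1)] cmp_Hom[OF dist_Hom(2)[OF d] w(2)] by blast
        then obtain u where u: "u \<in> Hom C (sh X1) Y" "u \<cdot> h = w" using dist_extend_shift[OF d w(2)] by blast
        obtain Y' where Y': "Y' \<in> obj C" "sh Y' = Y" using shift_obj_surj w Hom_objD by blast
        then obtain v where v: "v \<in> Hom C X1 Y'" "sa v = u" using shift_arr_surj u O[OF X(1)] by blast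
        have "Y' \<in> B" using tri_subcatD(4)[OF B] Y' w by blast
        then have "u = zr (sh X1) Y" using E[OF X(1) _ v(1)] v shift_zero Y' O[OF X(1)] by metis
        then show ?thesis using u cmp_zero_left dist_Hom(3)[OF d] w(2) Hom_objD by metis
      qed
    qed
  qed
qed

lemma orth_iff_left_perp: "B \<subseteq> obj C \<Longrightarrow> orth B A \<longleftrightarrow> B \<subseteq> left_perp A"
  unfolding orth_def left_perp_def by blast

lemma orth_iff_right_perp: "A \<subseteq> obj C \<Longrightarrow> orth B A \<longleftrightarrow> A \<subseteq> right_perp C B (obj C)"
  unfolding orth_def right_perp_def by blast

text \<open>The class of all sources orthogonal to \<open>A\<close> is itself triangulated, so
  minimality of the hull carries orthogonality over from the generators.\<close>

lemma orth_tri_hull_left: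
  assumes "orth G A" "tri_subcat C A" "G \<subseteq> obj C" shows "orth (tri_hull C G) A"
  using tri_hull_least[OF tri_subcat_left_perp[OF assms(2)], of G] assms(1)
    orth_iff_left_perp[OF assms(3)] orth_iff_left_perp[OF tri_subcatD(1)[OF tri_subcat_tri_hull[OF assms(3)]]]
  by simp

lemma orth_tri_hull_right:
  assumes "orth B G" "tri_subcat C B" "G \<subseteq> obj C" shows "orth B (tri_hull C G)"
  using tri_hull_least[OF tri_subcat_right_perp[OF assms(2)], of G] assms(1)
    orth_iff_right_perp[OF assms(3)] orth_iff_right_perp[OF tri_subcatD(1)[OF tri_subcat_tri_hull[OF assms(3)]]]
  by simp

end

section \<open>Coproducts and compact objects\<close>

context is_category
begin

lemma coproduct_obj: "is_coproduct C I X P \<iota> \<Longrightarrow> P \<in> obj C"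
  by (simp add: is_coproduct_def)

lemma coproduct_inj_Hom: "is_coproduct C I X P \<iota> \<Longrightarrow> i \<in> I \<Longrightarrow> \<iota> i \<in> Hom C (X i) P"
  by (simp add: is_coproduct_def)

lemma coproduct_desc:
  assumes "is_coproduct C I X P \<iota>" "Y \<in> obj C" "\<And>i. i \<in> I \<Longrightarrow> g i \<in> Hom C (X i) Y"
  obtains h where "h \<in> Hom C P Y" "\<And>i. i \<in> I \<Longrightarrow> h \<cdot> \<iota> i = g i"
proof -
  have "\<exists>!h. h \<in> Hom C P Y \<and> (\<forall>i \<in> I. cmp C h (\<iota> i) = g i)"
    using assms unfolding is_coproduct_def by simp
  then show ?thesis using that by blast
qed

lemma coproduct_eqI:
  assumes c: "is_coproduct C I X P \<iota>" and h: "h \<in> Hom C P Y" "h' \<in> Hom C P Y"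
    and eq: "\<And>i. i \<in> I \<Longrightarrow> h \<cdot> \<iota> i = h' \<cdot> \<iota> i"
  shows "h = h'"
proof -
  have "\<forall>i \<in> I. h' \<cdot> \<iota> i \<in> Hom C (X i) Y" using coproduct_inj_Hom[OF c] h cmp_Hom by blast
  then have "\<exists>!k. k \<in> Hom C P Y \<and> (\<forall>i \<in> I. k \<cdot> \<iota> i = h' \<cdot> \<iota> i)"
    using c[unfolded is_coproduct_def, THEN conjunct2, THEN conjunct2, rule_format,
        OF Hom_objD(2)[OF h(1)], of "\<lambda>i. h' \<cdot> \<iota> i"] by simp
  then show ?thesis using h eq by blast
qed

lemma coproductI:
  assumes "P \<in> obj C" "\<And>i. i \<in> I \<Longrightarrow> \<iota> i \<in> Hom C (X i) P"
    and "\<And>Y g. Y \<in> obj C \<Longrightarrow> (\<And>i. i \<in> I \<Longrightarrow> g i \<in> Hom C (X i) Y) \<Longrightarrow>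
      \<exists>h \<in> Hom C P Y. \<forall>i \<in> I. h \<cdot> \<iota> i = g i"
    and "\<And>Y h h'. h \<in> Hom C P Y \<Longrightarrow> h' \<in> Hom C P Y \<Longrightarrow> (\<And>i. i \<in> I \<Longrightarrow> h \<cdot> \<iota> i = h' \<cdot> \<iota> i) \<Longrightarrow> h = h'"
  shows "is_coproduct C I X P \<iota>"
  unfolding is_coproduct_def
proof (intro conjI ballI allI impI)
  fix Y g assume Y: "Y \<in> obj C" and g: "\<forall>i\<in>I. g i \<in> Hom C (X i) Y"
  then obtain h where h: "h \<in> Hom C P Y" "\<forall>i \<in> I. h \<cdot> \<iota> i = g i" using assms(3)[of Y g] by blast
  then show "\<exists>!h. h \<in> Hom C P Y \<and> (\<forall>i \<in> I. h \<cdot> \<iota> i = g i)"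
    using assms(4)[of _ Y] by (intro ex1I[of _ h]) simp_all
qed (use assms in auto)

text \<open>Smallness, coproduct closure and compactness speak of index sets in the type of \<kappa>
  only. An injection \<open>e\<close> into that type gives coproducts over any other small index
  set.\<close>

lemma coproduct_reindex:
  assumes e: "inj_on e J" and c: "is_coproduct C (e ` J) (\<lambda>i. X (inv_into J e i)) P \<iota>"
  shows "is_coproduct C J X P (\<lambda>j. \<iota> (e j))"
proof (rule coproductI)
  show "P \<in> obj C" by (rule coproduct_obj[OF c])
  show "\<iota> (e j) \<in> Hom C (X j) P" if "j \<in> J" for j
    using coproduct_inj_Hom[OF c, of "e j"] that e by simp
  show "\<exists>h \<in> Hom C P Y. \<forall>j \<in> J. h \<cdot> \<iota> (e j) = g j"
    if Y: "Y \<in> obj C" and g: "\<And>j. j \<in> J \<Longrightarrow> g j \<in> Hom C (X j) Y" for Y g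
  proof -
    have "g (inv_into J e i) \<in> Hom C (X (inv_into J e i)) Y" if "i \<in> e ` J" for i
      using g that inv_into_into[of i e J] by blast
    then obtain h where "h \<in> Hom C P Y" "\<And>i. i \<in> e ` J \<Longrightarrow> h \<cdot> \<iota> i = g (inv_into J e i)"
      using coproduct_desc[OF c Y, of "\<lambda>i. g (inv_into J e i)"] by blast
    then show ?thesis using e by (intro bexI[of _ h]) auto
  qed
  show "h = h'" if "h \<in> Hom C P Y" "h' \<in> Hom C P Y" "\<And>j. j \<in> J \<Longrightarrow> h \<cdot> \<iota> (e j) = h' \<cdot> \<iota> (e j)"
    for Y h h'
    using coproduct_eqI[OF c that(1,2)] that(3) by blast
qed

lemma coproduct_closed_Inter: "(\<And>S. S \<in> F \<Longrightarrow> coproduct_closed \<kappa> C S) \<Longrightarrow> coproduct_closed \<kappa> C (\<Inter>F)"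
  unfolding coproduct_closed_def by blast

lemma coproduct_closed_Int:
  "coproduct_closed \<kappa> C S \<Longrightarrow> coproduct_closed \<kappa> C S' \<Longrightarrow> coproduct_closed \<kappa> C (S \<inter> S')"
  using coproduct_closed_Inter[of "{S, S'}" \<kappa>] by auto

lemma coproduct_closed_obj: "coproduct_closed \<kappa> C (obj C)"
  unfolding coproduct_closed_def using coproduct_obj by blast

end

context additive_category
begin

text \<open>By compactness every morphism from \<open>M\<close> to a coproduct is a finite sum of
  morphisms through the summands. This is the corresponding induction principle, with
  \<open>H\<close> the property to be shown.\<close>

lemma compact_coproduct_induct:
  fixes \<kappa> :: "'u rel" and I :: "'u set"
  assumes M: "compact_obj \<kappa> C M" and c: "is_coproduct C I X P \<iota>" and I: "|I| <o \<kappa>"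
    and X: "\<And>i. i \<in> I \<Longrightarrow> X i \<in> obj C"
    and m: "m \<in> Hom C M P" and z: "zr M P \<in> H"
    and a: "\<And>f g. f \<in> Hom C M P \<Longrightarrow> g \<in> Hom C M P \<Longrightarrow> f \<in> H \<Longrightarrow> g \<in> H \<Longrightarrow> f \<^bold>+ g \<in> H"
    and g: "\<And>i x. i \<in> I \<Longrightarrow> x \<in> Hom C M (X i) \<Longrightarrow> \<iota> i \<cdot> x \<in> H"
  shows "m \<in> H"
proof -
  let ?G = "hom_group C M P"
  let ?S = "sum_group I (\<lambda>i. hom_group C M (X i))"
  have Mo: "M \<in> obj C" using M by (simp add: compact_obj_def)
  interpret G: comm_group ?G by (rule hom_group_comm_group[OF m])
  have gr: "group (hom_group C M (X i))" if "i \<in> I" for i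
    using hom_comm_group[OF Mo X[OF that]] comm_group.axioms(2) by blast
  have "(\<lambda>x. gfinprod ?G (\<lambda>i. \<iota> i \<cdot> x i) I) \<in> iso ?S ?G"
    using M c I X unfolding compact_obj_def by blast
  then have "(\<lambda>x. gfinprod ?G (\<lambda>i. \<iota> i \<cdot> x i) I) ` carrier ?S = carrier ?G"
    by (simp add: iso_def bij_betw_def)
  moreover have "m \<in> carrier ?G" using m by simp
  ultimately obtain x where x: "x \<in> carrier ?S" "m = gfinprod ?G (\<lambda>i. \<iota> i \<cdot> x i) I"
    by (metis (no_types, lifting) imageE)
  have "x \<in> (\<Pi>\<^sub>E i\<in>I. carrier (hom_group C M (X i)))"
    using x(1) carrier_sum_group[of I "\<lambda>i. hom_group C M (X i)", OF gr] by blast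
  then have xi: "x i \<in> Hom C M (X i)" if "i \<in> I" for i
    using PiE_mem[OF _ that] by fastforce
  have fin: "finprod ?G (\<lambda>i. \<iota> i \<cdot> x i) F \<in> H \<inter> Hom C M P" if "finite F" "F \<subseteq> I" for F
    using that
  proof (induction F rule: finite_induct)
    case empty
    then show ?case using z zero_Hom[OF Mo coproduct_obj[OF c]] by simp
  next
    case (insert i F)
    have H: "\<iota> j \<cdot> x j \<in> Hom C M P" if "j \<in> insert i F" for j
      using cmp_Hom[OF xi[of j] coproduct_inj_Hom[OF c, of j]] insert.prems that by blast
    have "finprod ?G (\<lambda>i. \<iota> i \<cdot> x i) (insert i F) = \<iota> i \<cdot> x i \<^bold>+ finprod ?G (\<lambda>i. \<iota> i \<cdot> x i) F"
      using G.finprod_insert[OF insert.hyps, of "\<lambda>i. \<iota> i \<cdot> x i"] H by (simp add: Pi_iff)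
    moreover have "\<iota> i \<cdot> x i \<in> H" using g xi insert.prems by simp
    ultimately show ?case using a[OF H[of i]] add_Hom[OF H[of i]] insert by simp
  qed
  show ?thesis
  \<comment> \<open>\<open>gfinprod\<close> is the product over the support when that is finite and
    defaults to the unit, here the zero morphism, otherwise. Both values lie in
    \<open>H\<close>.\<close>
  proof (cases "finite {i \<in> I. \<iota> i \<cdot> x i \<noteq> \<one>\<^bsub>?G\<^esub>}")
    case True
    then show ?thesis
      using fin[OF True] unfolding x(2) gfinprod_def by (simp only: if_True Collect_restrict Int_iff)
  next
    case False
    then show ?thesis using z unfolding x(2) gfinprod_def by (simp only: if_False hom_group_simps)
  qed
qed

end

context triangulated_category
begin

lemma coproduct_closed_left_perp:
  fixes \<kappa> :: "'u rel"
  assumes B: "B \<subseteq> obj C" shows "coproduct_closed \<kappa> C (left_perp B)"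
  unfolding coproduct_closed_def
proof (intro allI impI, elim conjE)
  fix I :: "'u set" and X P \<iota>
  assume X: "\<forall>i\<in>I. X i \<in> left_perp B" and c: "is_coproduct C I X P \<iota>"
  have P: "P \<in> obj C" by (rule coproduct_obj[OF c])
  have "Hom C P Y = {zr P Y}" if Y: "Y \<in> B" for Y
  proof (rule Hom_zeroI[OF P])
    show Yo: "Y \<in> obj C" using B Y by blast
    fix f assume f: "f \<in> Hom C P Y"
    show "f = zr P Y"
    proof (rule coproduct_eqI[OF c f zero_Hom[OF P Yo]])
      fix i assume i: "i \<in> I"
      then have "Hom C (X i) Y = {zr (X i) Y}" using X Y unfolding left_perp_def by blast
      then show "f \<cdot> \<iota> i = zr P Y \<cdot> \<iota> i"
        using cmp_Hom[OF coproduct_inj_Hom[OF c i] f] cmp_Hom[OF coproduct_inj_Hom[OF c i] zero_Hom[OF P Yo]]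
        by simp
    qed
  qed
  then show "P \<in> left_perp B" using P unfolding left_perp_def by blast
qed

text \<open>Compactness makes morphisms into a coproduct sums of components, all of which vanish
  here. No such condition appears for \<open>left_perp\<close>, since morphisms out of a coproduct
  are determined by their components by definition.\<close>

lemma coproduct_closed_right_perp:
  fixes \<kappa> :: "'u rel"
  assumes A: "\<And>M. M \<in> A \<Longrightarrow> compact_obj \<kappa> C M" shows "coproduct_closed \<kappa> C (right_perp C A (obj C))"
  unfolding coproduct_closed_def
proof (intro allI impI, elim conjE)
  fix I :: "'u set" and X P \<iota>
  assume I: "|I| <o \<kappa>" and X: "\<forall>i\<in>I. X i \<in> right_perp C A (obj C)" and c: "is_coproduct C I X P \<iota>"
  have P: "P \<in> obj C" by (rule coproduct_obj[OF c])
  have "Hom C M P = {zr M P}" if M: "M \<in> A" for M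
  proof (rule Hom_zeroI[OF _ P])
    show Mo: "M \<in> obj C" using A[OF M] by (simp add: compact_obj_def)
    fix f assume f: "f \<in> Hom C M P"
    have "f \<in> {zr M P}"
    proof (rule compact_coproduct_induct[OF A[OF M] c I _ f])
      show "X i \<in> obj C" if "i \<in> I" for i using X that unfolding right_perp_def by blast
      show "f \<^bold>+ g \<in> {zr M P}" if "f \<in> {zr M P}" "g \<in> {zr M P}" for f g
        using that add_zero[OF zero_Hom[OF Mo P]] by simp
      show "\<iota> i \<cdot> x \<in> {zr M P}" if i: "i \<in> I" and x: "x \<in> Hom C M (X i)" for i x
      proof -
        have "x = zr M (X i)" using X x i M unfolding right_perp_def by blast
        then show ?thesis using cmp_zero_right[OF coproduct_inj_Hom[OF c i] Mo] by simp
      qed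
    qed simp
    then show "f = zr M P" by simp
  qed
  then show "P \<in> right_perp C A (obj C)" using P unfolding right_perp_def by blast
qed

lemma coproduct_shift:
  assumes c: "is_coproduct C I X P \<iota>" and X: "\<And>i. i \<in> I \<Longrightarrow> X i \<in> obj C"
  shows "is_coproduct C I (\<lambda>i. sh (X i)) (sh P) (\<lambda>i. sa (\<iota> i))"
proof (rule coproductI)
  have P: "P \<in> obj C" by (rule coproduct_obj[OF c])
  show "sh P \<in> obj C" by (rule shift_obj_in[OF P])
  show "sa (\<iota> i) \<in> Hom C (sh (X i)) (sh P)" if "i \<in> I" for i
    by (rule shift_Hom[OF coproduct_inj_Hom[OF c that]])
  show "\<exists>h \<in> Hom C (sh P) Y. \<forall>i \<in> I. h \<cdot> sa (\<iota> i) = g i"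
    if Y: "Y \<in> obj C" and g: "\<And>i. i \<in> I \<Longrightarrow> g i \<in> Hom C (sh (X i)) Y" for Y g
  proof -
    obtain Y' where Y': "Y' \<in> obj C" "sh Y' = Y" using shift_obj_surj[OF Y] by blast
    have "\<forall>i \<in> I. \<exists>f. f \<in> Hom C (X i) Y' \<and> sa f = g i"
      using shift_arr_surj[OF _ X Y'(1)] g Y'(2) by blast
    then obtain g' where g': "\<And>i. i \<in> I \<Longrightarrow> g' i \<in> Hom C (X i) Y' \<and> sa (g' i) = g i"
      using bchoice[of I "\<lambda>i f. f \<in> Hom C (X i) Y' \<and> sa f = g i"] by blast
    obtain h where h: "h \<in> Hom C P Y'" "\<And>i. i \<in> I \<Longrightarrow> h \<cdot> \<iota> i = g' i"
      using coproduct_desc[OF c Y'(1), of g'] g' by blast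
    have "sa h \<cdot> sa (\<iota> i) = g i" if "i \<in> I" for i
      using shift_cmp[OF coproduct_inj_Hom[OF c that] h(1)] h(2)[OF that] g'[OF that] by simp
    then show ?thesis using shift_Hom[OF h(1)] Y'(2) by blast
  qed
  show "h = h'" if h: "h \<in> Hom C (sh P) Y" "h' \<in> Hom C (sh P) Y"
    and eq: "\<And>i. i \<in> I \<Longrightarrow> h \<cdot> sa (\<iota> i) = h' \<cdot> sa (\<iota> i)" for Y h h'
  proof -
    obtain Y' where Y': "Y' \<in> obj C" "sh Y' = Y" using shift_obj_surj[OF Hom_objD(2)[OF h(1)]] by blast
    obtain k where k: "k \<in> Hom C P Y'" "sa k = h" using shift_arr_surj[OF _ P Y'(1)] h Y' by blast
    obtain k' where k': "k' \<in> Hom C P Y'" "sa k' = h'" using shift_arr_surj[OF _ P Y'(1)] h Y' by blast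
    have "k = k'"
    proof (rule coproduct_eqI[OF c k(1) k'(1)])
      fix i assume i: "i \<in> I"
      note \<iota> = coproduct_inj_Hom[OF c i]
      have "sa (k \<cdot> \<iota> i) = sa (k' \<cdot> \<iota> i)"
        using eq[OF i] shift_cmp[OF \<iota> k(1)] shift_cmp[OF \<iota> k'(1)] k k' by simp
      then show "k \<cdot> \<iota> i = k' \<cdot> \<iota> i" using shift_arr_inj cmp_Hom[OF \<iota> k(1)] cmp_Hom[OF \<iota> k'(1)] by blast
    qed
    then show ?thesis using k k' by simp
  qed
qed

text \<open>The coproduct of the \<open>a i\<close> is not assumed: the cone \<open>Z\<close> of the
  induced map \<open>\<phi>\<close> is shown to be one. Fill-ins of triangles are not unique, so
  both halves of the universal property first hold up to morphisms factoring through
  \<open>\<delta>\<close> and must be corrected.\<close>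

lemma tri_coproduct:
  assumes b: "is_coproduct C I b Q \<beta>" and X: "is_coproduct C I X P \<iota>"
    and t: "\<And>i. i \<in> I \<Longrightarrow> tri (b i) (X i) (a i)"
  shows "\<exists>Z \<alpha>. is_coproduct C I a Z \<alpha> \<and> tri Q P Z"
proof -
  obtain f g h where d: "\<And>i. i \<in> I \<Longrightarrow> dist_triangle C (b i) (X i) (a i) (f i) (g i) (h i)"
    using t unfolding tri_def by metis
  note f = dist_Hom(1)[OF d] and g = dist_Hom(2)[OF d] and h = dist_Hom(3)[OF d]
  note bO = dist_obj(1)[OF d] and XO = dist_obj(2)[OF d] and aO = dist_obj(3)[OF d]
  note \<beta> = coproduct_inj_Hom[OF b] and \<iota> = coproduct_inj_Hom[OF X]
  have P: "P \<in> obj C" and Q: "Q \<in> obj C" using coproduct_obj b X by blast+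
  obtain \<phi> where \<phi>: "\<phi> \<in> Hom C Q P" "\<And>i. i \<in> I \<Longrightarrow> \<phi> \<cdot> \<beta> i = \<iota> i \<cdot> f i"
    using coproduct_desc[OF b P, of "\<lambda>i. \<iota> i \<cdot> f i"] cmp_Hom[OF f \<iota>] by blast
  obtain Z \<gamma> \<delta> where dZ: "dist_triangle C Q P Z \<phi> \<gamma> \<delta>" using cone_exists[OF \<phi>(1)] by blast
  note \<gamma> = dist_Hom(2)[OF dZ] and \<delta> = dist_Hom(3)[OF dZ] and ZO = dist_obj(3)[OF dZ]
  have "\<forall>i \<in> I. \<exists>c. c \<in> Hom C (a i) Z \<and> \<gamma> \<cdot> \<iota> i = c \<cdot> g i \<and> \<delta> \<cdot> c = sa (\<beta> i) \<cdot> h i"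
    using dist_morphism[OF d dZ \<beta> \<iota> \<phi>(2)] by blast
  then obtain c where "\<forall>i \<in> I. c i \<in> Hom C (a i) Z \<and> \<gamma> \<cdot> \<iota> i = c i \<cdot> g i \<and> \<delta> \<cdot> c i = sa (\<beta> i) \<cdot> h i"
    using bchoice[of I "\<lambda>i c. c \<in> Hom C (a i) Z \<and> \<gamma> \<cdot> \<iota> i = c \<cdot> g i \<and> \<delta> \<cdot> c = sa (\<beta> i) \<cdot> h i"] by blast
  then have c: "\<And>i. i \<in> I \<Longrightarrow> c i \<in> Hom C (a i) Z"
    and cg: "\<And>i. i \<in> I \<Longrightarrow> c i \<cdot> g i = \<gamma> \<cdot> \<iota> i"
    and \<delta>c: "\<And>i. i \<in> I \<Longrightarrow> \<delta> \<cdot> c i = sa (\<beta> i) \<cdot> h i" by simp_all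
  note sb = coproduct_shift[OF b bO] and sX = coproduct_shift[OF X XO]
  note s\<beta> = shift_Hom[OF \<beta>] and s\<iota> = shift_Hom[OF \<iota>]
  have "is_coproduct C I a Z c"
  proof (rule coproductI)
    show "Z \<in> obj C" by (rule ZO)
    show "\<And>i. i \<in> I \<Longrightarrow> c i \<in> Hom C (a i) Z" by (rule c)
  next
    fix W w assume W: "W \<in> obj C" and w: "\<And>i. i \<in> I \<Longrightarrow> w i \<in> Hom C (a i) W"
    obtain y where y: "y \<in> Hom C P W" "\<And>i. i \<in> I \<Longrightarrow> y \<cdot> \<iota> i = w i \<cdot> g i"
      using coproduct_desc[OF X W, of "\<lambda>i. w i \<cdot> g i"] cmp_Hom[OF g w] by blast
    have "y \<cdot> \<phi> = zr Q W"
    proof (rule coproduct_eqI[OF b cmp_Hom[OF \<phi>(1) y(1)] zero_Hom[OF Q W]])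
      fix i assume i: "i \<in> I"
      have "y \<cdot> \<phi> \<cdot> \<beta> i = y \<cdot> (\<iota> i \<cdot> f i)" using cmp_assoc[OF \<beta>[OF i] \<phi>(1) y(1)] \<phi>(2)[OF i] by simp
      also have "\<dots> = w i \<cdot> g i \<cdot> f i" using cmp_assoc[OF f[OF i] \<iota>[OF i] y(1)] y(2)[OF i] by simp
      also have "\<dots> = w i \<cdot> (g i \<cdot> f i)" using cmp_assoc[OF f[OF i] g[OF i] w[OF i]] by simp
      also have "\<dots> = zr (b i) W" using dist_cmp_zero(1)[OF d[OF i]] cmp_zero_right[OF w[OF i] bO[OF i]]
          by simp
      finally show "y \<cdot> \<phi> \<cdot> \<beta> i = zr Q W \<cdot> \<beta> i" using cmp_zero_left[OF \<beta>[OF i] W] by simp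
    qed
    then obtain v where v: "v \<in> Hom C Z W" "v \<cdot> \<gamma> = y" using dist_extend[OF dZ y(1)] by blast
    \<comment> \<open>The extension \<open>v\<close> agrees with \<open>w i\<close> only after
      composing with \<open>g i\<close>. The error factors through the connecting morphism
      \<open>h i\<close>; the factors assemble to \<open>u\<close> on \<open>Q[1]\<close>, and
      subtracting \<open>u \<cdot> \<delta>\<close> repairs \<open>v\<close>.\<close>
    have "\<exists>u. u \<in> Hom C (sh (b i)) W \<and> u \<cdot> h i = v \<cdot> c i \<^bold>+ ng (w i)" if i: "i \<in> I" for i
    proof -
      have vc: "v \<cdot> c i \<in> Hom C (a i) W" by (rule cmp_Hom[OF c[OF i] v(1)])
      have "v \<cdot> c i \<cdot> g i = w i \<cdot> g i"
        using cmp_assoc[OF g[OF i] c[OF i] v(1)] cg[OF i] cmp_assoc[OF \<iota>[OF i] \<gamma> v(1)] v(2) y(2)[OF i] by simp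
      then have "(v \<cdot> c i \<^bold>+ ng (w i)) \<cdot> g i = zr (X i) W"
        using cmp_add_left[OF g[OF i] vc neg_Hom[OF w[OF i]]] cmp_neg_left[OF g[OF i] w[OF i]]
          add_neg[OF cmp_Hom[OF g[OF i] w[OF i]]] by simp
      then show ?thesis using dist_extend_shift[OF d[OF i] add_Hom[OF vc neg_Hom[OF w[OF i]]]] by blast
    qed
    then obtain u' where u': "\<And>i. i \<in> I \<Longrightarrow> u' i \<in> Hom C (sh (b i)) W"
      "\<And>i. i \<in> I \<Longrightarrow> u' i \<cdot> h i = v \<cdot> c i \<^bold>+ ng (w i)" by metis
    obtain u where u: "u \<in> Hom C (sh Q) W" "\<And>i. i \<in> I \<Longrightarrow> u \<cdot> sa (\<beta> i) = u' i"
      using coproduct_desc[OF sb W, of u'] u'(1) by blast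
    have u\<delta>: "u \<cdot> \<delta> \<in> Hom C Z W" by (rule cmp_Hom[OF \<delta> u(1)])
    have "(v \<^bold>+ ng (u \<cdot> \<delta>)) \<cdot> c i = w i" if i: "i \<in> I" for i
    proof -
      have vc: "v \<cdot> c i \<in> Hom C (a i) W" by (rule cmp_Hom[OF c[OF i] v(1)])
      note nw = neg_Hom[OF w[OF i]]
      have "u \<cdot> \<delta> \<cdot> c i = v \<cdot> c i \<^bold>+ ng (w i)"
        using cmp_assoc[OF c[OF i] \<delta> u(1)] \<delta>c[OF i] cmp_assoc[OF h[OF i] s\<beta>[OF i] u(1)] u(2)[OF i] u'(2)[OF i]
        by simp
      then have "(v \<^bold>+ ng (u \<cdot> \<delta>)) \<cdot> c i = v \<cdot> c i \<^bold>+ ng (v \<cdot> c i \<^bold>+ ng (w i))" (is "?l = _")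
        using cmp_add_left[OF c[OF i] v(1) neg_Hom[OF u\<delta>]] cmp_neg_left[OF c[OF i] u\<delta>] by simp
      moreover have "ng (v \<cdot> c i \<^bold>+ ng (w i)) = w i \<^bold>+ ng (v \<cdot> c i)"
      proof (rule neg_unique[symmetric])
        note nv = neg_Hom[OF vc]
        show "v \<cdot> c i \<^bold>+ ng (w i) \<^bold>+ (w i \<^bold>+ ng (v \<cdot> c i)) = zr (a i) W"
          using add_assoc[OF vc nw add_Hom[OF w[OF i] nv]] add_assoc[OF nw w[OF i] nv, symmetric]
            add_neg[OF w[OF i]] add_zero[OF nv] add_neg[OF vc] by simp
      qed (rule add_Hom[OF vc nw] add_Hom[OF w[OF i] neg_Hom[OF vc]])+
      ultimately have "?l = v \<cdot> c i \<^bold>+ (ng (v \<cdot> c i) \<^bold>+ w i)" using add_comm[OF w[OF i] neg_Hom[OF vc]]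
          by simp
      also have "\<dots> = w i" using add_assoc[OF vc neg_Hom[OF vc] w[OF i]] add_neg[OF vc] add_zero[OF w[OF i]]
          by simp
      finally show ?thesis .
    qed
    then show "\<exists>h\<in>Hom C Z W. \<forall>i\<in>I. h \<cdot> c i = w i" using add_Hom[OF v(1) neg_Hom[OF u\<delta>]] by blast
  next
    fix W v v' assume vv: "v \<in> Hom C Z W" "v' \<in> Hom C Z W" and eq: "\<And>i. i \<in> I \<Longrightarrow> v \<cdot> c i = v' \<cdot> c i"
    have W: "W \<in> obj C" using vv Hom_objD by blast
    define w where "w = v \<^bold>+ ng v'"
    have w: "w \<in> Hom C Z W" unfolding w_def by (rule add_Hom[OF vv(1) neg_Hom[OF vv(2)]])
    have wc: "w \<cdot> c i = zr (a i) W" if i: "i \<in> I" for i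
      unfolding w_def using cmp_add_left[OF c[OF i] vv(1) neg_Hom[OF vv(2)]] cmp_neg_left[OF c[OF i] vv(2)]
        eq[OF i] add_neg[OF cmp_Hom[OF c[OF i] vv(2)]] by simp
    have "w \<cdot> \<gamma> = zr P W"
    proof (rule coproduct_eqI[OF X cmp_Hom[OF \<gamma> w] zero_Hom[OF P W]])
      fix i assume i: "i \<in> I"
      have "w \<cdot> \<gamma> \<cdot> \<iota> i = w \<cdot> c i \<cdot> g i"
        using cmp_assoc[OF \<iota>[OF i] \<gamma> w] cg[OF i] cmp_assoc[OF g[OF i] c[OF i] w] by simp
      also have "\<dots> = zr (X i) W" using wc[OF i] cmp_zero_left[OF g[OF i] W] by simp
      finally show "w \<cdot> \<gamma> \<cdot> \<iota> i = zr P W \<cdot> \<iota> i" using cmp_zero_left[OF \<iota>[OF i] W] by simp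
    qed
    then obtain u where u: "u \<in> Hom C (sh Q) W" "u \<cdot> \<delta> = w" using dist_extend_shift[OF dZ w] by blast
    \<comment> \<open>The difference \<open>w\<close> of two candidates is
      \<open>u \<cdot> \<delta>\<close>. On each summand \<open>u\<close> kills \<open>h i\<close>,
      so it extends along \<open>sa (f i)\<close>. Together this writes \<open>u\<close> as
      \<open>t \<cdot> sa \<phi>\<close>, and \<open>sa \<phi> \<cdot> \<delta>\<close> is
      zero.\<close>
    have "\<exists>t. t \<in> Hom C (sh (X i)) W \<and> t \<cdot> sa (f i) = u \<cdot> sa (\<beta> i)" if i: "i \<in> I" for i
    proof -
      have "u \<cdot> sa (\<beta> i) \<cdot> h i = zr (a i) W"
        using cmp_assoc[OF h[OF i] s\<beta>[OF i] u(1)] \<delta>c[OF i] cmp_assoc[OF c[OF i] \<delta> u(1)] u(2) wc[OF i] by simp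
      then show ?thesis using dist_extend_shift2[OF d[OF i] cmp_Hom[OF s\<beta>[OF i] u(1)]] by blast
    qed
    then obtain t' where t': "\<And>i. i \<in> I \<Longrightarrow> t' i \<in> Hom C (sh (X i)) W"
      "\<And>i. i \<in> I \<Longrightarrow> t' i \<cdot> sa (f i) = u \<cdot> sa (\<beta> i)" by metis
    obtain t where t: "t \<in> Hom C (sh P) W" "\<And>i. i \<in> I \<Longrightarrow> t \<cdot> sa (\<iota> i) = t' i"
      using coproduct_desc[OF sX W, of t'] t'(1) by blast
    note s\<phi> = shift_Hom[OF \<phi>(1)]
    have "t \<cdot> sa \<phi> = u"
    proof (rule coproduct_eqI[OF sb cmp_Hom[OF s\<phi> t(1)] u(1)])
      fix i assume i: "i \<in> I"
      have "t \<cdot> sa \<phi> \<cdot> sa (\<beta> i) = t \<cdot> (sa (\<iota> i) \<cdot> sa (f i))"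
        using cmp_assoc[OF s\<beta>[OF i] s\<phi> t(1)] shift_cmp[OF \<beta>[OF i] \<phi>(1)] \<phi>(2)[OF i]
          shift_cmp[OF f[OF i] \<iota>[OF i]] by simp
      also have "\<dots> = u \<cdot> sa (\<beta> i)"
        using cmp_assoc[OF shift_Hom[OF f[OF i]] s\<iota>[OF i] t(1)] t(2)[OF i] t'(2)[OF i] by simp
      finally show "t \<cdot> sa \<phi> \<cdot> sa (\<beta> i) = u \<cdot> sa (\<beta> i)" .
    qed
    then have "w = t \<cdot> (sa \<phi> \<cdot> \<delta>)" using u(2) cmp_assoc[OF \<delta> s\<phi> t(1)] by simp
    moreover have "sa \<phi> \<cdot> \<delta> = zr Z (sh P)"
    proof -
      have "ng (sa \<phi>) \<cdot> \<delta> = zr Z (sh P)" by (rule dist_cmp_zero(2)[OF dist_rot[OF dZ]])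
      then have "ng (sa \<phi> \<cdot> \<delta>) = zr Z (sh P)" using cmp_neg_left[OF \<delta> s\<phi>] by simp
      then show ?thesis using neg_neg[OF cmp_Hom[OF \<delta> s\<phi>]] neg_zero[OF ZO shift_obj_in[OF P]] by simp
    qed
    ultimately have "w = zr Z W" using cmp_zero_right[OF t(1) ZO] by simp
    then show "v = v'" using diff_zero_eq[OF vv] unfolding w_def by blast
  qed
  then show ?thesis using dZ tri_def by blast
qed

section \<open>Coproduct hulls\<close>

lemma coproduct_hull_superset: "G \<subseteq> coproduct_hull \<kappa> C G"
  unfolding coproduct_hull_def by blast

lemma coproduct_hull_least:
  "tri_subcat C S \<Longrightarrow> coproduct_closed \<kappa> C S \<Longrightarrow> G \<subseteq> S \<Longrightarrow> coproduct_hull \<kappa> C G \<subseteq> S"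
  unfolding coproduct_hull_def by blast

lemma coproduct_hull_mono: "G \<subseteq> G' \<Longrightarrow> coproduct_hull \<kappa> C G \<subseteq> coproduct_hull \<kappa> C G'"
  unfolding coproduct_hull_def by blast

lemma tri_subcat_coproduct_hull: "G \<subseteq> obj C \<Longrightarrow> tri_subcat C (coproduct_hull \<kappa> C G)"
  unfolding coproduct_hull_def
  by (rule tri_subcat_Inter) (use tri_subcat_obj coproduct_closed_obj in auto)

lemma coproduct_closed_coproduct_hull: "coproduct_closed \<kappa> C (coproduct_hull \<kappa> C G)"
  unfolding coproduct_hull_def by (rule coproduct_closed_Inter) simp

lemma orth_coproduct_hull_left:
  assumes "orth G A" "tri_subcat C A" "G \<subseteq> obj C" shows "orth (coproduct_hull \<kappa> C G) A"
  using coproduct_hull_least[OF tri_subcat_left_perp[OF assms(2)] coproduct_closed_left_perp[OF tri_subcatD(1)[OF assms(2)]], of G \<kappa>]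
    assms(1) orth_iff_left_perp[OF assms(3)]
    orth_iff_left_perp[OF tri_subcatD(1)[OF tri_subcat_coproduct_hull[OF assms(3), of \<kappa>]]]
  by simp

lemma orth_coproduct_hull_right:
  assumes "orth B G" "tri_subcat C B" "G \<subseteq> obj C" "\<And>M. M \<in> B \<Longrightarrow> compact_obj \<kappa> C M"
  shows "orth B (coproduct_hull \<kappa> C G)"
  using coproduct_hull_least[OF tri_subcat_right_perp[OF assms(2)] coproduct_closed_right_perp[OF assms(4)], of G]
    assms(1) orth_iff_right_perp[OF assms(3)]
    orth_iff_right_perp[OF tri_subcatD(1)[OF tri_subcat_coproduct_hull[OF assms(3), of \<kappa>]]]
  by simp

end

locale triangulated_category_coproducts = triangulated_category C
  for C :: "('o, 'm, 'z) tri_cat_data_scheme" +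
  fixes \<kappa> :: "'u rel"
  assumes universe: "universe_card \<kappa>" and coproducts: "has_small_coproducts \<kappa> C"
begin

text \<open>The coproduct of the subobjects exists by assumption; the cone of its map to
  \<open>P\<close> is then the coproduct of the quotients.\<close>

lemma coproduct_closed_star:
  assumes A: "coproduct_closed \<kappa> C A" and B: "coproduct_closed \<kappa> C B"
  shows "coproduct_closed \<kappa> C (star B A)"
  unfolding coproduct_closed_def
proof (intro allI impI, elim conjE)
  fix I :: "'u set" and X P \<iota>
  assume I: "|I| <o \<kappa>" and X: "\<forall>i\<in>I. X i \<in> star B A" and c: "is_coproduct C I X P \<iota>"
  obtain b a where ba: "\<And>i. i \<in> I \<Longrightarrow> b i \<in> B" "\<And>i. i \<in> I \<Longrightarrow> a i \<in> A"
    "\<And>i. i \<in> I \<Longrightarrow> tri (b i) (X i) (a i)"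
    using X unfolding star_def mem_Collect_eq by metis
  obtain Q \<beta> where Q: "is_coproduct C I b Q \<beta>"
    using coproducts I tri_obj(1)[OF ba(3)] unfolding has_small_coproducts_def by metis
  obtain Z \<alpha> where Z: "is_coproduct C I a Z \<alpha>" "tri Q P Z" using tri_coproduct[OF Q c ba(3)] by blast
  have "Q \<in> B" "Z \<in> A" using A B I ba Q Z(1) unfolding coproduct_closed_def by blast+
  then show "P \<in> star B A" unfolding star_def using Z(2) by blast
qed

lemma natLeq_less_universe: "|UNIV :: nat set| <o \<kappa>"
  using universe card_of_nat ordIso_ordLess_trans unfolding universe_card_def by blast

text \<open>The reindexed coproduct is packed with its two consequences, membership in coproduct
  closed classes and induction for compact sources. Both have to be drawn while the index set still
  lies in the type of \<kappa>.\<close>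

lemma small_coproduct:
  fixes J :: "'j set"
  assumes J: "|J| <o \<kappa>" and X: "\<forall>j \<in> J. X j \<in> obj C"
  shows "\<exists>P \<iota>. is_coproduct C J X P \<iota> \<and>
    (\<forall>S. coproduct_closed \<kappa> C S \<longrightarrow> (\<forall>j \<in> J. X j \<in> S) \<longrightarrow> P \<in> S) \<and>
    (\<forall>M H. compact_obj \<kappa> C M \<longrightarrow> zr M P \<in> H \<longrightarrow>
      (\<forall>f \<in> Hom C M P \<inter> H. \<forall>g \<in> Hom C M P \<inter> H. f \<^bold>+ g \<in> H) \<longrightarrow>
      (\<forall>j \<in> J. \<forall>x \<in> Hom C M (X j). \<iota> j \<cdot> x \<in> H) \<longrightarrow> Hom C M P \<subseteq> H)"
proof -
  have "|J| \<le>o |Field \<kappa>|"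
    using J universe card_of_Field_ordIso ordIso_symmetric ordLess_ordIso_trans ordLess_imp_ordLeq
    unfolding universe_card_def by blast
  then obtain e :: "'j \<Rightarrow> 'u" where e: "inj_on e J" using card_of_ordLeq[of J "Field \<kappa>"] by blast
  have I: "|e ` J| <o \<kappa>" using card_of_image ordLeq_ordLess_trans J by blast
  define X' where "X' i = X (inv_into J e i)" for i
  have X': "X' i \<in> obj C" if "i \<in> e ` J" for i unfolding X'_def using X inv_into_into[OF that] by blast
  obtain P \<iota> where P: "is_coproduct C (e ` J) X' P \<iota>"
    using coproducts I X' unfolding has_small_coproducts_def by metis
  have "is_coproduct C J X P (\<lambda>j. \<iota> (e j))"
    using coproduct_reindex[OF e] P unfolding X'_def by blast
  moreover have "P \<in> S" if S: "coproduct_closed \<kappa> C S" and XS: "\<forall>j \<in> J. X j \<in> S" for S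
  proof -
    have "\<forall>i \<in> e ` J. X' i \<in> S" unfolding X'_def using XS inv_into_into[of _ e J] by blast
    then show ?thesis using S I P unfolding coproduct_closed_def by blast
  qed
  moreover have "Hom C M P \<subseteq> H" if M: "compact_obj \<kappa> C M" "zr M P \<in> H"
    and a: "\<forall>f \<in> Hom C M P \<inter> H. \<forall>g \<in> Hom C M P \<inter> H. f \<^bold>+ g \<in> H"
    and g: "\<forall>j \<in> J. \<forall>x \<in> Hom C M (X j). \<iota> (e j) \<cdot> x \<in> H" for M H
  proof
    fix m assume m: "m \<in> Hom C M P"
    show "m \<in> H"
    proof (rule compact_coproduct_induct[OF M(1) P I X' m M(2)])
      show "f \<^bold>+ g \<in> H" if "f \<in> Hom C M P" "g \<in> Hom C M P" "f \<in> H" "g \<in> H" for f g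
        using a that by simp
      show "\<iota> i \<cdot> x \<in> H" if "i \<in> e ` J" "x \<in> Hom C M (X' i)" for i x
        using that g e unfolding X'_def by auto
    qed
  qed
  ultimately show ?thesis by (intro exI[of _ P] exI[of _ "\<lambda>j. \<iota> (e j)"]) simp
qed

end

section \<open>Semi-orthogonal filtrations and telescopes\<close>

context triangulated_category
begin

text \<open>Written as an orthogonal, the zero objects inherit closure under coproducts, the base
  case for hulls of finite families.\<close>

lemma zero_objs_eq_left_perp: "{Z. zero_obj C Z} = left_perp (obj C)"
proof
  show "{Z. zero_obj C Z} \<subseteq> left_perp (obj C)"
    unfolding left_perp_def using Hom_zeroI Hom_from_zero_obj zero_obj_in_obj by blast
  show "left_perp (obj C) \<subseteq> {Z. zero_obj C Z}"
    unfolding left_perp_def using zero_objI ident_Hom by blast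
qed

lemma dist_cmp_zero_shift:
  assumes d: "dist_triangle C X Y Z f g h" shows "sa f \<cdot> h = zr Z (sh Y)"
proof -
  note h = dist_Hom(3)[OF d] and sf = shift_Hom[OF dist_Hom(1)[OF d]]
  have "ng (sa f) \<cdot> h = zr Z (sh Y)" by (rule dist_cmp_zero(2)[OF dist_rot[OF d]])
  then have "ng (sa f \<cdot> h) = zr Z (sh Y)" using cmp_neg_left[OF h sf] by simp
  then show ?thesis
    using neg_neg[OF cmp_Hom[OF h sf]] neg_zero[OF dist_obj(3)[OF d] shift_obj_in[OF dist_obj(2)[OF d]]]
        by simp
qed

text \<open>A strict bound in the natural numbers replaces the integer bound of
  \<open>tri_le\<close>: \<open>hull_below B k\<close> is the hull of the pieces with index at most
  \<open>k - 1\<close>, and \<open>k = 0\<close> stands for the bound -1. It also allows induction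
  on \<open>k\<close>.\<close>

definition hull_below :: "(nat \<Rightarrow> 'o set) \<Rightarrow> nat \<Rightarrow> 'o set" where
  "hull_below B k = tri_hull C (\<Union>i<k. B i)"

lemma hull_below_0: "hull_below B 0 = {Z. zero_obj C Z}"
  unfolding hull_below_def by (simp add: tri_hull_empty)

lemma tri_subcat_hull_below: "(\<And>i. i < k \<Longrightarrow> B i \<subseteq> obj C) \<Longrightarrow> tri_subcat C (hull_below B k)"
  unfolding hull_below_def by (rule tri_subcat_tri_hull) blast

lemma hull_below_superset: "i < k \<Longrightarrow> B i \<subseteq> hull_below B k"
  unfolding hull_below_def using tri_hull_superset[of "\<Union>i<k. B i"] by blast

lemma hull_below_least: "tri_subcat C S \<Longrightarrow> (\<And>i. i < k \<Longrightarrow> B i \<subseteq> S) \<Longrightarrow> hull_below B k \<subseteq> S"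
  unfolding hull_below_def by (rule tri_hull_least) auto

lemma hull_below_mono: "j \<le> k \<Longrightarrow> hull_below B j \<subseteq> hull_below B k"
  unfolding hull_below_def by (rule tri_hull_mono, rule UN_mono) auto

lemma orth_hull_below:
  assumes B: "\<And>i. i \<le> k \<Longrightarrow> tri_subcat C (B i)" and o: "\<And>i. i < k \<Longrightarrow> orth (B k) (B i)"
  shows "orth (B k) (hull_below B k)"
  unfolding hull_below_def
proof (rule orth_tri_hull_right)
  show "orth (B k) (\<Union>i<k. B i)" using o unfolding orth_def by blast
  show "tri_subcat C (B k)" using B by simp
  show "(\<Union>i<k. B i) \<subseteq> obj C" by (rule UN_least, rule tri_subcatD(1)[OF B]) simp
qed

lemma hull_below_Suc:
  assumes B: "\<And>i. i \<le> k \<Longrightarrow> tri_subcat C (B i)" and o: "\<And>i. i < k \<Longrightarrow> orth (B k) (B i)"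
  shows "hull_below B (Suc k) = star (B k) (hull_below B k)"
proof -
  have sub: "(\<Union>i<k. B i) \<subseteq> obj C" by (rule UN_least, rule tri_subcatD(1)[OF B]) simp
  have "hull_below B (Suc k) = tri_hull C (B k \<union> (\<Union>i<k. B i))"
    unfolding hull_below_def by (simp add: lessThan_Suc)
  also have "\<dots> = tri_hull C (B k \<union> hull_below B k)"
    using tri_hull_Un_hull[OF tri_subcatD(1)[OF B] sub] tri_hull_idem[OF B] unfolding hull_below_def by simp
  also have "\<dots> = star (B k) (hull_below B k)"
  proof (rule tri_hull_Un)
    show "tri_subcat C (hull_below B k)" using tri_subcat_tri_hull[OF sub] unfolding hull_below_def .
    show "tri_subcat C (B k)" using B by simp
    show "orth (B k) (hull_below B k)" by (rule orth_hull_below) (use B o in blast)+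
  qed
  finally show ?thesis .
qed

text \<open>Split \<open>X\<close> as \<open>a -> X -> l\<close> with \<open>a\<close> in the top
  piece of \<open>A\<close> and \<open>l\<close> below. Membership in \<open>B i\<close> forces one
  of the two outer maps at \<open>X\<close> to vanish, and the connecting morphism then makes one
  outer term a summand of a shift of the other. Orthogonality kills that summand.\<close>

lemma hull_below_Int_piece:
  assumes A: "\<And>i. i < k \<Longrightarrow> tri_subcat C (A i)" and B: "\<And>i. i < k \<Longrightarrow> tri_subcat C (B i)"
    and AB: "\<And>i. i < k \<Longrightarrow> A i \<subseteq> B i" and o: "\<And>i j. i < j \<Longrightarrow> j < k \<Longrightarrow> orth (B j) (B i)"
    and i: "i < k" and X: "X \<in> B i" "X \<in> hull_below A k"
  shows "X \<in> A i"
  using assms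
proof (induction k)
  case 0
  then show ?case by simp
next
  case (Suc k)
  have oA: "orth (A j) (A i)" if "i < j" "j < Suc k" for i j
    using orth_mono[OF Suc.prems(4)[OF that]] Suc.prems(3) that by simp
  have tA: "tri_subcat C (hull_below A k)"
    by (rule tri_subcat_hull_below) (use tri_subcatD(1)[OF Suc.prems(1)] in simp)
  have oB: "orth (B k) (hull_below A k)"
  proof (rule orth_mono)
    show "orth (B k) (hull_below B k)" by (rule orth_hull_below) (use Suc.prems(2,4) in auto)
    show "hull_below A k \<subseteq> hull_below B k"
      unfolding hull_below_def by (rule tri_hull_mono, rule UN_mono, simp, rule Suc.prems(3)) simp
  qed simp
  have "X \<in> star (A k) (hull_below A k)"
    using Suc.prems(7) hull_below_Suc[of k A] Suc.prems(1) oA by simp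
  then obtain a l where al: "a \<in> A k" "l \<in> hull_below A k" "tri a X l" unfolding star_def by blast
  have aB: "a \<in> B k" and saB: "sh a \<in> B k"
    using Suc.prems(3)[of k] al(1) tri_subcatD(3)[OF Suc.prems(2)[of k]] by auto
  obtain f g h where d: "dist_triangle C a X l f g h" using al(3) unfolding tri_def by blast
  note H = dist_Hom[OF d] and O = dist_obj[OF d]
  show ?case
  proof (cases "i = k")
    case True
    \<comment> \<open>For the top piece, \<open>X -> l\<close> vanishes, so \<open>l\<close> is a
      retract of \<open>a[1]\<close>. There are no morphisms from \<open>a[1]\<close> to
      \<open>l\<close>, hence \<open>l = 0\<close> and \<open>X\<close> lies in
      \<open>A k\<close>.\<close>
    have "g = zr X l" using orthD[OF oB _ al(2) H(2)] Suc.prems(6) True by simp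
    then have "ident C l \<cdot> g = zr X l" using cmp_ident_left[OF H(2)] by simp
    then obtain v where v: "v \<in> Hom C (sh a) l" "v \<cdot> h = ident C l"
      using dist_extend_shift[OF d ident_Hom[OF O(3)]] by blast
    have "v = zr (sh a) l" by (rule orthD[OF oB saB al(2) v(1)])
    then have "ident C l = zr l l" using v(2) cmp_zero_left[OF H(3) O(3)] by simp
    then have "l \<in> A k" using zero_objI[OF O(3)] tri_subcatD(6)[OF Suc.prems(1)[of k]] by simp
    then show ?thesis using tri_subcat_middle[OF Suc.prems(1)[of k] al(3) al(1)] True by simp
  next
    case False
    then have ik: "i < k" using Suc.prems(5) by simp
    \<comment> \<open>For a lower piece, \<open>a -> X\<close> vanishes, so \<open>a[1]\<close> is a
      retract of \<open>l\<close>. Again \<open>a[1] -> l\<close> is zero, hence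
      \<open>a = 0\<close>, and the induction hypothesis applies to \<open>X\<close>.\<close>
    have "f = zr a X" using orthD[OF Suc.prems(4)[OF ik lessI] aB Suc.prems(6) H(1)] .
    then have "sa f \<cdot> ident C (sh a) = zr (sh a) (sh X)"
      using shift_zero[OF O(1,2)] cmp_ident_right shift_Hom[OF H(1)] by simp
    then obtain v where v: "v \<in> Hom C (sh a) l" "h \<cdot> v = ident C (sh a)"
      using dist_lift_shift[OF d ident_Hom[OF shift_obj_in[OF O(1)]]] by blast
    have "v = zr (sh a) l" by (rule orthD[OF oB saB al(2) v(1)])
    then have "ident C (sh a) = zr (sh a) (sh a)" using v(2) cmp_zero_right[OF H(3) shift_obj_in[OF O(1)]]
        by simp
    then have "zero_obj C (sh a)" using zero_objI[OF shift_obj_in[OF O(1)]] by simp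
    then have "zero_obj C a" using tri_subcatD(4)[OF tri_subcat_zero O(1)] by simp
    then have "a \<in> hull_below A k" using tri_subcatD(6)[OF tA] by simp
    then have "X \<in> hull_below A k" using tri_subcat_middle[OF tA al(3)] al(2) by simp
    then show ?thesis using Suc.IH Suc.prems(1-4,6) ik by simp
  qed
qed

text \<open>For \<open>X\<close> in \<open>Pp (N - 1 - i)\<close>, cut at level
  \<open>N - i\<close>: the part \<open>d\<close> lies in \<open>Pp (N - i)\<close>, covered by
  induction and contained in \<open>Pp (N - 1 - i)\<close>. So the part \<open>c\<close> lies in
  \<open>Pp (N - 1 - i)\<close> too, that is, in the \<open>i\<close>-th piece.\<close>

lemma hull_below_dual_pieces:
  assumes Cc: "\<And>k. k \<le> N \<Longrightarrow> tri_subcat C (Cc k)" and Pp: "\<And>k. k \<le> N \<Longrightarrow> tri_subcat C (Pp k)"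
    and Pm: "\<And>j k. j \<le> k \<Longrightarrow> k \<le> N \<Longrightarrow> Pp k \<subseteq> Pp j"
    and U: "tri_subcat C U" and PN: "Pp N = {Z. zero_obj C Z}"
    and dec: "\<And>k X. k \<le> N \<Longrightarrow> X \<in> U \<Longrightarrow> \<exists>c \<in> Cc k \<inter> U. \<exists>d \<in> Pp k \<inter> U. tri c X d"
    and i: "i \<le> N"
  shows "hull_below (\<lambda>i. Pp (N - 1 - i) \<inter> Cc (N - i) \<inter> U) i = Pp (N - i) \<inter> U"
  using i
proof (induction i)
  case 0
  have "{Z. zero_obj C Z} \<subseteq> U" using tri_subcatD(6)[OF U] by blast
  then show ?case using PN by (auto simp: hull_below_0)
next
  case (Suc i)
  let ?H = "\<lambda>i. Pp (N - 1 - i) \<inter> Cc (N - i) \<inter> U"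
  have HO: "?H j \<subseteq> obj C" for j using tri_subcatD(1)[OF U] by blast
  note th = tri_subcat_hull_below[of "Suc i" ?H, OF HO]
  show ?case
  proof
    show "hull_below ?H (Suc i) \<subseteq> Pp (N - Suc i) \<inter> U"
    proof (rule hull_below_least)
      show "tri_subcat C (Pp (N - Suc i) \<inter> U)" by (rule tri_subcat_Int[OF Pp U]) simp
      show "?H j \<subseteq> Pp (N - Suc i) \<inter> U" if "j < Suc i" for j
      proof -
        have "Pp (N - 1 - j) \<subseteq> Pp (N - Suc i)" by (rule Pm) (use that in arith)+
        then show ?thesis by blast
      qed
    qed
    show "Pp (N - Suc i) \<inter> U \<subseteq> hull_below ?H (Suc i)"
    proof
      fix X assume X: "X \<in> Pp (N - Suc i) \<inter> U"
      then obtain c d where cd: "c \<in> Cc (N - i) \<inter> U" "d \<in> Pp (N - i) \<inter> U" "tri c X d"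
        using dec[of "N - i" X] by auto
      have "d \<in> hull_below ?H i" using cd(2) Suc by simp
      then have 1: "d \<in> hull_below ?H (Suc i)" using hull_below_mono[of i "Suc i" ?H] by auto
      have "Pp (N - i) \<subseteq> Pp (N - Suc i)" by (rule Pm) arith+
      then have "d \<in> Pp (N - Suc i)" using cd(2) by blast
      then have "c \<in> Pp (N - Suc i)" using tri_subcat_left[OF Pp cd(3)] X by simp
      then have "c \<in> ?H i" using cd(1) by simp
      then have 2: "c \<in> hull_below ?H (Suc i)" using hull_below_superset[of i "Suc i" ?H] by auto
      show "X \<in> hull_below ?H (Suc i)" by (rule tri_subcat_middle[OF th cd(3) 2 1])
    qed
  qed
qed

text \<open>The same cuts read from the other end. For \<open>X\<close> in
  \<open>Cc (i + 1)\<close>, cut at level \<open>i\<close>: \<open>c\<close> is covered by induction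
  and lies in \<open>Cc (i + 1)\<close>, so \<open>d\<close> does as well and belongs to the piece
  with index \<open>N - 1 - i\<close>.\<close>

lemma hull_above_dual_pieces:
  fixes N :: nat
  assumes Cc: "\<And>k. k \<le> N \<Longrightarrow> tri_subcat C (Cc k)"
    and Cm: "\<And>j k. j \<le> k \<Longrightarrow> k \<le> N \<Longrightarrow> Cc j \<subseteq> Cc k"
    and U: "tri_subcat C U" and C0: "Cc 0 = {Z. zero_obj C Z}"
    and dec: "\<And>k X. k \<le> N \<Longrightarrow> X \<in> U \<Longrightarrow> \<exists>c \<in> Cc k \<inter> U. \<exists>d \<in> Pp k \<inter> U. tri c X d"
    and i: "i \<le> N"
  shows "tri_hull C (\<Union>j \<in> {N - i..<N}. Pp (N - 1 - j) \<inter> Cc (N - j) \<inter> U) = Cc i \<inter> U"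
  using i
proof (induction i)
  case 0
  have "{Z. zero_obj C Z} \<subseteq> U" using tri_subcatD(6)[OF U] by blast
  then show ?case using C0 by (auto simp: tri_hull_empty)
next
  case (Suc i)
  let ?H = "\<lambda>i. Pp (N - 1 - i) \<inter> Cc (N - i) \<inter> U"
  let ?G = "\<lambda>i. tri_hull C (\<Union>j \<in> {N - i..<N}. ?H j)"
  have "(\<Union>j \<in> {N - Suc i..<N}. ?H j) \<subseteq> obj C" using tri_subcatD(1)[OF U] by blast
  note th = tri_subcat_tri_hull[OF this]
  show ?case
  proof
    show "?G (Suc i) \<subseteq> Cc (Suc i) \<inter> U"
    proof (rule tri_hull_least)
      show "tri_subcat C (Cc (Suc i) \<inter> U)" by (rule tri_subcat_Int[OF Cc U]) (rule Suc.prems)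
      have "?H j \<subseteq> Cc (Suc i) \<inter> U" if "j \<in> {N - Suc i..<N}" for j
      proof -
        have "Cc (N - j) \<subseteq> Cc (Suc i)" by (rule Cm) (use that Suc.prems in auto)
        then show ?thesis by blast
      qed
      then show "(\<Union>j \<in> {N - Suc i..<N}. ?H j) \<subseteq> Cc (Suc i) \<inter> U" by (rule UN_least)
    qed
    show "Cc (Suc i) \<inter> U \<subseteq> ?G (Suc i)"
    proof
      fix X assume X: "X \<in> Cc (Suc i) \<inter> U"
      then obtain c d where cd: "c \<in> Cc i \<inter> U" "d \<in> Pp i \<inter> U" "tri c X d"
        using dec[of i X] Suc.prems by auto
      have "c \<in> ?G i" using cd(1) Suc by simp
      moreover have "?G i \<subseteq> ?G (Suc i)" by (rule tri_hull_mono, rule UN_mono) auto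
      ultimately have 1: "c \<in> ?G (Suc i)" by blast
      have "c \<in> Cc (Suc i)" using Cm[of i "Suc i"] cd(1) Suc.prems by auto
      then have "d \<in> Cc (Suc i)" using tri_subcatD(5)[OF Cc[OF Suc.prems] _ _ cd(3)] X by simp
      then have "d \<in> ?H (N - Suc i)" using cd(2) Suc.prems by simp
      moreover have "N - Suc i \<in> {N - Suc i..<N}" using Suc.prems by simp
      ultimately have "d \<in> (\<Union>j \<in> {N - Suc i..<N}. ?H j)" by (rule UN_I[rotated])
      then have 2: "d \<in> ?G (Suc i)" by (rule subsetD[OF tri_hull_superset])
      show "X \<in> ?G (Suc i)" by (rule tri_subcat_middle[OF th cd(3) 1 2])
    qed
  qed
qed

end

section \<open>Coproduct closure of filtrations, and homotopy colimits\<close>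

context triangulated_category_coproducts
begin

text \<open>A semi-orthogonal hull is an iterated extension product, and extension products preserve
  closure under coproducts. Hence such a hull of coproduct closed pieces is already closed.\<close>

lemma coproduct_closed_hull_below:
  assumes B: "\<And>i. i < k \<Longrightarrow> tri_subcat C (B i)" and o: "\<And>i j. i < j \<Longrightarrow> j < k \<Longrightarrow> orth (B j) (B i)"
    and c: "\<And>i. i < k \<Longrightarrow> coproduct_closed \<kappa> C (B i)"
  shows "coproduct_closed \<kappa> C (hull_below B k)"
  using assms
proof (induction k)
  case 0
  show ?case unfolding hull_below_0 zero_objs_eq_left_perp by (rule coproduct_closed_left_perp) simp
next
  case (Suc k)
  have "coproduct_closed \<kappa> C (star (B k) (hull_below B k))"
    by (rule coproduct_closed_star) (use Suc in simp_all)
  then show ?case using hull_below_Suc[of k B] Suc.prems by simp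
qed

text \<open>The homotopy colimit \<open>Y\<close> is the cone of \<open>1 - t\<close> on the
  coproduct of the \<open>c k\<close>. Maps out of \<open>Y\<close> are only claimed to exist, since
  they are unique only up to maps through \<open>P[1]\<close>. Compact sources are written
  \<open>sh M\<close> because the argument desuspends the component of \<open>m\<close> in
  \<open>P[1]\<close>.\<close>

lemma telescope:
  assumes t: "\<And>k. t k \<in> Hom C (c k) (c (Suc k))"
  obtains Y g where "\<And>k. g k \<in> Hom C (c k) Y" "\<And>k. g (Suc k) \<cdot> t k = g k"
    "\<And>X q. (\<And>k. q k \<in> Hom C (c k) X) \<Longrightarrow> (\<And>k. q (Suc k) \<cdot> t k = q k) \<Longrightarrow>
      \<exists>q' \<in> Hom C Y X. \<forall>k. q' \<cdot> g k = q k"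
    "\<And>M m. compact_obj \<kappa> C M \<Longrightarrow> compact_obj \<kappa> C (sh M) \<Longrightarrow> m \<in> Hom C (sh M) Y \<Longrightarrow>
      \<exists>k. \<exists>x \<in> Hom C (sh M) (c k). g k \<cdot> x = m"
    "\<And>S. tri_subcat C S \<Longrightarrow> coproduct_closed \<kappa> C S \<Longrightarrow> (\<And>k. c k \<in> S) \<Longrightarrow> Y \<in> S"
proof -
  have cO: "c k \<in> obj C" for k using Hom_objD(1)[OF t] .
  obtain P \<iota> where P: "is_coproduct C (UNIV :: nat set) c P \<iota>"
    and PS: "\<forall>S. coproduct_closed \<kappa> C S \<longrightarrow> (\<forall>j \<in> UNIV. c j \<in> S) \<longrightarrow> P \<in> S"
    and Pc: "\<forall>M H. compact_obj \<kappa> C M \<longrightarrow> zr M P \<in> H \<longrightarrow>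
      (\<forall>f \<in> Hom C M P \<inter> H. \<forall>g \<in> Hom C M P \<inter> H. f \<^bold>+ g \<in> H) \<longrightarrow>
      (\<forall>j \<in> UNIV. \<forall>x \<in> Hom C M (c j). \<iota> j \<cdot> x \<in> H) \<longrightarrow> Hom C M P \<subseteq> H"
    using small_coproduct[OF natLeq_less_universe ballI, of c, OF cO] by (elim exE conjE) (rule that)
  have Pc: "m \<in> H" if "compact_obj \<kappa> C M" "m \<in> Hom C M P" "zr M P \<in> H"
    "\<And>f g. f \<in> Hom C M P \<Longrightarrow> g \<in> Hom C M P \<Longrightarrow> f \<in> H \<Longrightarrow> g \<in> H \<Longrightarrow> f \<^bold>+ g \<in> H"
    "\<And>j x. x \<in> Hom C M (c j) \<Longrightarrow> \<iota> j \<cdot> x \<in> H" for M H m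
    by (rule subsetD[OF Pc[rule_format, OF that(1,3)] that(2)]) (use that(4,5) in simp_all)
  have PO: "P \<in> obj C" by (rule coproduct_obj[OF P])
  have \<iota>: "\<iota> k \<in> Hom C (c k) P" for k by (rule coproduct_inj_Hom[OF P UNIV_I])
  have \<iota>t: "\<iota> (Suc k) \<cdot> t k \<in> Hom C (c k) P" for k by (rule cmp_Hom[OF t \<iota>])
  have desc: "\<exists>h \<in> Hom C P Y. \<forall>k. h \<cdot> \<iota> k = g k" if "Y \<in> obj C" "\<And>k. g k \<in> Hom C (c k) Y" for g Y
    by (rule coproduct_desc[OF P that(1), of g, OF that(2)]) auto
  have eqI: "h = h'" if "h \<in> Hom C P Y" "h' \<in> Hom C P Y" "\<And>k. h \<cdot> \<iota> k = h' \<cdot> \<iota> k" for h h' Y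
    by (rule coproduct_eqI[OF P that(1,2) that(3)])
  \<comment> \<open>The map \<open>1 - t\<close>: on the \<open>k\<close>-th summand, the inclusion
    minus the transition into the next summand.\<close>
  obtain \<phi> where \<phi>: "\<phi> \<in> Hom C P P" "\<And>k. \<phi> \<cdot> \<iota> k = \<iota> k \<^bold>+ ng (\<iota> (Suc k) \<cdot> t k)"
    using desc[OF PO, of "\<lambda>k. \<iota> k \<^bold>+ ng (\<iota> (Suc k) \<cdot> t k)"] add_Hom[OF \<iota> neg_Hom[OF \<iota>t]] by blast
  obtain Y \<gamma> \<delta> where d: "dist_triangle C P P Y \<phi> \<gamma> \<delta>" using cone_exists[OF \<phi>(1)] by blast
  note \<gamma> = dist_Hom(2)[OF d] and \<delta> = dist_Hom(3)[OF d] and YO = dist_obj(3)[OF d]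
  define g where "g k = \<gamma> \<cdot> \<iota> k" for k
  have g: "g k \<in> Hom C (c k) Y" for k unfolding g_def by (rule cmp_Hom[OF \<iota> \<gamma>])
  have q\<phi>: "q \<cdot> \<phi> \<cdot> \<iota> k = q \<cdot> \<iota> k \<^bold>+ ng (q \<cdot> \<iota> (Suc k) \<cdot> t k)" if q: "q \<in> Hom C P X" for q X k
    using cmp_assoc[OF \<iota> \<phi>(1) q] \<phi>(2) cmp_add_right[OF \<iota> neg_Hom[OF \<iota>t] q] cmp_neg_right[OF \<iota>t q]
      cmp_assoc[OF t \<iota> q] by simp
  have gt: "g (Suc k) \<cdot> t k = g k" for k
  proof -
    have "\<gamma> \<cdot> \<phi> \<cdot> \<iota> k = zr (c k) Y" using dist_cmp_zero(1)[OF d] cmp_zero_left[OF \<iota> YO] by simp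
    then have "g k \<^bold>+ ng (g (Suc k) \<cdot> t k) = zr (c k) Y" using q\<phi>[OF \<gamma>] unfolding g_def by simp
    then show ?thesis by (rule diff_zero_eq[OF g cmp_Hom[OF t g], symmetric])
  qed
  have ext: "\<exists>q' \<in> Hom C Y X. \<forall>k. q' \<cdot> g k = q k"
    if q: "\<And>k. q k \<in> Hom C (c k) X" "\<And>k. q (Suc k) \<cdot> t k = q k" for X q
  proof -
    have X: "X \<in> obj C" using Hom_objD(2)[OF q(1)] .
    obtain r where r: "r \<in> Hom C P X" "\<And>k. r \<cdot> \<iota> k = q k" using desc[OF X q(1)] by blast
    have "r \<cdot> \<phi> = zr P X"
    proof (rule eqI[OF cmp_Hom[OF \<phi>(1) r(1)] zero_Hom[OF PO X]])
      show "r \<cdot> \<phi> \<cdot> \<iota> k = zr P X \<cdot> \<iota> k" for k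
        using q\<phi>[OF r(1)] r(2) q(2) add_neg[OF q(1)] cmp_zero_left[OF \<iota> X] by simp
    qed
    then obtain q' where q': "q' \<in> Hom C Y X" "q' \<cdot> \<gamma> = r" using dist_extend[OF d r(1)] by blast
    then have "q' \<cdot> g k = q k" for k unfolding g_def using cmp_assoc[OF \<iota> \<gamma> q'(1)] r(2) by simp
    then show ?thesis using q'(1) by blast
  qed
  \<comment> \<open>Zero morphisms exist, so the coproduct has projections \<open>\<pi> k\<close> to
    its summands. The truncations \<open>p K\<close> below retain the summands with index less than
    \<open>K\<close>.\<close>
  have "\<exists>h. h \<in> Hom C P (c k) \<and> (\<forall>j. h \<cdot> \<iota> j = (if j = k then ident C (c k) else zr (c j) (c k)))" for k
    using desc[OF cO, of "\<lambda>j. if j = k then ident C (c k) else zr (c j) (c k)" k]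
      ident_Hom[OF cO] zero_Hom[OF cO cO] by fastforce
  then obtain \<pi> where \<pi>: "\<And>k. \<pi> k \<in> Hom C P (c k)"
    and \<pi>\<iota>: "\<And>k j. \<pi> k \<cdot> \<iota> j = (if j = k then ident C (c k) else zr (c j) (c k))" by metis
  have "\<exists>h. h \<in> Hom C P P \<and> (\<forall>j. h \<cdot> \<iota> j = (if j < K then \<iota> j else zr (c j) P))" for K :: nat
    using desc[OF PO, of "\<lambda>j. if j < K then \<iota> j else zr (c j) P"] \<iota> zero_Hom[OF cO PO] by fastforce
  then obtain p where p: "\<And>K. p K \<in> Hom C P P"
    and p\<iota>: "\<And>K j. p K \<cdot> \<iota> j = (if j < K then \<iota> j else zr (c j) P)" by metis
  have p0: "p 0 = zr P P"
    by (rule eqI[OF p zero_Hom[OF PO PO]]) (simp add: p\<iota> cmp_zero_left[OF \<iota> PO])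
  have \<iota>\<pi>: "\<iota> K \<cdot> \<pi> K \<in> Hom C P P" for K by (rule cmp_Hom[OF \<pi> \<iota>])
  have pS: "p (Suc K) = p K \<^bold>+ \<iota> K \<cdot> \<pi> K" for K
  proof (rule eqI[OF p add_Hom[OF p \<iota>\<pi>]])
    fix j
    have "(p K \<^bold>+ \<iota> K \<cdot> \<pi> K) \<cdot> \<iota> j = p K \<cdot> \<iota> j \<^bold>+ \<iota> K \<cdot> (\<pi> K \<cdot> \<iota> j)"
      using cmp_add_left[OF \<iota> p \<iota>\<pi>] cmp_assoc[OF \<iota> \<pi> \<iota>] by simp
    also have "\<dots> = p (Suc K) \<cdot> \<iota> j"
      using p\<iota> \<pi>\<iota> cmp_ident_right[OF \<iota>] cmp_zero_right[OF \<iota> cO] add_zero[OF \<iota>] add_zero[OF zero_Hom[OF cO PO]]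
      by (simp add: less_Suc_eq)
    finally show "p (Suc K) \<cdot> \<iota> j = (p K \<^bold>+ \<iota> K \<cdot> \<pi> K) \<cdot> \<iota> j" by simp
  qed
  have proj0: "y = zr M P" if M: "compact_obj \<kappa> C M" and y: "y \<in> Hom C M P" and 0: "\<And>k. \<pi> k \<cdot> y = zr M (c k)"
      for M y
  proof -
    have MO: "M \<in> obj C" using Hom_objD(1)[OF y] .
    have py: "p K \<cdot> y = zr M P" for K
    proof (induction K)
      case 0
      show ?case using p0 cmp_zero_left[OF y PO] by simp
    next
      case (Suc K)
      have "p (Suc K) \<cdot> y = p K \<cdot> y \<^bold>+ \<iota> K \<cdot> (\<pi> K \<cdot> y)"
        using pS cmp_add_left[OF y p \<iota>\<pi>] cmp_assoc[OF y \<pi> \<iota>] by simp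
      then show ?case using Suc 0 cmp_zero_right[OF \<iota> MO] add_zero[OF zero_Hom[OF MO PO]] by simp
    qed
    \<comment> \<open>A morphism from a compact source has finite support, hence is fixed by all
      large truncations. Asking for all large \<open>K'\<close>, not for one, makes the property
      additive. With vanishing components every truncation is zero, so \<open>y\<close> is
      zero.\<close>
    have "y \<in> {m. \<exists>K. \<forall>K'\<ge>K. p K' \<cdot> m = m}"
    proof (rule Pc[OF M y])
      show "zr M P \<in> {m. \<exists>K. \<forall>K'\<ge>K. p K' \<cdot> m = m}" using cmp_zero_right[OF p MO] by simp
      show "u \<^bold>+ v \<in> {m. \<exists>K. \<forall>K'\<ge>K. p K' \<cdot> m = m}"
        if uv: "u \<in> Hom C M P" "v \<in> Hom C M P" "u \<in> {m. \<exists>K. \<forall>K'\<ge>K. p K' \<cdot> m = m}"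
          "v \<in> {m. \<exists>K. \<forall>K'\<ge>K. p K' \<cdot> m = m}" for u v
      proof -
        obtain K L where "\<forall>K'\<ge>K. p K' \<cdot> u = u" "\<forall>K'\<ge>L. p K' \<cdot> v = v" using uv by blast
        then have "\<forall>K'\<ge>max K L. p K' \<cdot> (u \<^bold>+ v) = u \<^bold>+ v" using cmp_add_right[OF uv(1,2) p] by simp
        then show ?thesis by blast
      qed
      show "\<iota> j \<cdot> x \<in> {m. \<exists>K. \<forall>K'\<ge>K. p K' \<cdot> m = m}" if x: "x \<in> Hom C M (c j)" for j x
      proof -
        have "\<forall>K'\<ge>Suc j. p K' \<cdot> (\<iota> j \<cdot> x) = \<iota> j \<cdot> x" using cmp_assoc[OF x \<iota> p] p\<iota> by simp
        then show ?thesis by blast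
      qed
    qed
    then show ?thesis using py by auto
  qed
  \<comment> \<open>In components, \<open>\<phi> \<cdot> y = 0\<close> says that the first component
    of \<open>y\<close> is zero and that each later one is the transition applied to its
    predecessor. So all components vanish.\<close>
  have inj: "y = zr M P" if M: "compact_obj \<kappa> C M" and y: "y \<in> Hom C M P" and 0: "\<phi> \<cdot> y = zr M P" for M y
  proof (rule proj0[OF M y])
    have MO: "M \<in> obj C" using Hom_objD(1)[OF y] .
    have \<pi>\<phi>y: "\<pi> k \<cdot> \<phi> \<cdot> y = zr M (c k)" for k
      using cmp_assoc[OF y \<phi>(1) \<pi>] 0 cmp_zero_right[OF \<pi> MO] by simp
    show "\<pi> k \<cdot> y = zr M (c k)" for k
    proof (induction k)
      case 0
      have "\<pi> 0 \<cdot> \<phi> = \<pi> 0"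
      proof (rule eqI[OF cmp_Hom[OF \<phi>(1) \<pi>] \<pi>])
        have "\<pi> 0 \<cdot> \<iota> j \<in> Hom C (c j) (c 0)" for j by (rule cmp_Hom[OF \<iota> \<pi>])
        then show "\<pi> 0 \<cdot> \<phi> \<cdot> \<iota> j = \<pi> 0 \<cdot> \<iota> j" for j
          using q\<phi>[OF \<pi>, of 0 j] \<pi>\<iota>[of 0 "Suc j"] cmp_zero_left[OF t cO] neg_zero[OF cO cO] add_zero by simp
      qed
      then show ?case using \<pi>\<phi>y[of 0] by simp
    next
      case (Suc k)
      have t\<pi>: "t k \<cdot> \<pi> k \<in> Hom C P (c (Suc k))" by (rule cmp_Hom[OF \<pi> t])
      have "\<pi> (Suc k) \<cdot> \<phi> = \<pi> (Suc k) \<^bold>+ ng (t k \<cdot> \<pi> k)"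
      proof (rule eqI[OF cmp_Hom[OF \<phi>(1) \<pi>] add_Hom[OF \<pi> neg_Hom[OF t\<pi>]]])
        fix j
        have "\<pi> (Suc k) \<cdot> \<iota> (Suc j) \<cdot> t j = t k \<cdot> (\<pi> k \<cdot> \<iota> j)"
          using \<pi>\<iota> cmp_ident_left[OF t] cmp_ident_right[OF t] cmp_zero_left[OF t cO] cmp_zero_right[OF t cO]
              by simp
        then show "\<pi> (Suc k) \<cdot> \<phi> \<cdot> \<iota> j = (\<pi> (Suc k) \<^bold>+ ng (t k \<cdot> \<pi> k)) \<cdot> \<iota> j"
          using q\<phi>[OF \<pi>] cmp_add_left[OF \<iota> \<pi> neg_Hom[OF t\<pi>]] cmp_neg_left[OF \<iota> t\<pi>] cmp_assoc[OF \<iota> \<pi> t] by simp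
      qed
      then have "\<pi> (Suc k) \<cdot> y \<^bold>+ ng (t k \<cdot> (\<pi> k \<cdot> y)) = zr M (c (Suc k))"
        using \<pi>\<phi>y[of "Suc k"] cmp_add_left[OF y \<pi> neg_Hom[OF t\<pi>]] cmp_neg_left[OF y t\<pi>] cmp_assoc[OF y \<pi> t]
            by simp
      then show ?case
        using Suc cmp_zero_right[OF t MO] neg_zero[OF MO cO] add_zero(1)[OF cmp_Hom[OF y \<pi>]] by simp
    qed
  qed
  \<comment> \<open>Moving along the transitions brings morphisms from different stages to a common
    one, as needed to add them.\<close>
  have push: "\<exists>x' \<in> Hom C M (c K). g K \<cdot> x' = g k \<cdot> x" if kK: "k \<le> K" and x: "x \<in> Hom C M (c k)" for M x k K
    using kK
  proof (induction K rule: dec_induct)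
    case base
    show ?case using x by blast
  next
    case (step K)
    then obtain x' where x': "x' \<in> Hom C M (c K)" "g K \<cdot> x' = g k \<cdot> x" by blast
    then have "g (Suc K) \<cdot> (t K \<cdot> x') = g k \<cdot> x" using cmp_assoc[OF x'(1) t g] gt by simp
    then show ?case using cmp_Hom[OF x'(1) t] by blast
  qed
  have fac: "\<exists>k. \<exists>x \<in> Hom C (sh M) (c k). g k \<cdot> x = m"
    if M: "compact_obj \<kappa> C M" "compact_obj \<kappa> C (sh M)" and m: "m \<in> Hom C (sh M) Y" for M m
  proof -
    have MO: "M \<in> obj C" using M(1) by (simp add: compact_obj_def)
    note sMO = shift_obj_in[OF MO]
    \<comment> \<open>The component \<open>\<delta> \<cdot> m\<close> in \<open>P[1]\<close>
      desuspends to a morphism killed by \<open>\<phi>\<close>, hence is zero. So \<open>m\<close>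
      lifts to \<open>P\<close>, where compactness puts it at a finite stage.\<close>
    obtain y where y: "y \<in> Hom C M P" "sa y = \<delta> \<cdot> m" using shift_arr_surj[OF cmp_Hom[OF m \<delta>] MO PO] by blast
    have "sa (\<phi> \<cdot> y) = zr (sh M) (sh P)"
      using shift_cmp[OF y(1) \<phi>(1)] y(2) cmp_assoc[OF m \<delta> shift_Hom[OF \<phi>(1)]] dist_cmp_zero_shift[OF d]
        cmp_zero_left[OF m shift_obj_in[OF PO]] by simp
    then have "\<phi> \<cdot> y = zr M P" using shift_zero_iff[OF cmp_Hom[OF y(1) \<phi>(1)]] by simp
    then have "y = zr M P" by (rule inj[OF M(1) y(1)])
    then have "\<delta> \<cdot> m = zr (sh M) (sh P)" using y(2) shift_zero[OF MO PO] by simp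
    then obtain m' where m': "m' \<in> Hom C (sh M) P" "\<gamma> \<cdot> m' = m" using dist_lift_mid[OF d m] by blast
    have "m' \<in> {m'. \<exists>k. \<exists>x \<in> Hom C (sh M) (c k). g k \<cdot> x = \<gamma> \<cdot> m'}"
    proof (rule Pc[OF M(2) m'(1)])
      have "g 0 \<cdot> zr (sh M) (c 0) = \<gamma> \<cdot> zr (sh M) P"
        using cmp_zero_right[OF g sMO] cmp_zero_right[OF \<gamma> sMO] by simp
      then show "zr (sh M) P \<in> {m'. \<exists>k. \<exists>x \<in> Hom C (sh M) (c k). g k \<cdot> x = \<gamma> \<cdot> m'}"
        using zero_Hom[OF sMO cO] by blast
    next
      fix u v assume uv: "u \<in> Hom C (sh M) P" "v \<in> Hom C (sh M) P"
        and H: "u \<in> {m'. \<exists>k. \<exists>x \<in> Hom C (sh M) (c k). g k \<cdot> x = \<gamma> \<cdot> m'}"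
          "v \<in> {m'. \<exists>k. \<exists>x \<in> Hom C (sh M) (c k). g k \<cdot> x = \<gamma> \<cdot> m'}"
      then obtain k x l z where kx: "x \<in> Hom C (sh M) (c k)" "g k \<cdot> x = \<gamma> \<cdot> u"
        and lz: "z \<in> Hom C (sh M) (c l)" "g l \<cdot> z = \<gamma> \<cdot> v" by blast
      obtain x' where x': "x' \<in> Hom C (sh M) (c (max k l))" "g (max k l) \<cdot> x' = \<gamma> \<cdot> u"
        using push[OF max.cobounded1 kx(1), of l] kx(2) by auto
      obtain z' where z': "z' \<in> Hom C (sh M) (c (max k l))" "g (max k l) \<cdot> z' = \<gamma> \<cdot> v"
        using push[OF max.cobounded2 lz(1), of k] lz(2) by auto
      have "g (max k l) \<cdot> (x' \<^bold>+ z') = \<gamma> \<cdot> (u \<^bold>+ v)"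
        using cmp_add_right[OF x'(1) z'(1) g] cmp_add_right[OF uv \<gamma>] x' z' by simp
      then show "u \<^bold>+ v \<in> {m'. \<exists>k. \<exists>x \<in> Hom C (sh M) (c k). g k \<cdot> x = \<gamma> \<cdot> m'}"
        using add_Hom[OF x'(1) z'(1)] by blast
    next
      fix j x assume x: "x \<in> Hom C (sh M) (c j)"
      then have "g j \<cdot> x = \<gamma> \<cdot> (\<iota> j \<cdot> x)" unfolding g_def using cmp_assoc[OF x \<iota> \<gamma>] by simp
      then show "\<iota> j \<cdot> x \<in> {m'. \<exists>k. \<exists>x \<in> Hom C (sh M) (c k). g k \<cdot> x = \<gamma> \<cdot> m'}" using x by blast
    qed
    then show ?thesis using m'(2) by simp
  qed
  show ?thesis
  proof (rule that[OF g gt ext fac])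
    fix S assume S: "tri_subcat C S" "coproduct_closed \<kappa> C S" "\<And>k. c k \<in> S"
    have "P \<in> S" using PS S(2,3) by blast
    moreover have "tri P P Y" unfolding tri_def using d by blast
    ultimately show "Y \<in> S" using tri_subcatD(5)[OF S(1)] by blast
  qed
qed

end

section \<open>Localization at compact objects\<close>

context triangulated_category_coproducts
begin

text \<open>Regularity of \<kappa> enters here: it keeps the set of pairs of a representative and a
  morphism out of it small.\<close>

lemma small_Sigma:
  assumes "|A| <o \<kappa>" "\<And>a. a \<in> A \<Longrightarrow> |F a| <o \<kappa>" shows "|Sigma A F| <o \<kappa>"
proof (rule stable_elim[OF regularCard_stable assms])
  show c: "Card_order \<kappa>" and "regularCard \<kappa>" using universe unfolding universe_card_def by blast+
  show "infinite (Field \<kappa>)"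
  proof
    assume "finite (Field \<kappa>)"
    then have "|Field \<kappa>| <o natLeq" by (simp add: finite_iff_ordLess_natLeq)
    then have "\<kappa> <o natLeq" using card_of_Field_ordIso[OF c] ordIso_symmetric ordIso_ordLess_trans by blast
    then show False using universe ordLess_irreflexive ordLess_transitive unfolding universe_card_def by blast
  qed
qed

text \<open>One copy of \<open>M\<close> is taken for each chosen morphism \<open>f\<close> in
  \<open>G M\<close>, and \<open>e\<close> restricts to \<open>f\<close> on that copy. With all
  morphisms chosen, \<open>e\<close> is surjective on morphisms from \<open>Sk\<close>; with a
  kernel chosen, the cone of \<open>e\<close> kills that kernel. The last clause is what extends the
  map to \<open>X\<close> over this cone.\<close>

lemma covering_coproduct:
  assumes Sk: "Sk \<subseteq> L" "|Sk| <o \<kappa>" and L: "L \<subseteq> obj C" and X: "X \<in> obj C"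
    and G: "\<And>M. M \<in> Sk \<Longrightarrow> G M \<subseteq> Hom C M X" "\<And>M. M \<in> Sk \<Longrightarrow> |Hom C M X| <o \<kappa>"
  shows "\<exists>P \<in> coproduct_hull \<kappa> C L. \<exists>e \<in> Hom C P X.
    (\<forall>M \<in> Sk. \<forall>f \<in> G M. \<exists>i \<in> Hom C M P. e \<cdot> i = f) \<and>
    (\<forall>W. \<forall>r \<in> Hom C X W. (\<forall>M \<in> Sk. \<forall>f \<in> G M. r \<cdot> f = zr M W) \<longrightarrow> r \<cdot> e = zr P W)"
proof -
  let ?J = "Sigma Sk G"
  have J: "|?J| <o \<kappa>"
  proof (rule small_Sigma[OF Sk(2)])
    fix M assume M: "M \<in> Sk"
    show "|G M| <o \<kappa>" by (rule ordLeq_ordLess_trans[OF card_of_mono1[OF G(1)[OF M]] G(2)[OF M]])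
  qed
  have JO: "\<forall>j \<in> ?J. fst j \<in> obj C" using Sk L by auto
  obtain P \<iota> where P: "is_coproduct C ?J fst P \<iota>"
    and PS: "\<forall>S. coproduct_closed \<kappa> C S \<longrightarrow> (\<forall>j \<in> ?J. fst j \<in> S) \<longrightarrow> P \<in> S"
    using small_coproduct[OF J JO] by (elim exE conjE) (rule that)
  have "P \<in> coproduct_hull \<kappa> C L"
  proof (rule PS[rule_format, OF coproduct_closed_coproduct_hull])
    fix j assume "j \<in> ?J"
    then show "fst j \<in> coproduct_hull \<kappa> C L" using Sk(1) coproduct_hull_superset[of L \<kappa>] by auto
  qed
  moreover
  have "snd j \<in> Hom C (fst j) X" if "j \<in> ?J" for j
    using that G(1)[of "fst j"] by (auto simp: subset_iff)
  then obtain e where e: "e \<in> Hom C P X" "\<And>j. j \<in> ?J \<Longrightarrow> e \<cdot> \<iota> j = snd j"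
    using coproduct_desc[OF P X, of snd] by metis
  have "\<exists>i \<in> Hom C M P. e \<cdot> i = f" if "M \<in> Sk" "f \<in> G M" for M f
    using e(2)[of "(M, f)"] coproduct_inj_Hom[OF P, of "(M, f)"] that by auto
  moreover have "r \<cdot> e = zr P W"
    if r: "r \<in> Hom C X W" and 0: "\<forall>M \<in> Sk. \<forall>f \<in> G M. r \<cdot> f = zr M W" for r W
  proof (rule coproduct_eqI[OF P cmp_Hom[OF e(1) r] zero_Hom[OF coproduct_obj[OF P] Hom_objD(2)[OF r]]])
    fix j assume j: "j \<in> ?J"
    note \<iota> = coproduct_inj_Hom[OF P j]
    have "r \<cdot> e \<cdot> \<iota> j = r \<cdot> snd j" using cmp_assoc[OF \<iota> e(1) r] e(2)[OF j] by simp
    also have "\<dots> = zr (fst j) W" using 0 j by auto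
    finally show "r \<cdot> e \<cdot> \<iota> j = zr P W \<cdot> \<iota> j" using cmp_zero_left[OF \<iota> Hom_objD(2)[OF r]] by simp
  qed
  ultimately show ?thesis using e(1) by blast
qed

text \<open>Cellular approximation: \<open>c\<close> is the homotopy colimit of objects \<open>c\<^sub>k\<close> over \<open>X\<close>, where \<open>c\<^sub>0 \<rightarrow> X\<close> is
  surjective on morphisms from \<open>L\<close> and \<open>c\<^sub>k \<rightarrow> c\<^sub>k\<^sub>+\<^sub>1\<close> kills all such morphisms that vanish in \<open>X\<close>.\<close>

lemma localization_triangle:
  assumes L: "tri_subcat C L" and cpt: "\<And>M. M \<in> L \<Longrightarrow> compact_obj \<kappa> C M"
    and es: "essentially_small \<kappa> C L" and ls: "locally_small_from \<kappa> C L" and X: "X \<in> obj C"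
  shows "\<exists>c \<in> coproduct_hull \<kappa> C L. \<exists>d \<in> right_perp C L (obj C). tri c X d"
proof -
  note LO = tri_subcatD(1)[OF L]
  obtain Sk where Sk: "Sk \<subseteq> L" "|Sk| <o \<kappa>" "\<And>M. M \<in> L \<Longrightarrow> \<exists>M' \<in> Sk. isomorphic C M M'"
    using es unfolding essentially_small_def by blast
  let ?H = "coproduct_hull \<kappa> C L"
  note H = tri_subcat_coproduct_hull[OF LO, of \<kappa>]
  have sm: "|Hom C M Y| <o \<kappa>" if "M \<in> Sk" "Y \<in> obj C" for M Y
    using ls Sk(1) that unfolding locally_small_from_def by blast
  \<comment> \<open>A state is an object with a map to \<open>X\<close>. Surjectivity is imposed
    only at stage 0, because compatibility with the transitions passes it on to the colimit.\<close>
  define P where "P k s \<longleftrightarrow> fst s \<in> ?H \<and> snd s \<in> Hom C (fst s) X \<and>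
    (k = (0::nat) \<longrightarrow> (\<forall>M \<in> Sk. \<forall>f \<in> Hom C M X. \<exists>i \<in> Hom C M (fst s). snd s \<cdot> i = f))" for k s
  define Q where "Q s s' \<longleftrightarrow> (\<exists>t. t \<in> Hom C (fst s) (fst s') \<and> snd s' \<cdot> t = snd s \<and>
    (\<forall>M \<in> Sk. \<forall>x \<in> Hom C M (fst s). snd s \<cdot> x = zr M X \<longrightarrow> t \<cdot> x = zr M (fst s')))" for s s'
  have "\<exists>s. \<forall>k. P k (s k) \<and> Q (s k) (s (Suc k))"
  proof (rule dependent_nat_choice)
    obtain c q where "c \<in> ?H" "q \<in> Hom C c X" "\<forall>M \<in> Sk. \<forall>f \<in> Hom C M X. \<exists>i \<in> Hom C M c. q \<cdot> i = f"
      using covering_coproduct[OF Sk(1,2) LO X, of "\<lambda>M. Hom C M X"] sm[OF _ X] by blast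
    then show "\<exists>s. P 0 s" unfolding P_def by (intro exI[of _ "(c, q)"]) simp
  next
    fix s k assume s: "P k s"
    obtain c q where cq: "s = (c, q)" by fastforce
    have c: "c \<in> ?H" and q: "q \<in> Hom C c X" using s unfolding P_def cq by simp_all
    have cO: "c \<in> obj C" using Hom_objD(1)[OF q] .
    obtain p e where p: "p \<in> ?H" and e: "e \<in> Hom C p c"
      and e1: "\<forall>M \<in> Sk. \<forall>f \<in> {x \<in> Hom C M c. q \<cdot> x = zr M X}. \<exists>i \<in> Hom C M p. e \<cdot> i = f"
      and e2: "\<forall>W. \<forall>r \<in> Hom C c W. (\<forall>M \<in> Sk. \<forall>f \<in> {x \<in> Hom C M c. q \<cdot> x = zr M X}. r \<cdot> f = zr M W) \<longrightarrow> r \<cdot> e = zr p W"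
      using covering_coproduct[OF Sk(1,2) LO cO, of "\<lambda>M. {x \<in> Hom C M c. q \<cdot> x = zr M X}"] sm[OF _ cO] by auto
    have qe: "q \<cdot> e = zr p X" using e2 q by simp
    \<comment> \<open>Since \<open>q \<cdot> e\<close> vanishes, \<open>q\<close> extends over the
      cone \<open>c'\<close>. Each morphism from \<open>Sk\<close> that dies in \<open>X\<close>
      factors through \<open>e\<close>, hence dies in \<open>c'\<close>.\<close>
    obtain c' t w where d: "dist_triangle C p c c' e t w" using cone_exists[OF e] by blast
    note t = dist_Hom(2)[OF d]
    obtain q' where q': "q' \<in> Hom C c' X" "q' \<cdot> t = q" using dist_extend[OF d q qe] by blast
    have "tri p c c'" unfolding tri_def using d by blast
    then have "c' \<in> ?H" using tri_subcatD(5)[OF H p c] by blast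
    moreover have "t \<cdot> x = zr M c'" if M: "M \<in> Sk" and x: "x \<in> Hom C M c" "q \<cdot> x = zr M X" for M x
    proof -
      obtain i where i: "i \<in> Hom C M p" "e \<cdot> i = x" using e1 M x by blast
      then have "t \<cdot> x = t \<cdot> e \<cdot> i" using cmp_assoc[OF i(1) e t] by simp
      then show ?thesis using dist_cmp_zero(1)[OF d] cmp_zero_left[OF i(1) dist_obj(3)[OF d]] by simp
    qed
    ultimately show "\<exists>s'. P (Suc k) s' \<and> Q s s'"
      unfolding P_def Q_def cq using q' t by (intro exI[of _ "(c', q')"]) auto
  qed
  then obtain s where s: "\<And>k. P k (s k)" "\<And>k. Q (s k) (s (Suc k))" by blast
  define c where "c k = fst (s k)" for k
  define q where "q k = snd (s k)" for k
  have cH: "c k \<in> ?H" and q: "q k \<in> Hom C (c k) X" for k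
    using s(1)[of k] unfolding P_def c_def q_def by simp_all
  have q0: "\<forall>M \<in> Sk. \<forall>f \<in> Hom C M X. \<exists>i \<in> Hom C M (c 0). q 0 \<cdot> i = f"
    using s(1)[of 0] unfolding P_def c_def q_def by simp
  have "\<exists>t. \<forall>k. t k \<in> Hom C (c k) (c (Suc k)) \<and> q (Suc k) \<cdot> t k = q k \<and>
    (\<forall>M \<in> Sk. \<forall>x \<in> Hom C M (c k). q k \<cdot> x = zr M X \<longrightarrow> t k \<cdot> x = zr M (c (Suc k)))"
    by (rule choice) (use s(2) in \<open>simp add: Q_def c_def q_def\<close>)
  then obtain t where t: "\<And>k. t k \<in> Hom C (c k) (c (Suc k))" and qt: "\<And>k. q (Suc k) \<cdot> t k = q k"
    and tk: "\<And>k. \<forall>M \<in> Sk. \<forall>x \<in> Hom C M (c k). q k \<cdot> x = zr M X \<longrightarrow> t k \<cdot> x = zr M (c (Suc k))" by blast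
  obtain Y g where g: "\<And>k. g k \<in> Hom C (c k) Y" and gt: "\<And>k. g (Suc k) \<cdot> t k = g k"
    and ext: "\<And>X q. (\<And>k. q k \<in> Hom C (c k) X) \<Longrightarrow> (\<And>k. q (Suc k) \<cdot> t k = q k) \<Longrightarrow>
      \<exists>q' \<in> Hom C Y X. \<forall>k. q' \<cdot> g k = q k"
    and fac: "\<And>M m. compact_obj \<kappa> C M \<Longrightarrow> compact_obj \<kappa> C (sh M) \<Longrightarrow> m \<in> Hom C (sh M) Y \<Longrightarrow>
      \<exists>k. \<exists>x \<in> Hom C (sh M) (c k). g k \<cdot> x = m"
    and YS: "\<And>S. tri_subcat C S \<Longrightarrow> coproduct_closed \<kappa> C S \<Longrightarrow> (\<And>k. c k \<in> S) \<Longrightarrow> Y \<in> S"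
    by (rule telescope[of t c, OF t]) (rule that, blast+)
  have YH: "Y \<in> ?H" by (rule YS[OF H coproduct_closed_coproduct_hull cH])
  obtain q' where q': "q' \<in> Hom C Y X" "\<And>k. q' \<cdot> g k = q k" using ext[of q X, OF q qt] by blast
  obtain d v w where d: "dist_triangle C Y X d q' v w" using cone_exists[OF q'(1)] by blast
  note v = dist_Hom(2)[OF d] and w = dist_Hom(3)[OF d] and dO = dist_obj(3)[OF d] and YO = dist_obj(1)[OF d]
  have unsh: "\<exists>M' \<in> L. sh M' = M" if "M \<in> L" for M
    using shift_obj_surj[of M] tri_subcatD(4)[OF L] LO that by blast
  \<comment> \<open>The stages are built for representatives only; conjugation by an isomorphism
    extends surjectivity, and likewise \<open>kill\<close>, to all of \<open>L\<close>.\<close>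
  have surj: "\<exists>i \<in> Hom C M (c 0). q 0 \<cdot> i = f" if M: "M \<in> L" and f: "f \<in> Hom C M X" for M f
  proof -
    obtain M' where M': "M' \<in> Sk" "isomorphic C M M'" using Sk(3)[OF M] by blast
    obtain a b where ab: "a \<in> Hom C M M'" "b \<in> Hom C M' M" "b \<cdot> a = ident C M"
      using isomorphicD[OF M'(2)] by blast
    obtain i where i: "i \<in> Hom C M' (c 0)" "q 0 \<cdot> i = f \<cdot> b" using q0 M'(1) cmp_Hom[OF ab(2) f] by blast
    have "q 0 \<cdot> (i \<cdot> a) = f \<cdot> b \<cdot> a" using cmp_assoc[OF ab(1) i(1) q] i(2) by simp
    also have "\<dots> = f" using cmp_assoc[OF ab(1,2) f] ab(3) cmp_ident_right[OF f] by simp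
    finally show ?thesis using cmp_Hom[OF ab(1) i(1)] by blast
  qed
  have kill: "t k \<cdot> x = zr M (c (Suc k))"
    if M: "M \<in> L" and x: "x \<in> Hom C M (c k)" and 0: "q k \<cdot> x = zr M X" for M x k
  proof -
    obtain M' where M': "M' \<in> Sk" "isomorphic C M M'" using Sk(3)[OF M] by blast
    obtain a b where ab: "a \<in> Hom C M M'" "b \<in> Hom C M' M" "b \<cdot> a = ident C M"
      using isomorphicD[OF M'(2)] by blast
    note xb = cmp_Hom[OF ab(2) x]
    have "q k \<cdot> (x \<cdot> b) = zr M' X" using cmp_assoc[OF ab(2) x q] 0 cmp_zero_left[OF ab(2) X] by simp
    then have "t k \<cdot> (x \<cdot> b) = zr M' (c (Suc k))" using tk M'(1) xb by blast
    moreover have "x = x \<cdot> b \<cdot> a" using cmp_assoc[OF ab(1,2) x] ab(3) cmp_ident_right[OF x] by simp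
    ultimately show ?thesis
      using cmp_assoc[OF ab(1) xb t] cmp_zero_left[OF ab(1) Hom_objD(2)[OF t]] by simp
  qed
  \<comment> \<open>A morphism to the colimit comes from a stage \<open>k\<close>. If it vanishes in
    \<open>X\<close>, the next transition kills it. Every object of \<open>L\<close> is a shift of
    one in \<open>L\<close>, which matches the form of \<open>fac\<close>.\<close>
  have inj: "y = zr M Y" if M: "M \<in> L" and y: "y \<in> Hom C M Y" and 0: "q' \<cdot> y = zr M X" for M y
  proof -
    obtain M' where M': "M' \<in> L" "sh M' = M" using unsh[OF M] by blast
    have "y \<in> Hom C (sh M') Y" using y M'(2) by simp
    then obtain k x where x: "x \<in> Hom C M (c k)" "g k \<cdot> x = y"
      using fac[OF cpt[OF M'(1)]] cpt[OF M] M'(2) by metis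
    have "q k \<cdot> x = zr M X" using cmp_assoc[OF x(1) g q'(1)] q'(2) x(2) 0 by simp
    then have "t k \<cdot> x = zr M (c (Suc k))" by (rule kill[OF M x(1)])
    then have "g k \<cdot> x = zr M Y"
      using cmp_assoc[OF x(1) t g] gt cmp_zero_right[OF g Hom_objD(1)[OF x(1)]] by simp
    then show ?thesis using x(2) by simp
  qed
  have "m = zr M d" if M: "M \<in> L" and m: "m \<in> Hom C M d" for M m
  proof -
    obtain M' where M': "M' \<in> L" "sh M' = M" using unsh[OF M] by blast
    have MO: "M \<in> obj C" "M' \<in> obj C" using LO M M'(1) by blast+
    have "w \<cdot> m \<in> Hom C (sh M') (sh Y)" using cmp_Hom[OF m w] M'(2) by simp
    \<comment> \<open>Injectivity of \<open>D(-, Y) \<rightarrow> D(-, X)\<close> on the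
      desuspension removes the component of \<open>m\<close> in \<open>Y[1]\<close>. So
      \<open>m\<close> lifts to \<open>X\<close>, by surjectivity even to stage 0 over
      \<open>Y\<close>, and then dies because \<open>v \<cdot> q'\<close> is zero.\<close>
    then obtain y where y: "y \<in> Hom C M' Y" "sa y = w \<cdot> m" using shift_arr_surj MO(2) YO by blast
    have "sa (q' \<cdot> y) = zr (sh M') (sh X)"
      using shift_cmp[OF y(1) q'(1)] y(2) cmp_assoc[OF m w shift_Hom[OF q'(1)]] dist_cmp_zero_shift[OF d]
        cmp_zero_left[OF m shift_obj_in[OF X]] M'(2) by simp
    then have "q' \<cdot> y = zr M' X" using shift_zero_iff[OF cmp_Hom[OF y(1) q'(1)]] by simp
    then have "y = zr M' Y" by (rule inj[OF M'(1) y(1)])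
    then have "w \<cdot> m = zr M (sh Y)" using y(2) shift_zero[OF MO(2) YO] M'(2) by simp
    then obtain m' where m': "m' \<in> Hom C M X" "v \<cdot> m' = m" using dist_lift_mid[OF d m] by blast
    obtain i where i: "i \<in> Hom C M (c 0)" "q 0 \<cdot> i = m'" using surj[OF M m'(1)] by blast
    note gi = cmp_Hom[OF i(1) g]
    have "m = v \<cdot> (q' \<cdot> (g 0 \<cdot> i))" using m'(2) i(2) cmp_assoc[OF i(1) g q'(1)] q'(2) by simp
    also have "\<dots> = zr M d"
      using cmp_assoc[OF gi q'(1) v] dist_cmp_zero(1)[OF d] cmp_zero_left[OF gi dO] by simp
    finally show ?thesis .
  qed
  then have "d \<in> right_perp C L (obj C)"
    using Hom_zeroI[OF _ dO] LO dO unfolding right_perp_def by blast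
  moreover have "tri Y X d" unfolding tri_def using d by blast
  ultimately show ?thesis using YH by blast
qed

end

section \<open>Admissible subcategories and decompositions\<close>

lemma bij_betw_ex1: "bij_betw f A B \<Longrightarrow> y \<in> B \<Longrightarrow> \<exists>!x. x \<in> A \<and> f x = y"
  by (auto simp: bij_betw_def inj_on_def)

lemma full_sub_simps [simp]:
  "obj (full_sub C U) = U" "cmp (full_sub C U) = cmp C" "ident (full_sub C U) = ident C"
  "zero_arr (full_sub C U) = zero_arr C" "shift_obj (full_sub C U) = shift_obj C"
  by (simp_all add: full_sub_def)

lemma Hom_full_sub: "Hom (full_sub C U) X Y = (if X \<in> U \<and> Y \<in> U then Hom C X Y else {})"
  by (auto simp: Hom_def full_sub_def)

lemma isomorphic_full_sub:
  "X \<in> U \<Longrightarrow> Y \<in> U \<Longrightarrow> isomorphic (full_sub C U) X Y \<longleftrightarrow> isomorphic C X Y"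
  by (simp add: isomorphic_def iso_arr_def Hom_full_sub)

lemma dist_triangle_full_sub:
  assumes "\<And>X. X \<in> U \<Longrightarrow> shift_obj C X \<in> U"
  shows "dist_triangle (full_sub C U) X Y Z f g h \<longleftrightarrow>
    X \<in> U \<and> Y \<in> U \<and> Z \<in> U \<and> dist_triangle C X Y Z f g h"
proof -
  have "(f, g, h) \<in> dist (full_sub C U) \<longleftrightarrow>
      (f, g, h) \<in> dist C \<and> src C f \<in> U \<and> tgt C f \<in> U \<and> tgt C g \<in> U"
    by (simp add: full_sub_def)
  then show ?thesis
    unfolding dist_triangle_def triangle_def Hom_full_sub full_sub_simps using assms[of X]
    by (auto simp: Hom_def split: if_splits)
qed

section \<open>Notions for a full subcategory, read in the ambient category\<close>

context triangulated_category
begin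

lemma zero_obj_full_sub:
  assumes U: "tri_subcat C U" shows "zero_obj (full_sub C U) Z \<longleftrightarrow> zero_obj C Z"
proof
  assume Z: "zero_obj (full_sub C U) Z"
  then have ZU: "Z \<in> U" and "\<exists>!f. f \<in> Hom (full_sub C U) Z Z" unfolding zero_obj_def by auto
  then have u: "\<exists>!f. f \<in> Hom C Z Z" by (simp add: Hom_full_sub)
  have ZO: "Z \<in> obj C" using ZU tri_subcatD(1)[OF U] by blast
  show "zero_obj C Z" by (rule zero_objI[OF ZO]) (use u ident_Hom[OF ZO] zero_Hom[OF ZO ZO] in blast)
next
  assume Z: "zero_obj C Z"
  have "Z \<in> U" by (rule tri_subcatD(6)[OF U Z])
  then show "zero_obj (full_sub C U) Z"
    using Z tri_subcatD(1)[OF U] unfolding zero_obj_def by (simp add: Hom_full_sub subset_iff)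
qed

text \<open>Restrictions and decompositions of \<open>T\<close> are phrased inside
  \<open>full_sub C U\<close>. Translating them to the ambient category avoids treating
  \<open>full_sub C U\<close> as a triangulated category of its own.\<close>

lemma tri_subcat_full_sub:
  assumes U: "tri_subcat C U" shows "tri_subcat (full_sub C U) S \<longleftrightarrow> tri_subcat C S \<and> S \<subseteq> U"
proof
  assume S: "tri_subcat (full_sub C U) S"
  have SU: "S \<subseteq> U" using S by (simp add: tri_subcat_def)
  note UO = tri_subcatD(1)[OF U]
  have iso: "Y \<in> S" if "X \<in> S" "isomorphic C X Y" for X Y
  proof -
    have XU: "X \<in> U" using SU that(1) by blast
    then have YU: "Y \<in> U" by (rule tri_subcatD(2)[OF U _ that(2)])
    have "isomorphic (full_sub C U) X Y" using that(2) by (simp add: isomorphic_full_sub[OF XU YU])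
    then show ?thesis using S that(1) YU unfolding tri_subcat_def full_sub_simps by metis
  qed
  have "tri_subcat C S"
  proof (rule tri_subcatI)
    show "S \<subseteq> obj C" using SU UO by blast
    show "Z \<in> S" if Z: "zero_obj C Z" for Z
    proof -
      obtain W where W: "W \<in> S" "zero_obj (full_sub C U) W" using S unfolding tri_subcat_def by blast
      have "zero_obj C W" using W(2) unfolding zero_obj_full_sub[OF U] .
      then show ?thesis by (rule iso[OF W(1) zero_obj_isomorphic[OF _ Z]])
    qed
    show "Y \<in> S" if "X \<in> S" "isomorphic C X Y" for X Y by (rule iso[OF that])
    have sh: "\<forall>X\<in>U. (sh X \<in> S) = (X \<in> S)" using S unfolding tri_subcat_def full_sub_simps by blast
    show "sh X \<in> S" if "X \<in> S" for X using sh SU that by blast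
    show "X \<in> S" if "X \<in> obj C" "sh X \<in> S" for X
      using sh SU that tri_subcatD(4)[OF U that(1)] by blast
    show "Z \<in> S" if XY: "X \<in> S" "Y \<in> S" and t: "tri X Y Z" for X Y Z
    proof -
      have ZU: "Z \<in> U" by (rule tri_subcatD(5)[OF U _ _ t]) (use SU XY in blast)+
      obtain f g h where "dist_triangle C X Y Z f g h" using t unfolding tri_def by blast
      then have "dist_triangle (full_sub C U) X Y Z f g h"
        using dist_triangle_full_sub[OF tri_subcatD(3)[OF U]] SU XY ZU by blast
      moreover have "\<forall>X\<in>S. \<forall>Y\<in>S. \<forall>Z f g h. dist_triangle (full_sub C U) X Y Z f g h \<longrightarrow> Z \<in> S"
        using S unfolding tri_subcat_def by blast
      ultimately show ?thesis using XY by blast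
    qed
  qed
  then show "tri_subcat C S \<and> S \<subseteq> U" using SU by blast
next
  assume S: "tri_subcat C S \<and> S \<subseteq> U"
  then have SC: "tri_subcat C S" and SU: "S \<subseteq> U" by blast+
  note UO = tri_subcatD(1)[OF U]
  obtain Z where Z: "zero_obj C Z" using zero_obj_exists by blast
  have 1: "\<exists>Z\<in>S. zero_obj (full_sub C U) Z"
    using Z tri_subcatD(6)[OF SC Z] zero_obj_full_sub[OF U] by blast
  have 2: "\<forall>X\<in>S. \<forall>Y\<in>U. isomorphic (full_sub C U) X Y \<longrightarrow> Y \<in> S"
    using isomorphic_full_sub tri_subcatD(2)[OF SC] SU by (metis subsetD)
  have 3: "\<forall>X\<in>U. (sh X \<in> S) = (X \<in> S)" using tri_subcatD(3,4)[OF SC] UO by blast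
  have 4: "\<forall>X\<in>S. \<forall>Y\<in>S. \<forall>Z f g h. dist_triangle (full_sub C U) X Y Z f g h \<longrightarrow> Z \<in> S"
  proof (intro ballI allI impI)
    fix X Y Z f g h assume XY: "X \<in> S" "Y \<in> S" and "dist_triangle (full_sub C U) X Y Z f g h"
    then have "tri X Y Z"
      using dist_triangle_full_sub[OF tri_subcatD(3)[OF U]] unfolding tri_def by blast
    then show "Z \<in> S" by (rule tri_subcatD(5)[OF SC XY])
  qed
  show "tri_subcat (full_sub C U) S" unfolding tri_subcat_def full_sub_simps by (intro conjI SU 1 2 3 4)
qed

lemma tri_hull_full_sub:
  assumes U: "tri_subcat C U" and G: "G \<subseteq> U" shows "tri_hull (full_sub C U) G = tri_hull C G"
proof
  have "tri_subcat C (tri_hull C G)" using tri_subcat_tri_hull G tri_subcatD(1)[OF U] by blast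
  then have "tri_subcat (full_sub C U) (tri_hull C G)"
    using tri_subcat_full_sub[OF U] tri_hull_least[OF U G] by blast
  then show "tri_hull (full_sub C U) G \<subseteq> tri_hull C G"
    unfolding tri_hull_def[of "full_sub C U"] using tri_hull_superset[of G] by blast
  show "tri_hull C G \<subseteq> tri_hull (full_sub C U) G"
    unfolding tri_hull_def[of "full_sub C U"] using tri_hull_least tri_subcat_full_sub[OF U] by blast
qed

lemma hull_below_cong: "(\<And>i. i < k \<Longrightarrow> A i = B i) \<Longrightarrow> hull_below A k = hull_below B k"
  unfolding hull_below_def by (rule arg_cong[of _ _ "tri_hull C"]) auto

lemma tri_le_eq_hull_below: "k \<le> Suc n \<Longrightarrow> tri_le C n B (int k - 1) = hull_below B k"
proof -
  assume k: "k \<le> Suc n"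
  have "{i. i \<le> n \<and> int i \<le> int k - 1} = {..<k}" using k by auto
  then show ?thesis by (simp add: tri_le_def hull_below_def)
qed

lemma tri_le_full_sub:
  assumes "tri_subcat C U" "\<And>i. i \<le> n \<Longrightarrow> B i \<subseteq> U"
  shows "tri_le (full_sub C U) n B j = tri_le C n B j"
  unfolding tri_le_def by (rule tri_hull_full_sub[OF assms(1)]) (use assms(2) in blast)

lemma semi_orth_dec_iff:
  "semi_orth_dec C n B \<longleftrightarrow> (\<forall>i \<le> n. tri_subcat C (B i)) \<and>
    (\<forall>i j. i < j \<and> j \<le> n \<longrightarrow> orth (B j) (B i)) \<and> hull_below B (Suc n) = obj C"
  unfolding semi_orth_dec_def orth_def using tri_le_eq_hull_below[of "Suc n" n B] by simp

lemma semi_orth_dec_full_sub_iff: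
  assumes U: "tri_subcat C U"
  shows "semi_orth_dec (full_sub C U) n B \<longleftrightarrow> (\<forall>i \<le> n. tri_subcat C (B i) \<and> B i \<subseteq> U) \<and>
    (\<forall>i j. i < j \<and> j \<le> n \<longrightarrow> orth (B j) (B i)) \<and> hull_below B (Suc n) = U"
proof (cases "\<forall>i \<le> n. B i \<subseteq> U")
  case True
  then have "tri_le (full_sub C U) n B (int n) = hull_below B (Suc n)"
    using tri_le_full_sub[OF U, of n B] tri_le_eq_hull_below[of "Suc n" n B] by simp
  moreover have "(\<forall>X \<in> B j. \<forall>Y \<in> B i. Hom (full_sub C U) X Y = {zr X Y}) \<longleftrightarrow> orth (B j) (B i)"
    if "i < j \<and> j \<le> n" for i j
  proof -
    have "B i \<subseteq> U" "B j \<subseteq> U" using True that by simp_all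
    then show ?thesis unfolding orth_def by (auto simp: Hom_full_sub subset_iff)
  qed
  ultimately show ?thesis
    unfolding semi_orth_dec_def by (simp add: tri_subcat_full_sub[OF U] cong: imp_cong)
next
  case False
  then show ?thesis unfolding semi_orth_dec_def by (auto simp: tri_subcat_full_sub[OF U])
qed

text \<open>The two vanishing groups are the neighbours of this map in the long exact sequence: the
  first gives surjectivity, the second injectivity.\<close>

lemma bij_betw_precompose:
  assumes d: "dist_triangle C X Y Z f g h" and W: "W \<in> obj C"
    and 0: "Hom C X W = {zr X W}" "Hom C (sh X) W = {zr (sh X) W}"
  shows "bij_betw (\<lambda>w. w \<cdot> g) (Hom C Z W) (Hom C Y W)"
  unfolding bij_betw_def inj_on_def
proof (intro conjI ballI impI equalityI subsetI)
  note H = dist_Hom[OF d] and O = dist_obj[OF d]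
  fix w w' assume w: "w \<in> Hom C Z W" "w' \<in> Hom C Z W" and eq: "w \<cdot> g = w' \<cdot> g"
  have k: "w \<^bold>+ ng w' \<in> Hom C Z W" by (rule add_Hom[OF w(1) neg_Hom[OF w(2)]])
  have "(w \<^bold>+ ng w') \<cdot> g = zr Y W"
    using cmp_add_left[OF H(2) w(1) neg_Hom[OF w(2)]] cmp_neg_left[OF H(2) w(2)] eq add_neg[OF cmp_Hom[OF H(2) w(2)]]
    by simp
  then obtain v where v: "v \<in> Hom C (sh X) W" "v \<cdot> h = w \<^bold>+ ng w'" using dist_extend_shift[OF d k] by blast
  have "v = zr (sh X) W" using v(1) 0(2) by blast
  then have "w \<^bold>+ ng w' = zr Z W" using v(2) cmp_zero_left[OF H(3) W] by simp
  then show "w = w'" by (rule diff_zero_eq[OF w])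
next
  fix y assume y: "y \<in> Hom C Y W"
  have "y \<cdot> f = zr X W" using cmp_Hom[OF dist_Hom(1)[OF d] y] 0(1) by blast
  then show "y \<in> (\<lambda>w. w \<cdot> g) ` Hom C Z W" using dist_extend[OF d y] by blast
next
  fix y assume "y \<in> (\<lambda>w. w \<cdot> g) ` Hom C Z W"
  then show "y \<in> Hom C Y W" using cmp_Hom[OF dist_Hom(2)[OF d]] by blast
qed

text \<open>The second vanishing group stands for \<open>Hom(W, Z[-1])\<close>, written with the
  shift on the other side; accordingly, injectivity is checked after one shift.\<close>

lemma bij_betw_postcompose:
  assumes d: "dist_triangle C X Y Z f g h" and W: "W \<in> obj C"
    and 0: "Hom C W Z = {zr W Z}" "Hom C (sh W) Z = {zr (sh W) Z}"
  shows "bij_betw (\<lambda>w. f \<cdot> w) (Hom C W X) (Hom C W Y)"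
  unfolding bij_betw_def inj_on_def
proof (intro conjI ballI impI equalityI subsetI)
  note H = dist_Hom[OF d] and O = dist_obj[OF d]
  fix w w' assume w: "w \<in> Hom C W X" "w' \<in> Hom C W X" and eq: "f \<cdot> w = f \<cdot> w'"
  have k: "w \<^bold>+ ng w' \<in> Hom C W X" by (rule add_Hom[OF w(1) neg_Hom[OF w(2)]])
  have "f \<cdot> (w \<^bold>+ ng w') = zr W Y"
    using cmp_add_right[OF w(1) neg_Hom[OF w(2)] H(1)] cmp_neg_right[OF w(2) H(1)] eq add_neg[OF cmp_Hom[OF w(2) H(1)]]
    by simp
  then have "sa f \<cdot> sa (w \<^bold>+ ng w') = zr (sh W) (sh Y)" using shift_cmp[OF k H(1)] shift_zero[OF W O(2)]
      by simp
  then obtain v where v: "v \<in> Hom C (sh W) Z" "h \<cdot> v = sa (w \<^bold>+ ng w')"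
    using dist_lift_shift[OF d shift_Hom[OF k]] by blast
  have "v = zr (sh W) Z" using v(1) 0(2) by blast
  then have "sa (w \<^bold>+ ng w') = zr (sh W) (sh X)" using v(2) cmp_zero_right[OF H(3) shift_obj_in[OF W]] by simp
  then have "w \<^bold>+ ng w' = zr W X" using shift_zero_iff[OF k] by simp
  then show "w = w'" by (rule diff_zero_eq[OF w])
next
  fix y assume y: "y \<in> Hom C W Y"
  have "g \<cdot> y = zr W Z" using cmp_Hom[OF y dist_Hom(2)[OF d]] 0(1) by blast
  then show "y \<in> (\<lambda>w. f \<cdot> w) ` Hom C W X" using dist_lift[OF d y] by blast
next
  fix y assume "y \<in> (\<lambda>w. f \<cdot> w) ` Hom C W X"
  then show "y \<in> Hom C W Y" using cmp_Hom[OF _ dist_Hom(1)[OF d]] by blast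
qed

text \<open>By the orthogonality of \<open>c\<close> and \<open>c[1]\<close>, the map
  \<open>X -> d\<close> is universal among maps from \<open>X\<close> to \<open>S\<close>. Universal
  arrows chosen for all \<open>X\<close> form a left adjoint, with functoriality and naturality from
  uniqueness.\<close>

lemma left_admissibleI:
  assumes S: "tri_subcat C S"
    and ex: "\<And>X. X \<in> obj C \<Longrightarrow> \<exists>c. \<exists>d \<in> S. tri c X d \<and> orth {c, sh c} S"
  shows "left_admissible C S"
proof -
  note SO = tri_subcatD(1)[OF S]
  have univ: "\<exists>L \<eta>. L \<in> S \<and> \<eta> \<in> Hom C X L \<and> (\<forall>Y \<in> S. \<forall>f \<in> Hom C X Y. \<exists>!g. g \<in> Hom C L Y \<and> g \<cdot> \<eta> = f)"
    if X: "X \<in> obj C" for X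
  proof -
    obtain c L where L: "L \<in> S" "tri c X L" and o: "orth {c, sh c} S" using ex[OF X] by blast
    obtain a \<eta> b where d: "dist_triangle C c X L a \<eta> b" using L(2) unfolding tri_def by blast
    note H = dist_Hom[OF d]
    have "\<exists>!g. g \<in> Hom C L Y \<and> g \<cdot> \<eta> = f" if Y: "Y \<in> S" and f: "f \<in> Hom C X Y" for Y f
    proof -
      have YO: "Y \<in> obj C" using SO Y by blast
      have "Hom C c Y = {zr c Y}" "Hom C (sh c) Y = {zr (sh c) Y}" using o Y unfolding orth_def by blast+
      then have "bij_betw (\<lambda>g. g \<cdot> \<eta>) (Hom C L Y) (Hom C X Y)" by (rule bij_betw_precompose[OF d YO])
      then show ?thesis by (rule bij_betw_ex1[OF _ f])
    qed
    then show ?thesis using L(1) H(2) by blast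
  qed
  then have ch: "\<forall>X \<in> obj C. \<exists>L. \<exists>\<eta>. L \<in> S \<and> \<eta> \<in> Hom C X L \<and>
      (\<forall>Y \<in> S. \<forall>f \<in> Hom C X Y. \<exists>!g. g \<in> Hom C L Y \<and> g \<cdot> \<eta> = f)" by blast
  obtain L where ch': "\<forall>X \<in> obj C. \<exists>\<eta>. L X \<in> S \<and> \<eta> \<in> Hom C X (L X) \<and>
      (\<forall>Y \<in> S. \<forall>f \<in> Hom C X Y. \<exists>!g. g \<in> Hom C (L X) Y \<and> g \<cdot> \<eta> = f)"
    using bchoice[OF ch] by (elim exE) (rule that)
  obtain \<eta> where L\<eta>: "\<forall>X \<in> obj C. L X \<in> S \<and> \<eta> X \<in> Hom C X (L X) \<and>
      (\<forall>Y \<in> S. \<forall>f \<in> Hom C X Y. \<exists>!g. g \<in> Hom C (L X) Y \<and> g \<cdot> \<eta> X = f)"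
    using bchoice[OF ch'] by (elim exE) (rule that)
  have L: "L X \<in> S" and \<eta>: "\<eta> X \<in> Hom C X (L X)" if "X \<in> obj C" for X using L\<eta> that by simp_all
  have fac: "\<exists>!g. g \<in> Hom C (L X) Y \<and> g \<cdot> \<eta> X = f" if "Y \<in> S" "f \<in> Hom C X Y" for X Y f
    using L\<eta> Hom_objD(1)[OF that(2)] that by blast
  have uniq: "g = g'" if "Y \<in> S" "X \<in> obj C" "g \<in> Hom C (L X) Y" "g' \<in> Hom C (L X) Y" "g \<cdot> \<eta> X = g' \<cdot> \<eta> X"
      for X Y g g'
    using fac[OF that(1) cmp_Hom[OF \<eta>[OF that(2)] that(4)]] that(3-5) by blast
  define Lm where "Lm f = (THE g. g \<in> Hom C (L (src C f)) (L (tgt C f)) \<and> g \<cdot> \<eta> (src C f) = \<eta> (tgt C f) \<cdot> f)"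
      for f
  have Lm: "Lm f \<in> Hom C (L X) (L Y)" "Lm f \<cdot> \<eta> X = \<eta> Y \<cdot> f" if f: "f \<in> Hom C X Y" for f X Y
  proof -
    note \<eta>f = cmp_Hom[OF f \<eta>[OF Hom_objD(2)[OF f]]]
    have "Lm f \<in> Hom C (L X) (L Y) \<and> Lm f \<cdot> \<eta> X = \<eta> Y \<cdot> f"
      unfolding Lm_def Hom_src_tgt[OF f] by (rule theI'[OF fac[OF L[OF Hom_objD(2)[OF f]] \<eta>f]])
    then show "Lm f \<in> Hom C (L X) (L Y)" "Lm f \<cdot> \<eta> X = \<eta> Y \<cdot> f" by blast+
  qed
  have LO: "L X \<in> obj C" if "X \<in> obj C" for X using L[OF that] SO by blast
  have 1: "is_functor C (full_sub C S) L Lm"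
    unfolding is_functor_def full_sub_simps
  proof (intro conjI ballI allI)
    fix X assume X: "X \<in> obj C"
    show "L X \<in> S" by (rule L[OF X])
    show "Lm (ident C X) = ident C (L X)"
    proof (rule uniq[OF L[OF X] X Lm(1)[OF ident_Hom[OF X]] ident_Hom[OF LO[OF X]]])
      show "Lm (ident C X) \<cdot> \<eta> X = ident C (L X) \<cdot> \<eta> X"
        using Lm(2)[OF ident_Hom[OF X]] cmp_ident_left[OF \<eta>[OF X]] cmp_ident_right[OF \<eta>[OF X]] by simp
    qed
  next
    fix X Y f assume f: "f \<in> Hom C X Y"
    show "Lm f \<in> Hom (full_sub C S) (L X) (L Y)"
      using Lm(1)[OF f] L Hom_objD[OF f] by (simp add: Hom_full_sub)
  next
    fix X Y Z f g assume f: "f \<in> Hom C X Y" and g: "g \<in> Hom C Y Z"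
    note X = Hom_objD(1)[OF f] and Y = Hom_objD(2)[OF f] and Z = Hom_objD(2)[OF g]
    show "Lm (g \<cdot> f) = Lm g \<cdot> Lm f"
    proof (rule uniq[OF L[OF Z] X Lm(1)[OF cmp_Hom[OF f g]] cmp_Hom[OF Lm(1)[OF f] Lm(1)[OF g]]])
      have "Lm g \<cdot> Lm f \<cdot> \<eta> X = \<eta> Z \<cdot> (g \<cdot> f)"
        using cmp_assoc[OF \<eta>[OF X] Lm(1)[OF f] Lm(1)[OF g]] Lm(2)[OF f] cmp_assoc[OF f \<eta>[OF Y] Lm(1)[OF g]]
          Lm(2)[OF g] cmp_assoc[OF f g \<eta>[OF Z]] by simp
      then show "Lm (g \<cdot> f) \<cdot> \<eta> X = Lm g \<cdot> Lm f \<cdot> \<eta> X" using Lm(2)[OF cmp_Hom[OF f g]] by simp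
    qed
  qed
  have 2: "is_functor (full_sub C S) C (\<lambda>X. X) (\<lambda>f. f)"
    unfolding is_functor_def using SO by (auto simp: Hom_full_sub split: if_splits)
  have 3: "bij_betw (\<lambda>g. g \<cdot> \<eta> X) (Hom (full_sub C S) (L X) Y) (Hom C X Y)" if X: "X \<in> obj C" and Y: "Y \<in> S"
      for X Y
  proof -
    have HH: "Hom (full_sub C S) (L X) Y = Hom C (L X) Y" using L[OF X] Y by (simp add: Hom_full_sub)
    show ?thesis
      unfolding HH bij_betw_def inj_on_def
    proof (intro conjI ballI impI equalityI subsetI)
      fix f assume "f \<in> Hom C X Y"
      then show "f \<in> (\<lambda>g. g \<cdot> \<eta> X) ` Hom C (L X) Y" using fac[OF Y] by blast
    next
      fix f assume "f \<in> (\<lambda>g. g \<cdot> \<eta> X) ` Hom C (L X) Y"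
      then show "f \<in> Hom C X Y" using cmp_Hom[OF \<eta>[OF X]] by blast
    qed (rule uniq[OF Y X])
  qed
  have 4: "b \<cdot> (f \<cdot> Lm a) \<cdot> \<eta> X' = b \<cdot> (f \<cdot> \<eta> X \<cdot> a)"
    if a: "a \<in> Hom C X' X" and f: "f \<in> Hom (full_sub C S) (L X) Y" and b: "b \<in> Hom (full_sub C S) Y Y'"
    for X' X Y Y' a f b
  proof -
    have f: "f \<in> Hom C (L X) Y" and b: "b \<in> Hom C Y Y'" using f b
        by (auto simp: Hom_full_sub split: if_splits)
    note X' = Hom_objD(1)[OF a] and X = Hom_objD(2)[OF a]
    have "b \<cdot> (f \<cdot> Lm a) \<cdot> \<eta> X' = b \<cdot> (f \<cdot> Lm a \<cdot> \<eta> X')"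
      using cmp_assoc[OF \<eta>[OF X'] cmp_Hom[OF Lm(1)[OF a] f] b] by simp
    also have "f \<cdot> Lm a \<cdot> \<eta> X' = f \<cdot> \<eta> X \<cdot> a"
      using cmp_assoc[OF \<eta>[OF X'] Lm(1)[OF a] f] Lm(2)[OF a] cmp_assoc[OF a \<eta>[OF X] f] by simp
    finally show ?thesis .
  qed
  have "adjoint_functors C (full_sub C S) L Lm (\<lambda>X. X) (\<lambda>f. f)"
    unfolding adjoint_functors_def full_sub_simps
    by (intro conjI 1 2 exI[of _ "\<lambda>X Y g. g \<cdot> \<eta> X"] allI ballI 3 4)
  then show ?thesis unfolding left_admissible_def using S by blast
qed

text \<open>Dually, \<open>c -> X\<close> is couniversal. As \<open>S\<close> is closed under the
  shift, \<open>orth S {d}\<close> supplies both vanishing groups for every source in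
  \<open>S\<close>.\<close>

lemma right_admissibleI:
  assumes S: "tri_subcat C S"
    and ex: "\<And>X. X \<in> obj C \<Longrightarrow> \<exists>c \<in> S. \<exists>d. tri c X d \<and> orth S {d}"
  shows "right_admissible C S"
proof -
  note SO = tri_subcatD(1)[OF S]
  have univ: "\<exists>R \<epsilon>. R \<in> S \<and> \<epsilon> \<in> Hom C R X \<and> (\<forall>Y \<in> S. \<forall>f \<in> Hom C Y X. \<exists>!g. g \<in> Hom C Y R \<and> \<epsilon> \<cdot> g = f)"
    if X: "X \<in> obj C" for X
  proof -
    obtain R d where R: "R \<in> S" "tri R X d" and o: "orth S {d}" using ex[OF X] by blast
    obtain \<epsilon> b e where d: "dist_triangle C R X d \<epsilon> b e" using R(2) unfolding tri_def by blast
    note H = dist_Hom[OF d]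
    have "\<exists>!g. g \<in> Hom C Y R \<and> \<epsilon> \<cdot> g = f" if Y: "Y \<in> S" and f: "f \<in> Hom C Y X" for Y f
    proof -
      have YO: "Y \<in> obj C" using SO Y by blast
      have "Hom C Y d = {zr Y d}" "Hom C (sh Y) d = {zr (sh Y) d}"
        using o Y tri_subcatD(3)[OF S Y] unfolding orth_def by blast+
      then have "bij_betw (\<lambda>g. \<epsilon> \<cdot> g) (Hom C Y R) (Hom C Y X)" by (rule bij_betw_postcompose[OF d YO])
      then show ?thesis by (rule bij_betw_ex1[OF _ f])
    qed
    then show ?thesis using R(1) H(1) by blast
  qed
  then have ch: "\<forall>X \<in> obj C. \<exists>R. \<exists>\<epsilon>. R \<in> S \<and> \<epsilon> \<in> Hom C R X \<and>
      (\<forall>Y \<in> S. \<forall>f \<in> Hom C Y X. \<exists>!g. g \<in> Hom C Y R \<and> \<epsilon> \<cdot> g = f)" by blast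
  obtain R where ch': "\<forall>X \<in> obj C. \<exists>\<epsilon>. R X \<in> S \<and> \<epsilon> \<in> Hom C (R X) X \<and>
      (\<forall>Y \<in> S. \<forall>f \<in> Hom C Y X. \<exists>!g. g \<in> Hom C Y (R X) \<and> \<epsilon> \<cdot> g = f)"
    using bchoice[OF ch] by (elim exE) (rule that)
  obtain \<epsilon> where R\<epsilon>: "\<forall>X \<in> obj C. R X \<in> S \<and> \<epsilon> X \<in> Hom C (R X) X \<and>
      (\<forall>Y \<in> S. \<forall>f \<in> Hom C Y X. \<exists>!g. g \<in> Hom C Y (R X) \<and> \<epsilon> X \<cdot> g = f)"
    using bchoice[OF ch'] by (elim exE) (rule that)
  have R: "R X \<in> S" and \<epsilon>: "\<epsilon> X \<in> Hom C (R X) X" if "X \<in> obj C" for X using R\<epsilon> that by simp_all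
  have fac: "\<exists>!g. g \<in> Hom C Y (R X) \<and> \<epsilon> X \<cdot> g = f" if "Y \<in> S" "f \<in> Hom C Y X" for X Y f
    using R\<epsilon> Hom_objD(2)[OF that(2)] that by blast
  have uniq: "g = g'" if "Y \<in> S" "X \<in> obj C" "g \<in> Hom C Y (R X)" "g' \<in> Hom C Y (R X)" "\<epsilon> X \<cdot> g = \<epsilon> X \<cdot> g'"
      for X Y g g'
    using fac[OF that(1) cmp_Hom[OF that(4) \<epsilon>[OF that(2)]]] that(3-5) by blast
  \<comment> \<open>The adjunction bijection must lead from \<open>Hom(Y, X)\<close> to
    \<open>Hom(Y, R X)\<close>, so it is the inverse of composition with the counit. On the left
    side composition with the unit itself has the right direction.\<close>
  define \<phi> where "\<phi> X f = (THE g. g \<in> Hom C (src C f) (R X) \<and> \<epsilon> X \<cdot> g = f)" for X f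
  have \<phi>: "\<phi> X f \<in> Hom C Y (R X)" "\<epsilon> X \<cdot> \<phi> X f = f" if Y: "Y \<in> S" and f: "f \<in> Hom C Y X" for X f Y
  proof -
    have "\<phi> X f \<in> Hom C Y (R X) \<and> \<epsilon> X \<cdot> \<phi> X f = f"
      unfolding \<phi>_def Hom_src_tgt[OF f] by (rule theI'[OF fac[OF Y f]])
    then show "\<phi> X f \<in> Hom C Y (R X)" "\<epsilon> X \<cdot> \<phi> X f = f" by blast+
  qed
  define Rm where "Rm f = \<phi> (tgt C f) (f \<cdot> \<epsilon> (src C f))" for f
  have Rm: "Rm f \<in> Hom C (R X) (R Y)" "\<epsilon> Y \<cdot> Rm f = f \<cdot> \<epsilon> X" if f: "f \<in> Hom C X Y" for f X Y
    unfolding Rm_def Hom_src_tgt[OF f]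
    using \<phi>[OF R[OF Hom_objD(1)[OF f]] cmp_Hom[OF \<epsilon>[OF Hom_objD(1)[OF f]] f]] by blast+
  have RO: "R X \<in> obj C" if "X \<in> obj C" for X using R[OF that] SO by blast
  have 1: "is_functor C (full_sub C S) R Rm"
    unfolding is_functor_def full_sub_simps
  proof (intro conjI ballI allI)
    fix X assume X: "X \<in> obj C"
    show "R X \<in> S" by (rule R[OF X])
    show "Rm (ident C X) = ident C (R X)"
    proof (rule uniq[OF R[OF X] X Rm(1)[OF ident_Hom[OF X]] ident_Hom[OF RO[OF X]]])
      show "\<epsilon> X \<cdot> Rm (ident C X) = \<epsilon> X \<cdot> ident C (R X)"
        using Rm(2)[OF ident_Hom[OF X]] cmp_ident_left[OF \<epsilon>[OF X]] cmp_ident_right[OF \<epsilon>[OF X]] by simp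
    qed
  next
    fix X Y f assume f: "f \<in> Hom C X Y"
    show "Rm f \<in> Hom (full_sub C S) (R X) (R Y)"
      using Rm(1)[OF f] R Hom_objD[OF f] by (simp add: Hom_full_sub)
  next
    fix X Y Z f g assume f: "f \<in> Hom C X Y" and g: "g \<in> Hom C Y Z"
    note X = Hom_objD(1)[OF f] and Y = Hom_objD(2)[OF f] and Z = Hom_objD(2)[OF g]
    show "Rm (g \<cdot> f) = Rm g \<cdot> Rm f"
    proof (rule uniq[OF R[OF X] Z Rm(1)[OF cmp_Hom[OF f g]] cmp_Hom[OF Rm(1)[OF f] Rm(1)[OF g]]])
      have "\<epsilon> Z \<cdot> (Rm g \<cdot> Rm f) = g \<cdot> f \<cdot> \<epsilon> X"
        using cmp_assoc[OF Rm(1)[OF f] Rm(1)[OF g] \<epsilon>[OF Z]] Rm(2)[OF g] cmp_assoc[OF Rm(1)[OF f] \<epsilon>[OF Y] g]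
          Rm(2)[OF f] cmp_assoc[OF \<epsilon>[OF X] f g] by simp
      then show "\<epsilon> Z \<cdot> Rm (g \<cdot> f) = \<epsilon> Z \<cdot> (Rm g \<cdot> Rm f)" using Rm(2)[OF cmp_Hom[OF f g]] by simp
    qed
  qed
  have 2: "is_functor (full_sub C S) C (\<lambda>X. X) (\<lambda>f. f)"
    unfolding is_functor_def using SO by (auto simp: Hom_full_sub split: if_splits)
  have 3: "bij_betw (\<phi> X) (Hom C Y X) (Hom (full_sub C S) Y (R X))" if Y: "Y \<in> S" and X: "X \<in> obj C" for X Y
  proof -
    have HH: "Hom (full_sub C S) Y (R X) = Hom C Y (R X)" using R[OF X] Y by (simp add: Hom_full_sub)
    show ?thesis
      unfolding HH bij_betw_def inj_on_def
    proof (intro conjI ballI impI equalityI subsetI)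
      fix f g assume "f \<in> Hom C Y X" "g \<in> Hom C Y X" "\<phi> X f = \<phi> X g"
      then show "f = g" using \<phi>(2)[OF Y] by metis
    next
      fix g assume g: "g \<in> Hom C Y (R X)"
      note \<epsilon>g = cmp_Hom[OF g \<epsilon>[OF X]]
      have "g = \<phi> X (\<epsilon> X \<cdot> g)" by (rule uniq[OF Y X g \<phi>(1)[OF Y \<epsilon>g]]) (simp add: \<phi>(2)[OF Y \<epsilon>g])
      then show "g \<in> \<phi> X ` Hom C Y X" using \<epsilon>g by blast
    next
      fix g assume "g \<in> \<phi> X ` Hom C Y X"
      then show "g \<in> Hom C Y (R X)" using \<phi>(1)[OF Y] by blast
    qed
  qed
  have 4: "\<phi> Y' (b \<cdot> (f \<cdot> a)) = Rm b \<cdot> (\<phi> Y f \<cdot> a)"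
    if a: "a \<in> Hom (full_sub C S) X' X" and f: "f \<in> Hom C X Y" and b: "b \<in> Hom C Y Y'" for X' X Y Y' a f b
  proof -
    have X': "X' \<in> S" and X: "X \<in> S" and a: "a \<in> Hom C X' X" using a
        by (auto simp: Hom_full_sub split: if_splits)
    note Y = Hom_objD(1)[OF b] and Y' = Hom_objD(2)[OF b]
    note bfa = cmp_Hom[OF cmp_Hom[OF a f] b] and \<phi>a = cmp_Hom[OF a \<phi>(1)[OF X f]]
    show ?thesis
    proof (rule uniq[OF X' Y' \<phi>(1)[OF X' bfa] cmp_Hom[OF \<phi>a Rm(1)[OF b]]])
      have "\<epsilon> Y' \<cdot> (Rm b \<cdot> (\<phi> Y f \<cdot> a)) = b \<cdot> (\<epsilon> Y \<cdot> (\<phi> Y f \<cdot> a))"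
        using cmp_assoc[OF \<phi>a Rm(1)[OF b] \<epsilon>[OF Y']] Rm(2)[OF b] cmp_assoc[OF \<phi>a \<epsilon>[OF Y] b] by simp
      also have "\<epsilon> Y \<cdot> (\<phi> Y f \<cdot> a) = f \<cdot> a"
        using cmp_assoc[OF a \<phi>(1)[OF X f] \<epsilon>[OF Y]] \<phi>(2)[OF X f] by simp
      finally show "\<epsilon> Y' \<cdot> \<phi> Y' (b \<cdot> (f \<cdot> a)) = \<epsilon> Y' \<cdot> (Rm b \<cdot> (\<phi> Y f \<cdot> a))" using \<phi>(2)[OF X' bfa] by simp
    qed
  qed
  have "adjoint_functors (full_sub C S) C (\<lambda>X. X) (\<lambda>f. f) R Rm"
    unfolding adjoint_functors_def full_sub_simps
    by (intro conjI 1 2 exI[of _ "\<lambda>Y X f. \<phi> X f"] allI ballI 3 4)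
  then show ?thesis unfolding right_admissible_def using S by blast
qed

end

section \<open>Semi-orthogonal decompositions of compact generators\<close>

locale compact_semi_orth = triangulated_category_coproducts C \<kappa>
  for C :: "('o, 'm, 'z) tri_cat_data_scheme" and \<kappa> :: "'u rel" +
  fixes T :: "'o set" and n :: nat and S :: "nat \<Rightarrow> 'o set"
  assumes T: "tri_subcat C T" and locally_small: "locally_small_from \<kappa> C T"
    and compact: "\<And>M. M \<in> T \<Longrightarrow> compact_obj \<kappa> C M" and generates: "coproduct_hull \<kappa> C T = obj C"
    and dec: "semi_orth_dec (full_sub C T) n S"
begin

lemma piece: "i \<le> n \<Longrightarrow> tri_subcat C (S i)" "i \<le> n \<Longrightarrow> S i \<subseteq> T"
  and piece_orth: "i < j \<Longrightarrow> j \<le> n \<Longrightarrow> orth (S j) (S i)"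
  and hull_pieces: "hull_below S (Suc n) = T"
  using dec semi_orth_dec_full_sub_iff[OF T] by simp_all

lemma T_obj: "T \<subseteq> obj C"
  by (rule tri_subcatD(1)[OF T])

lemma hull_below_piece: "k \<le> Suc n \<Longrightarrow> hull_below S k \<subseteq> T"
  using hull_below_mono[of k "Suc n" S] hull_pieces by simp

lemma tri_subcat_hull_below_piece: "k \<le> Suc n \<Longrightarrow> tri_subcat C (hull_below S k)"
  by (rule tri_subcat_hull_below) (use piece(1) tri_subcatD(1) less_Suc_eq_le in \<open>metis order_less_le_trans\<close>)

text \<open>The order of the two enlargements matters: the target is closed under coproducts while
  the source still consists of compact objects, and only then the source is enlarged.\<close>

lemma orth_coproduct_hulls:
  assumes A: "tri_subcat C A" "A \<subseteq> T" and B: "tri_subcat C B" and o: "orth A B"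
  shows "orth (coproduct_hull \<kappa> C A) (coproduct_hull \<kappa> C B)"
proof (rule orth_coproduct_hull_left)
  show "orth A (coproduct_hull \<kappa> C B)"
    by (rule orth_coproduct_hull_right[OF o A(1) tri_subcatD(1)[OF B] compact]) (use A(2) in blast)
  show "tri_subcat C (coproduct_hull \<kappa> C B)" by (rule tri_subcat_coproduct_hull[OF tri_subcatD(1)[OF B]])
  show "A \<subseteq> obj C" by (rule tri_subcatD(1)[OF A(1)])
qed

text \<open>The hull of the enlarged pieces is closed under coproducts and contains
  \<open>T\<close>, hence is everything.\<close>

lemma semi_orth_dec_coproduct_hulls: "semi_orth_dec C n (\<lambda>i. coproduct_hull \<kappa> C (S i))"
  unfolding semi_orth_dec_iff
proof (intro conjI allI impI)
  let ?S = "\<lambda>i. coproduct_hull \<kappa> C (S i)"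
  show t: "tri_subcat C (?S i)" if "i \<le> n" for i
    by (rule tri_subcat_coproduct_hull[OF tri_subcatD(1)[OF piece(1)[OF that]]])
  show o: "orth (?S j) (?S i)" if "i < j \<and> j \<le> n" for i j
    by (rule orth_coproduct_hulls) (use that piece piece_orth in auto)
  have tH: "tri_subcat C (hull_below ?S (Suc n))"
    by (rule tri_subcat_hull_below) (use tri_subcatD(1)[OF t] in simp)
  have cH: "coproduct_closed \<kappa> C (hull_below ?S (Suc n))"
    by (rule coproduct_closed_hull_below) (use t o coproduct_closed_coproduct_hull in simp_all)
  have "T \<subseteq> hull_below ?S (Suc n)"
    unfolding hull_pieces[symmetric]
  proof (rule hull_below_least[OF tH])
    fix i assume "i < Suc n"
    then show "S i \<subseteq> hull_below ?S (Suc n)"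
      using hull_below_superset[of i "Suc n" ?S] coproduct_hull_superset[of "S i" \<kappa>] by blast
  qed
  then show "hull_below ?S (Suc n) = obj C"
    using coproduct_hull_least[OF tH cH] generates tri_subcatD(1)[OF tH] by blast
qed

section \<open>The chains \<open>T_{<k}^\<Coprod>\<close> and \<open>T_{<k}^\<bottom>\<close>, and
  the hat family between their steps\<close>

abbreviation "Ck k \<equiv> coproduct_hull \<kappa> C (hull_below S k)"
abbreviation "Pk k \<equiv> right_perp C (hull_below S k) (obj C)"
abbreviation "hat \<equiv> hat_family \<kappa> C T n S"

lemma tri_le_T: "k \<le> Suc n \<Longrightarrow> tri_le (full_sub C T) n S (int k - 1) = hull_below S k"
  using tri_le_full_sub[OF T, of n S] piece(2) tri_le_eq_hull_below by simp

lemma tri_subcat_Ck: "k \<le> Suc n \<Longrightarrow> tri_subcat C (Ck k)"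
  by (rule tri_subcat_coproduct_hull[OF tri_subcatD(1)[OF tri_subcat_hull_below_piece]])

lemma tri_subcat_Pk: "k \<le> Suc n \<Longrightarrow> tri_subcat C (Pk k)"
  by (rule tri_subcat_right_perp[OF tri_subcat_hull_below_piece])

lemma Ck_mono: "j \<le> k \<Longrightarrow> Ck j \<subseteq> Ck k"
  by (rule coproduct_hull_mono[OF hull_below_mono])

lemma Pk_antimono: "j \<le> k \<Longrightarrow> Pk k \<subseteq> Pk j"
  using hull_below_mono[of j k S] unfolding right_perp_def by blast

lemma coproduct_closed_Pk: "k \<le> Suc n \<Longrightarrow> coproduct_closed \<kappa> C (Pk k)"
  by (rule coproduct_closed_right_perp[OF compact]) (use hull_below_piece in blast)

lemma orth_Ck_Pk:
  assumes k: "k \<le> Suc n" shows "orth (Ck k) (Pk k)"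
proof (rule orth_coproduct_hull_left)
  show "tri_subcat C (Pk k)" by (rule tri_subcat_Pk[OF k])
  show "orth (hull_below S k) (Pk k)" unfolding orth_def right_perp_def by blast
  show "hull_below S k \<subseteq> obj C" by (rule tri_subcatD(1)[OF tri_subcat_hull_below_piece[OF k]])
qed

lemma Ck_0: "Ck 0 = {Z. zero_obj C Z}"
proof
  have c: "coproduct_closed \<kappa> C {Z. zero_obj C Z}"
    unfolding zero_objs_eq_left_perp by (rule coproduct_closed_left_perp) simp
  show "Ck 0 \<subseteq> {Z. zero_obj C Z}"
      by (rule coproduct_hull_least[OF tri_subcat_zero c]) (simp add: hull_below_0)
  show "{Z. zero_obj C Z} \<subseteq> Ck 0" using coproduct_hull_superset hull_below_0 by metis
qed

text \<open>An object orthogonal to all of \<open>T\<close> is orthogonal to the coproduct hull,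
  hence to itself.\<close>

lemma Pk_Suc_n: "Pk (Suc n) = {Z. zero_obj C Z}"
proof
  show "Pk (Suc n) \<subseteq> {Z. zero_obj C Z}"
  proof
    fix X assume X: "X \<in> Pk (Suc n)"
    have XO: "X \<in> obj C" using X unfolding right_perp_def by blast
    then have "X \<in> Ck (Suc n)" unfolding hull_pieces generates .
    then have "ident C X = zr X X" by (rule orthD[OF orth_Ck_Pk[OF order_refl] _ X ident_Hom[OF XO]])
    then show "X \<in> {Z. zero_obj C Z}" using zero_objI[OF XO] by simp
  qed
  show "{Z. zero_obj C Z} \<subseteq> Pk (Suc n)" using tri_subcatD(6)[OF tri_subcat_Pk[OF order_refl]] by blast
qed

text \<open>With strict bounds, \<open>T_{<=n-i-1}\<close> becomes level \<open>n - i\<close> and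
  \<open>T_{<=n-i}\<close> becomes level \<open>n + 1 - i\<close>.\<close>

lemma hat_eq: "i \<le> n \<Longrightarrow> hat i = Pk (n - i) \<inter> Ck (Suc n - i)"
proof -
  assume i: "i \<le> n"
  have "tri_le (full_sub C T) n S (int n - int i - 1) = hull_below S (n - i)"
    "tri_le (full_sub C T) n S (int n - int i) = hull_below S (Suc n - i)"
    using tri_le_T[of "n - i"] tri_le_T[of "Suc n - i"] i by (simp_all add: of_nat_diff)
  then have "hat i = right_perp C (hull_below S (n - i)) (Ck (Suc n - i))" unfolding hat_family_def by simp
  moreover have "Ck (Suc n - i) \<subseteq> obj C" by (rule tri_subcatD(1)[OF tri_subcat_Ck]) simp
  ultimately show ?thesis unfolding right_perp_def by blast
qed

lemma tri_subcat_hat: "i \<le> n \<Longrightarrow> tri_subcat C (hat i)"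
  unfolding hat_eq by (rule tri_subcat_Int[OF tri_subcat_Pk tri_subcat_Ck]) simp_all

lemma coproduct_closed_hat: "i \<le> n \<Longrightarrow> coproduct_closed \<kappa> C (hat i)"
  unfolding hat_eq
  by (rule coproduct_closed_Int[OF coproduct_closed_Pk coproduct_closed_coproduct_hull]) simp

text \<open>The level \<open>n - i\<close> separates the two pieces: \<open>hat j\<close> is
  contained in \<open>Ck (n - i)\<close> because \<open>n + 1 - j\<close> is at most
  \<open>n - i\<close>, and \<open>hat i\<close> is contained in \<open>Pk (n - i)\<close>.\<close>

lemma orth_hat: "i < j \<Longrightarrow> j \<le> n \<Longrightarrow> orth (hat j) (hat i)"
proof -
  assume ij: "i < j" "j \<le> n"
  show ?thesis
  proof (rule orth_mono[OF orth_Ck_Pk])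
    have "Ck (Suc n - j) \<subseteq> Ck (n - i)" by (rule Ck_mono) (use ij in arith)
    then show "hat j \<subseteq> Ck (n - i)" using hat_eq[of j] ij by blast
    show "hat i \<subseteq> Pk (n - i)" using hat_eq[of i] ij by auto
  qed simp
qed

text \<open>Stability of \<open>U\<close> under truncation at every level is what both inductions on
  the hat pieces require. It is verified for the whole category and for \<open>T_sub\<close>, so one
  argument yields the decomposition and its restriction.\<close>

definition decomposes :: "'o set \<Rightarrow> bool" where
  "decomposes U \<longleftrightarrow> tri_subcat C U \<and>
    (\<forall>k \<le> Suc n. \<forall>X \<in> U. \<exists>c \<in> Ck k \<inter> U. \<exists>d \<in> Pk k \<inter> U. tri c X d)"

lemma hull_below_hat:
  assumes U: "decomposes U" and i: "i \<le> Suc n"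
  shows "hull_below (\<lambda>i. hat i \<inter> U) i = Pk (Suc n - i) \<inter> U"
proof -
  have "hull_below (\<lambda>i. Pk (Suc n - 1 - i) \<inter> Ck (Suc n - i) \<inter> U) i = Pk (Suc n - i) \<inter> U"
    by (rule hull_below_dual_pieces)
      (use U i tri_subcat_Ck tri_subcat_Pk Pk_antimono Pk_Suc_n in \<open>simp_all add: decomposes_def\<close>)
  moreover have "hull_below (\<lambda>i. hat i \<inter> U) i = hull_below (\<lambda>i. Pk (Suc n - 1 - i) \<inter> Ck (Suc n - i) \<inter> U) i"
    by (rule hull_below_cong) (use i hat_eq in simp)
  ultimately show ?thesis by simp
qed

lemma hull_above_hat:
  assumes U: "decomposes U" and i: "i \<le> Suc n"
  shows "tri_hull C (\<Union>j \<in> {Suc n - i..<Suc n}. hat j \<inter> U) = Ck i \<inter> U"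
proof -
  have "tri_hull C (\<Union>j \<in> {Suc n - i..<Suc n}. Pk (Suc n - 1 - j) \<inter> Ck (Suc n - j) \<inter> U) = Ck i \<inter> U"
    by (rule hull_above_dual_pieces)
      (use U i tri_subcat_Ck Ck_mono Ck_0 in \<open>simp_all add: decomposes_def\<close>)
  moreover have "(\<Union>j \<in> {Suc n - i..<Suc n}. hat j \<inter> U) =
      (\<Union>j \<in> {Suc n - i..<Suc n}. Pk (Suc n - 1 - j) \<inter> Ck (Suc n - j) \<inter> U)"
    using hat_eq by (intro SUP_cong) auto
  ultimately show ?thesis by simp
qed

lemma decomposes_restricts:
  assumes U: "decomposes U" shows "restricts_to C n hat U"
proof -
  have t: "tri_subcat C U" using U unfolding decomposes_def by blast
  have "hull_below (\<lambda>i. hat i \<inter> U) (Suc n) = Pk 0 \<inter> U" using hull_below_hat[OF U, of "Suc n"] by simp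
  moreover have "U \<subseteq> Pk 0"
    unfolding hull_below_0 right_perp_def
    using tri_subcatD(1)[OF t] Hom_zeroI Hom_from_zero_obj zero_obj_in_obj by (auto simp: subset_iff)
  ultimately have "hull_below (\<lambda>i. hat i \<inter> U) (Suc n) = U" by blast
  moreover have "tri_subcat C (hat i \<inter> U)" if "i \<le> n" for i
      by (rule tri_subcat_Int[OF tri_subcat_hat[OF that] t])
  moreover have "orth (hat j \<inter> U) (hat i \<inter> U)" if "i < j \<and> j \<le> n" for i j
    using orth_mono[OF orth_hat] that by blast
  ultimately show ?thesis unfolding restricts_to_def semi_orth_dec_full_sub_iff[OF t] using t by simp
qed

lemma decomposes_obj:
  assumes es: "essentially_small \<kappa> C T" shows "decomposes (obj C)"
  unfolding decomposes_def
proof (intro conjI allI impI ballI tri_subcat_obj)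
  fix k X assume k: "k \<le> Suc n" and X: "X \<in> obj C"
  note t = tri_subcat_hull_below_piece[OF k] and sub = hull_below_piece[OF k]
  obtain Sk where Sk: "Sk \<subseteq> T" "|Sk| <o \<kappa>" "\<forall>X \<in> T. \<exists>Y \<in> Sk. isomorphic C X Y"
    using es unfolding essentially_small_def by blast
  have "essentially_small \<kappa> C (hull_below S k)"
    unfolding essentially_small_def
  proof (intro exI conjI ballI)
    \<comment> \<open>A representative of an object of the hull is again in the hull, by closure
      under isomorphism, so intersecting loses nothing.\<close>
    show "Sk \<inter> hull_below S k \<subseteq> hull_below S k" by blast
    show "|Sk \<inter> hull_below S k| <o \<kappa>" by (rule ordLeq_ordLess_trans[OF card_of_mono1 Sk(2)]) blast
    fix M assume M: "M \<in> hull_below S k"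
    then obtain Y where "Y \<in> Sk" "isomorphic C M Y" using Sk(3) sub by blast
    then show "\<exists>Y \<in> Sk \<inter> hull_below S k. isomorphic C M Y" using tri_subcatD(2)[OF t M] by blast
  qed
  moreover have "locally_small_from \<kappa> C (hull_below S k)"
    using locally_small sub unfolding locally_small_from_def by blast
  moreover have "compact_obj \<kappa> C M" if "M \<in> hull_below S k" for M using compact sub that by blast
  ultimately obtain c d where "c \<in> Ck k" "d \<in> Pk k" "tri c X d"
    using localization_triangle[OF t _ _ _ X] by blast
  then show "\<exists>c \<in> Ck k \<inter> obj C. \<exists>d \<in> Pk k \<inter> obj C. tri c X d" using tri_obj by blast
qed

lemma hat_Int_obj: "i \<le> n \<Longrightarrow> hat i \<inter> obj C = hat i"
  using tri_subcatD(1)[OF tri_subcat_hat] by blast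

lemma tri_le_hat:
  assumes es: "essentially_small \<kappa> C T" and i: "i \<le> Suc n"
  shows "tri_le C n hat (int i - 1) = Pk (Suc n - i)"
proof -
  have "hull_below hat i = hull_below (\<lambda>i. hat i \<inter> obj C) i"
    by (rule hull_below_cong) (use i hat_Int_obj in simp)
  also have "\<dots> = Pk (Suc n - i)"
    using hull_below_hat[OF decomposes_obj[OF es] i] unfolding right_perp_def by blast
  finally show ?thesis using tri_le_eq_hull_below[OF i] by simp
qed

lemma tri_ge_hat:
  assumes es: "essentially_small \<kappa> C T" and i: "i \<le> Suc n"
  shows "tri_ge C n hat (int n + 1 - int i) = Ck i"
proof -
  have I: "{j. j \<le> n \<and> int n + 1 - int i \<le> int j} = {Suc n - i..<Suc n}" using i by auto
  have "(\<Union>j \<in> {Suc n - i..<Suc n}. hat j) = (\<Union>j \<in> {Suc n - i..<Suc n}. hat j \<inter> obj C)"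
    using hat_Int_obj by (intro SUP_cong) auto
  then have "tri_ge C n hat (int n + 1 - int i) = Ck i \<inter> obj C"
    unfolding tri_ge_def I using hull_above_hat[OF decomposes_obj[OF es] i] by simp
  then show ?thesis using tri_subcatD(1)[OF tri_subcat_Ck[OF i]] by blast
qed

lemma semi_orth_dec_hat:
  assumes es: "essentially_small \<kappa> C T" shows "semi_orth_dec C n hat"
proof -
  have "hull_below hat (Suc n) = Pk 0"
    using tri_le_hat[OF es, of "Suc n"] tri_le_eq_hull_below[of "Suc n" n hat] by simp
  moreover have "obj C \<subseteq> Pk 0"
    unfolding hull_below_0 right_perp_def
    using Hom_zeroI Hom_from_zero_obj zero_obj_in_obj by (auto simp: subset_iff)
  moreover have "Pk 0 \<subseteq> obj C" unfolding right_perp_def by blast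
  ultimately show ?thesis unfolding semi_orth_dec_iff using tri_subcat_hat orth_hat by blast
qed

lemma left_admissible_Pk:
  assumes es: "essentially_small \<kappa> C T" and k: "k \<le> Suc n" shows "left_admissible C (Pk k)"
proof (rule left_admissibleI[OF tri_subcat_Pk[OF k]])
  fix X assume "X \<in> obj C"
  then obtain c d where cd: "c \<in> Ck k" "d \<in> Pk k" "tri c X d"
    using decomposes_obj[OF es] k unfolding decomposes_def by blast
  have "orth {c, sh c} (Pk k)"
    by (rule orth_mono[OF orth_Ck_Pk[OF k]]) (use cd(1) tri_subcatD(3)[OF tri_subcat_Ck[OF k]] in auto)
  then show "\<exists>c. \<exists>d\<in>Pk k. tri c X d \<and> orth {c, sh c} (Pk k)" using cd by blast
qed

lemma right_admissible_Ck:
  assumes es: "essentially_small \<kappa> C T" and k: "k \<le> Suc n" shows "right_admissible C (Ck k)"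
proof (rule right_admissibleI[OF tri_subcat_Ck[OF k]])
  fix X assume "X \<in> obj C"
  then obtain c d where cd: "c \<in> Ck k" "d \<in> Pk k" "tri c X d"
    using decomposes_obj[OF es] k unfolding decomposes_def by blast
  have "orth (Ck k) {d}" by (rule orth_mono[OF orth_Ck_Pk[OF k]]) (use cd(2) in auto)
  then show "\<exists>c\<in>Ck k. \<exists>d. tri c X d \<and> orth (Ck k) {d}" using cd by blast
qed

text \<open>Each \<open>hat i\<close> is closed under coproducts, so the enlarged pieces
  \<open>?E i\<close> stay inside it and remain semi-orthogonal. Their hull is closed under
  coproducts and contains \<open>U\<close>, hence contains the hull \<open>?U\<close>.\<close>

lemma restricts_to_coproduct_hull:
  assumes r: "restricts_to C n hat U"
  shows "restricts_to C n hat (coproduct_hull \<kappa> C U)"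
    and "i \<le> n \<Longrightarrow> hat i \<inter> coproduct_hull \<kappa> C U = coproduct_hull \<kappa> C (hat i \<inter> U)"
proof -
  let ?U = "coproduct_hull \<kappa> C U" and ?E = "\<lambda>i. coproduct_hull \<kappa> C (hat i \<inter> U)"
  have U: "tri_subcat C U" using r unfolding restricts_to_def by blast
  note sod = r[unfolded restricts_to_def semi_orth_dec_full_sub_iff[OF U]]
  have HU: "hull_below (\<lambda>i. hat i \<inter> U) (Suc n) = U" using sod by blast
  have tU: "tri_subcat C ?U" by (rule tri_subcat_coproduct_hull[OF tri_subcatD(1)[OF U]])
  have tE: "tri_subcat C (?E i)" if "i \<le> n" for i
    by (rule tri_subcat_coproduct_hull) (use tri_subcatD(1)[OF U] in blast)
  have Eh: "?E i \<subseteq> hat i" if "i \<le> n" for i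
    by (rule coproduct_hull_least[OF tri_subcat_hat[OF that] coproduct_closed_hat[OF that]]) blast
  have EU: "?E i \<subseteq> ?U" for i by (rule coproduct_hull_mono) blast
  have oE: "orth (?E j) (?E i)" if "i < j" "j \<le> n" for i j
    by (rule orth_mono[OF orth_hat[OF that] Eh Eh]) (use that in simp_all)
  have tH: "tri_subcat C (hull_below ?E (Suc n))"
    by (rule tri_subcat_hull_below) (use tri_subcatD(1)[OF tE] in simp)
  have cH: "coproduct_closed \<kappa> C (hull_below ?E (Suc n))"
    by (rule coproduct_closed_hull_below) (use tE oE coproduct_closed_coproduct_hull in simp_all)
  have "U \<subseteq> hull_below ?E (Suc n)"
  proof -
    have "hull_below (\<lambda>i. hat i \<inter> U) (Suc n) \<subseteq> hull_below ?E (Suc n)"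
    proof (rule hull_below_least[OF tH])
      fix i assume "i < Suc n"
      then show "hat i \<inter> U \<subseteq> hull_below ?E (Suc n)"
        using hull_below_superset[of i "Suc n" ?E] coproduct_hull_superset[of "hat i \<inter> U" \<kappa>] by blast
    qed
    then show ?thesis unfolding HU .
  qed
  then have UE: "?U \<subseteq> hull_below ?E (Suc n)" by (rule coproduct_hull_least[OF tH cH])
  have eq: "hat i \<inter> ?U = ?E i" if i: "i \<le> n" for i
  proof
    show "?E i \<subseteq> hat i \<inter> ?U" using Eh[OF i] EU by blast
    show "hat i \<inter> ?U \<subseteq> ?E i"
    proof
      fix X assume X: "X \<in> hat i \<inter> ?U"
      show "X \<in> ?E i"
      \<comment> \<open>Rigidity gives the less obvious inclusion: an object of \<open>hat i\<close>
        that is built from the smaller pieces lies in the \<open>i\<close>-th smaller piece.\<close>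
      proof (rule hull_below_Int_piece[of "Suc n" ?E hat])
        show "X \<in> hull_below ?E (Suc n)" using UE X by blast
      qed (use X i tE Eh orth_hat tri_subcat_hat in auto)
    qed
  qed
  show "i \<le> n \<Longrightarrow> hat i \<inter> ?U = ?E i" by (rule eq)
  have "hull_below (\<lambda>i. hat i \<inter> ?U) (Suc n) = hull_below ?E (Suc n)"
    by (rule hull_below_cong) (use eq in simp)
  moreover have "hull_below ?E (Suc n) \<subseteq> ?U" by (rule hull_below_least[OF tU EU])
  ultimately have "hull_below (\<lambda>i. hat i \<inter> ?U) (Suc n) = ?U" using UE by blast
  then show "restricts_to C n hat ?U"
    unfolding restricts_to_def semi_orth_dec_full_sub_iff[OF tU] using tU tE oE eq EU by simp
qed

end

section \<open>Graded modules\<close>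

lemma mod_homD:
  assumes "f \<in> mod_hom R M N"
  shows "x \<in> carrier M \<Longrightarrow> f x \<in> carrier N"
    "x \<in> carrier M \<Longrightarrow> y \<in> carrier M \<Longrightarrow> f (x \<oplus>\<^bsub>M\<^esub> y) = f x \<oplus>\<^bsub>N\<^esub> f y"
    "r \<in> carrier R \<Longrightarrow> x \<in> carrier M \<Longrightarrow> f (r \<odot>\<^bsub>M\<^esub> x) = r \<odot>\<^bsub>N\<^esub> f x"
  using assms by (auto simp: mod_hom_def)

lemma mod_homI:
  assumes "\<And>x. x \<in> carrier M \<Longrightarrow> f x \<in> carrier N"
    "\<And>x y. x \<in> carrier M \<Longrightarrow> y \<in> carrier M \<Longrightarrow> f (x \<oplus>\<^bsub>M\<^esub> y) = f x \<oplus>\<^bsub>N\<^esub> f y"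
    "\<And>r x. r \<in> carrier R \<Longrightarrow> x \<in> carrier M \<Longrightarrow> f (r \<odot>\<^bsub>M\<^esub> x) = r \<odot>\<^bsub>N\<^esub> f x"
  shows "f \<in> mod_hom R M N"
  using assms by (auto simp: mod_hom_def)

lemma module_closed:
  assumes "module R M"
  shows "\<zero>\<^bsub>M\<^esub> \<in> carrier M" "x \<in> carrier M \<Longrightarrow> y \<in> carrier M \<Longrightarrow> x \<oplus>\<^bsub>M\<^esub> y \<in> carrier M"
    "r \<in> carrier R \<Longrightarrow> x \<in> carrier M \<Longrightarrow> r \<odot>\<^bsub>M\<^esub> x \<in> carrier M"
proof -
  interpret module R M by (rule assms)
  show "\<zero>\<^bsub>M\<^esub> \<in> carrier M" "x \<in> carrier M \<Longrightarrow> y \<in> carrier M \<Longrightarrow> x \<oplus>\<^bsub>M\<^esub> y \<in> carrier M"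
    "r \<in> carrier R \<Longrightarrow> x \<in> carrier M \<Longrightarrow> r \<odot>\<^bsub>M\<^esub> x \<in> carrier M" by simp_all
qed

lemma mod_hom_zero:
  assumes M: "module R M" and N: "module R N" and f: "f \<in> mod_hom R M N" shows "f \<zero>\<^bsub>M\<^esub> = \<zero>\<^bsub>N\<^esub>"
proof -
  interpret M: module R M by (rule M)
  interpret N: module R N by (rule N)
  have "f \<zero>\<^bsub>M\<^esub> \<oplus>\<^bsub>N\<^esub> f \<zero>\<^bsub>M\<^esub> = f \<zero>\<^bsub>M\<^esub>" using mod_homD(2)[OF f M.M.zero_closed M.M.zero_closed] by simp
  then show ?thesis using N.M.add.l_cancel_one mod_homD(1)[OF f M.M.zero_closed] by simp
qed

lemma mod_hom_comp:
  assumes f: "f \<in> mod_hom R M N" and g: "g \<in> mod_hom R N P" shows "(\<lambda>x. g (f x)) \<in> mod_hom R M P"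
  by (rule mod_homI) (simp_all add: mod_homD[OF f] mod_homD[OF g])

lemma mod_hom_inverse:
  assumes M: "module R M" and f: "f \<in> mod_hom R M N" and b: "bij_betw f (carrier M) (carrier N)"
  shows "inv_into (carrier M) f \<in> mod_hom R N M"
proof (rule mod_homI)
  let ?g = "inv_into (carrier M) f"
  have inj: "inj_on f (carrier M)" and im: "f ` carrier M = carrier N" using b by (simp_all add: bij_betw_def)
  have g: "?g y \<in> carrier M" "f (?g y) = y" if "y \<in> carrier N" for y
    using that inv_into_into[of y f "carrier M"] f_inv_into_f[of y f "carrier M"] im by simp_all
  fix x y r assume x: "x \<in> carrier N"
  show "?g x \<in> carrier M" by (rule g(1)[OF x])
  show "?g (x \<oplus>\<^bsub>N\<^esub> y) = ?g x \<oplus>\<^bsub>M\<^esub> ?g y" if y: "y \<in> carrier N"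
    using inv_into_f_f[OF inj module_closed(2)[OF M g(1)[OF x] g(1)[OF y]]] mod_homD(2)[OF f g(1)[OF x] g(1)[OF y]] g(2) x y
    by simp
  show "?g (r \<odot>\<^bsub>N\<^esub> x) = r \<odot>\<^bsub>M\<^esub> ?g x" if r: "r \<in> carrier R"
    using inv_into_f_f[OF inj module_closed(3)[OF M r g(1)[OF x]]] mod_homD(3)[OF f r g(1)[OF x]] g(2) x
        by simp
qed

text \<open>\<open>G\<close> is not assumed to satisfy any module axiom. This serves both images of
  homomorphisms and copies of modules on another carrier type.\<close>

lemma module_surj_image:
  assumes M: "module R M" and im: "f ` carrier M = carrier G"
    and add: "\<And>x y. x \<in> carrier M \<Longrightarrow> y \<in> carrier M \<Longrightarrow> f (x \<oplus>\<^bsub>M\<^esub> y) = f x \<oplus>\<^bsub>G\<^esub> f y"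
    and smult: "\<And>r x. r \<in> carrier R \<Longrightarrow> x \<in> carrier M \<Longrightarrow> f (r \<odot>\<^bsub>M\<^esub> x) = r \<odot>\<^bsub>G\<^esub> f x"
    and zero: "f \<zero>\<^bsub>M\<^esub> = \<zero>\<^bsub>G\<^esub>"
  shows "module R G"
proof -
  interpret M: module R M by (rule M)
  have pre: "\<exists>x' \<in> carrier M. f x' = x" if "x \<in> carrier G" for x using that im by (metis imageE)
  have f: "f x \<in> carrier G" if "x \<in> carrier M" for x using that im by blast
  show ?thesis
  proof (rule moduleI[OF M.is_cring abelian_groupI])
    show "\<zero>\<^bsub>G\<^esub> \<in> carrier G" using f[OF M.M.zero_closed] zero by simp
  next
    fix x y assume "x \<in> carrier G" "y \<in> carrier G"
    then obtain x' y' where xy: "x' \<in> carrier M" "f x' = x" "y' \<in> carrier M" "f y' = y" using pre by metis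
    show "x \<oplus>\<^bsub>G\<^esub> y \<in> carrier G" using f[of "x' \<oplus>\<^bsub>M\<^esub> y'"] add[of x' y'] xy by simp
    show "x \<oplus>\<^bsub>G\<^esub> y = y \<oplus>\<^bsub>G\<^esub> x" using add[of x' y'] add[of y' x'] xy M.M.a_comm by simp
    show "r \<odot>\<^bsub>G\<^esub> (x \<oplus>\<^bsub>G\<^esub> y) = r \<odot>\<^bsub>G\<^esub> x \<oplus>\<^bsub>G\<^esub> r \<odot>\<^bsub>G\<^esub> y" if r: "r \<in> carrier R" for r
      using smult[OF r, of "x' \<oplus>\<^bsub>M\<^esub> y'"] smult[OF r, of x'] smult[OF r, of y'] add[of x' y']
        add[of "r \<odot>\<^bsub>M\<^esub> x'" "r \<odot>\<^bsub>M\<^esub> y'"] M.smult_r_distr[OF r] xy r by simp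
    fix z assume "z \<in> carrier G"
    then obtain z' where z: "z' \<in> carrier M" "f z' = z" using pre by metis
    show "x \<oplus>\<^bsub>G\<^esub> y \<oplus>\<^bsub>G\<^esub> z = x \<oplus>\<^bsub>G\<^esub> (y \<oplus>\<^bsub>G\<^esub> z)"
      using add[of x' y'] add[of "x' \<oplus>\<^bsub>M\<^esub> y'" z'] add[of y' z'] add[of x' "y' \<oplus>\<^bsub>M\<^esub> z'"] xy z M.M.a_assoc
          by simp
  next
    fix x assume "x \<in> carrier G"
    then obtain x' where x: "x' \<in> carrier M" "f x' = x" using pre by metis
    show "\<zero>\<^bsub>G\<^esub> \<oplus>\<^bsub>G\<^esub> x = x" using add[OF M.M.zero_closed x(1)] x zero by simp
    show "\<exists>y\<in>carrier G. y \<oplus>\<^bsub>G\<^esub> x = \<zero>\<^bsub>G\<^esub>"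
      using add[OF M.M.a_inv_closed[OF x(1)] x(1)] f[OF M.M.a_inv_closed[OF x(1)]] x zero M.M.l_neg by auto
    show "\<one>\<^bsub>R\<^esub> \<odot>\<^bsub>G\<^esub> x = x" using smult[of "\<one>\<^bsub>R\<^esub>" x'] x by simp
    show "a \<odot>\<^bsub>G\<^esub> x \<in> carrier G" if "a \<in> carrier R" for a
      using smult[OF that x(1)] f[of "a \<odot>\<^bsub>M\<^esub> x'"] x that by simp
    show "(a \<oplus>\<^bsub>R\<^esub> b) \<odot>\<^bsub>G\<^esub> x = a \<odot>\<^bsub>G\<^esub> x \<oplus>\<^bsub>G\<^esub> b \<odot>\<^bsub>G\<^esub> x" if ab: "a \<in> carrier R" "b \<in> carrier R" for a b
      using smult[of "a \<oplus>\<^bsub>R\<^esub> b" x'] smult[of a x'] smult[of b x'] add[of "a \<odot>\<^bsub>M\<^esub> x'" "b \<odot>\<^bsub>M\<^esub> x'"]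
        M.smult_l_distr[OF ab x(1)] x ab by simp
    show "(a \<otimes>\<^bsub>R\<^esub> b) \<odot>\<^bsub>G\<^esub> x = a \<odot>\<^bsub>G\<^esub> (b \<odot>\<^bsub>G\<^esub> x)" if ab: "a \<in> carrier R" "b \<in> carrier R" for a b
      using smult[of "a \<otimes>\<^bsub>R\<^esub> b" x'] smult[of b x'] smult[of a "b \<odot>\<^bsub>M\<^esub> x'"] M.smult_assoc1[OF ab x(1)] x ab
          by simp
  qed
qed

lemma module_image:
  assumes M: "module R M" and N: "module R N" and f: "f \<in> mod_hom R M N"
  shows "module R (N\<lparr>carrier := f ` carrier M\<rparr>)"
  by (rule module_surj_image[OF M, of f]) (simp_all add: mod_homD[OF f] mod_hom_zero[OF M N f])

definition mod_isomorphic ::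
  "('r, 'y) ring_scheme \<Rightarrow> ('r, 'a, 'z) module_scheme \<Rightarrow> ('r, 'b, 'w) module_scheme \<Rightarrow> bool" where
  "mod_isomorphic R M N \<longleftrightarrow> (\<exists>f \<in> mod_hom R M N. bij_betw f (carrier M) (carrier N))"

lemma gmod_isomorphic_iff: "gmod_isomorphic R G H \<longleftrightarrow> (\<forall>j. mod_isomorphic R (G j) (H j))"
proof
  show "gmod_isomorphic R G H \<Longrightarrow> \<forall>j. mod_isomorphic R (G j) (H j)"
    unfolding gmod_isomorphic_def mod_isomorphic_def gmod_hom_def by blast
  assume "\<forall>j. mod_isomorphic R (G j) (H j)"
  then have "\<forall>j. \<exists>f. f \<in> mod_hom R (G j) (H j) \<and> bij_betw f (carrier (G j)) (carrier (H j))"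
    unfolding mod_isomorphic_def by blast
  from choice[OF this] show "gmod_isomorphic R G H" unfolding gmod_isomorphic_def gmod_hom_def by blast
qed

lemma mod_isomorphic_sym: "module R M \<Longrightarrow> mod_isomorphic R M N \<Longrightarrow> mod_isomorphic R N M"
  unfolding mod_isomorphic_def using mod_hom_inverse bij_betw_inv_into by blast

lemma mod_isomorphic_trans:
  assumes "mod_isomorphic R M N" "mod_isomorphic R N P" shows "mod_isomorphic R M P"
proof -
  obtain f g where f: "f \<in> mod_hom R M N" "bij_betw f (carrier M) (carrier N)"
    and g: "g \<in> mod_hom R N P" "bij_betw g (carrier N) (carrier P)"
    using assms unfolding mod_isomorphic_def by blast
  have "bij_betw (\<lambda>x. g (f x)) (carrier M) (carrier P)" using bij_betw_trans[OF f(2) g(2)]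
      by (simp add: comp_def)
  then show ?thesis unfolding mod_isomorphic_def using mod_hom_comp[OF f(1) g(1)] by blast
qed

text \<open>Modules of morphisms and members of \<open>A\<close> have carriers of different types.
  The structure is carried along an injection into the type of \<kappa>, which exists by
  smallness.\<close>

lemma module_transport:
  fixes \<kappa> :: "'u rel"
  assumes M: "module R M" and \<kappa>: "Card_order \<kappa>" and small: "|carrier M| <o \<kappa>"
  shows "\<exists>G :: ('r, 'u) module. module R G \<and> |carrier G| <o \<kappa> \<and> mod_isomorphic R M G"
proof -
  have "|carrier M| \<le>o |Field \<kappa>|"
    using small card_of_Field_ordIso[OF \<kappa>] ordIso_symmetric ordLess_ordIso_trans ordLess_imp_ordLeq by blast
  then obtain e :: "_ \<Rightarrow> 'u" where e: "inj_on e (carrier M)" using card_of_ordLeq[of "carrier M" "Field \<kappa>"]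
      by blast
  let ?i = "inv_into (carrier M) e"
  define G :: "('r, 'u) module" where "G = \<lparr>carrier = e ` carrier M, mult = undefined, one = undefined,
    ring.zero = e \<zero>\<^bsub>M\<^esub>, add = (\<lambda>a b. e (?i a \<oplus>\<^bsub>M\<^esub> ?i b)), smult = (\<lambda>r a. e (r \<odot>\<^bsub>M\<^esub> ?i a))\<rparr>"
  have c: "carrier G = e ` carrier M" by (simp add: G_def)
  have a: "e (x \<oplus>\<^bsub>M\<^esub> y) = e x \<oplus>\<^bsub>G\<^esub> e y" if "x \<in> carrier M" "y \<in> carrier M" for x y
    using that e by (simp add: G_def)
  have s: "e (r \<odot>\<^bsub>M\<^esub> x) = r \<odot>\<^bsub>G\<^esub> e x" if "x \<in> carrier M" for r x
    using that e by (simp add: G_def)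
  have "module R G" by (rule module_surj_image[OF M c[symmetric] a s]) (simp_all add: G_def)
  moreover have "|carrier G| <o \<kappa>" unfolding c by (rule ordLeq_ordLess_trans[OF card_of_image small])
  moreover have "e \<in> mod_hom R M G" by (rule mod_homI) (simp_all add: c a s)
  then have "mod_isomorphic R M G" unfolding mod_isomorphic_def using e c by (auto simp: bij_betw_def)
  ultimately show ?thesis by blast
qed

text \<open>Exactness is preserved when \<open>a\<close> and \<open>b\<close> are conjugated by
  isomorphisms. This moves a sequence of modules of morphisms to carriers on which the closure
  properties of \<open>A\<close> can be applied.\<close>

lemma exact_transport:
  assumes M: "module R M1" "module R M2" "module R M3" and G3: "module R G3"
    and p1: "p1 \<in> mod_hom R M1 G1" "bij_betw p1 (carrier M1) (carrier G1)"
    and p2: "p2 \<in> mod_hom R M2 G2" "bij_betw p2 (carrier M2) (carrier G2)"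
    and p3: "p3 \<in> mod_hom R M3 G3" "bij_betw p3 (carrier M3) (carrier G3)"
    and a: "a \<in> mod_hom R M1 M2" and b: "b \<in> mod_hom R M2 M3"
    and ex: "{x \<in> carrier M2. b x = \<zero>\<^bsub>M3\<^esub>} = a ` carrier M1"
  shows "{y \<in> carrier G2. p3 (b (inv_into (carrier M2) p2 y)) = \<zero>\<^bsub>G3\<^esub>} =
    (\<lambda>x. p2 (a (inv_into (carrier M1) p1 x))) ` carrier G1"
proof -
  have im: "p1 ` carrier M1 = carrier G1" "p2 ` carrier M2 = carrier G2"
    and inj: "inj_on p1 (carrier M1)" "inj_on p2 (carrier M2)" "inj_on p3 (carrier M3)"
    using p1(2) p2(2) p3(2) by (simp_all add: bij_betw_def)
  have z: "p3 (b x) = \<zero>\<^bsub>G3\<^esub> \<longleftrightarrow> b x = \<zero>\<^bsub>M3\<^esub>" if "x \<in> carrier M2" for x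
    using mod_hom_zero[OF M(3) G3 p3(1)] inj_onD[OF inj(3)] mod_homD(1)[OF b that] module_closed(1)[OF M(3)]
        by metis
  have "{y \<in> carrier G2. p3 (b (inv_into (carrier M2) p2 y)) = \<zero>\<^bsub>G3\<^esub>} = p2 ` {x \<in> carrier M2. b x = \<zero>\<^bsub>M3\<^esub>}"
    unfolding im(2)[symmetric] using z inj(2) mod_hom_zero[OF M(3) G3 p3(1)] by auto
  also have "\<dots> = (\<lambda>x. p2 (a (inv_into (carrier M1) p1 x))) ` p1 ` carrier M1"
    unfolding ex image_image by (rule image_cong) (simp_all add: inj(1))
  finally show ?thesis unfolding im(1) .
qed

section \<open>Membership in an exact abelian subcategory up to isomorphism\<close>

definition ess_in ::
  "('r, 'y) ring_scheme \<Rightarrow> ('r, 'u) graded_module set \<Rightarrow> ('r, 'm) graded_module \<Rightarrow> bool" where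
  "ess_in R A X \<longleftrightarrow> (\<exists>G \<in> A. gmod_isomorphic R X G)"

lemma ess_in_iso:
  "ess_in R A Y \<Longrightarrow> (\<And>j. mod_isomorphic R (X j) (Y j)) \<Longrightarrow> ess_in R A X"
  unfolding ess_in_def gmod_isomorphic_iff using mod_isomorphic_trans by blast

context
  fixes R :: "('r, 'y) ring_scheme" and \<kappa> :: "'u rel" and A :: "('r, 'u) graded_module set"
  assumes exact: "exact_abelian_subcat R \<kappa> A" and \<kappa>: "Card_order \<kappa>"
begin

lemma abelian_graded: "A \<subseteq> graded_modules R \<kappa>"
  using exact unfolding exact_abelian_subcat_def by blast

lemma abelian_module: "G \<in> A \<Longrightarrow> module R (G j)"
  and abelian_small: "G \<in> A \<Longrightarrow> |carrier (G j)| <o \<kappa>"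
  using abelian_graded unfolding graded_modules_def by blast+

lemma abelian_kernel:
  "G \<in> A \<Longrightarrow> H \<in> A \<Longrightarrow> K \<in> graded_modules R \<kappa> \<Longrightarrow> is_gmod_kernel R K G H k f \<Longrightarrow> K \<in> A"
  using exact unfolding exact_abelian_subcat_def by blast

lemma abelian_cokernel:
  "G \<in> A \<Longrightarrow> H \<in> A \<Longrightarrow> Q \<in> graded_modules R \<kappa> \<Longrightarrow> is_gmod_cokernel R G H Q f p \<Longrightarrow> Q \<in> A"
  using exact unfolding exact_abelian_subcat_def by blast

lemma abelian_extension:
  "G \<in> A \<Longrightarrow> H \<in> A \<Longrightarrow> E \<in> graded_modules R \<kappa> \<Longrightarrow> is_gmod_kernel R G E H k p \<Longrightarrow>
    is_gmod_cokernel R G E H k p \<Longrightarrow> E \<in> A"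
  using exact unfolding exact_abelian_subcat_def by blast

lemma graded_image:
  assumes G: "\<And>j. module R (G j)" and H: "H \<in> graded_modules R \<kappa>"
    and f: "\<And>j. f j \<in> mod_hom R (G j) (H j)"
  shows "(\<lambda>j. (H j)\<lparr>carrier := f j ` carrier (G j)\<rparr>) \<in> graded_modules R \<kappa>"
proof -
  have "f j ` carrier (G j) \<subseteq> carrier (H j)" for j using mod_homD(1)[OF f] by blast
  then have "|f j ` carrier (G j)| <o \<kappa>" for j
    using H ordLeq_ordLess_trans[OF card_of_mono1] unfolding graded_modules_def by blast
  moreover have "module R (H j)" for j using H unfolding graded_modules_def by blast
  ultimately show ?thesis unfolding graded_modules_def using module_image[OF G _ f] by simp
qed

text \<open>\<open>A\<close> has some member \<open>G\<close>, and the kernel of the identity of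
  \<open>G\<close> is zero. The kernel is realised as the image of the zero endomorphism.\<close>

lemma abelian_zero: "\<exists>G \<in> A. \<forall>j. carrier (G j) = {\<zero>\<^bsub>G j\<^esub>}"
proof -
  obtain G where G: "G \<in> A" using exact unfolding exact_abelian_subcat_def by blast
  note m = module_closed[OF abelian_module[OF G]]
  have z: "(\<lambda>_. \<zero>\<^bsub>G j\<^esub>) \<in> mod_hom R (G j) (G j)" for j
  proof -
    interpret module R "G j" by (rule abelian_module[OF G])
    show ?thesis by (rule mod_homI) (simp_all add: smult_r_null)
  qed
  define K where "K j = (G j)\<lparr>carrier := (\<lambda>_. \<zero>\<^bsub>G j\<^esub>) ` carrier (G j)\<rparr>" for j
  have K: "K \<in> graded_modules R \<kappa>"
    unfolding K_def by (rule graded_image[OF abelian_module[OF G] subsetD[OF abelian_graded G] z])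
  have c: "carrier (K j) = {\<zero>\<^bsub>K j\<^esub>}" for j unfolding K_def using m(1) by auto
  have "is_gmod_kernel R K G G (\<lambda>j x. x) (\<lambda>j x. x)"
    unfolding is_gmod_kernel_def gmod_hom_def
  proof (intro conjI CollectI allI)
    fix j
    show "(\<lambda>x. x) \<in> mod_hom R (K j) (G j)" unfolding K_def by (rule mod_homI) (auto simp: m)
    show "(\<lambda>x. x) \<in> mod_hom R (G j) (G j)" by (rule mod_homI) auto
    show "(\<lambda>x. x) ` carrier (K j) = {x \<in> carrier (G j). x = \<zero>\<^bsub>G j\<^esub>}" using m(1)[of j] by (auto simp: K_def)
  qed simp
  then show ?thesis using abelian_kernel[OF G G K] c by blast
qed

lemma ess_in_shift:
  assumes st: "shift_stable R \<kappa> A" shows "ess_in R A (\<lambda>j. X (j + 1)) \<longleftrightarrow> ess_in R A X"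
proof
  assume "ess_in R A (\<lambda>j. X (j + 1))"
  then obtain G where G: "G \<in> A" "\<And>j. mod_isomorphic R (X (j + 1)) (G j)"
    unfolding ess_in_def gmod_isomorphic_iff by blast
  define G' where "G' j = G (j - 1)" for j
  have "G' \<in> graded_modules R \<kappa>" unfolding G'_def graded_modules_def
    using abelian_module[OF G(1)] abelian_small[OF G(1)] by blast
  moreover have "(\<lambda>j. G' (j + 1)) = G" by (simp add: G'_def)
  ultimately have "G' \<in> A" using st G(1) unfolding shift_stable_def by metis
  moreover have "mod_isomorphic R (X j) (G' j)" for j using G(2)[of "j - 1"] by (simp add: G'_def)
  ultimately show "ess_in R A X" unfolding ess_in_def gmod_isomorphic_iff by blast
next
  assume "ess_in R A X"
  then obtain G where G: "G \<in> A" "\<And>j. mod_isomorphic R (X j) (G j)"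
    unfolding ess_in_def gmod_isomorphic_iff by blast
  then have "(\<lambda>j. G (j + 1)) \<in> A" using st abelian_graded unfolding shift_stable_def by blast
  then show "ess_in R A (\<lambda>j. X (j + 1))"
    unfolding ess_in_def gmod_isomorphic_iff using G(2) by (intro bexI[of _ "\<lambda>j. G (j + 1)"]) simp_all
qed

text \<open>The middle term is an extension of the kernel of \<open>d\<close> by the cokernel of \<open>a\<close>, both of which are realised
  as images inside the neighbouring modules.\<close>

lemma ess_in_five_term:
  assumes M: "\<And>j. module R (M1 j)" "\<And>j. module R (M2 j)" "\<And>j. module R (M3 j)" "\<And>j. module R (M4 j)" "\<And>j. module R (M5 j)"
    and small: "\<And>j. |carrier (M3 j)| <o \<kappa>"
    and ess: "ess_in R A M1" "ess_in R A M2" "ess_in R A M4" "ess_in R A M5"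
    and hom: "\<And>j. a j \<in> mod_hom R (M1 j) (M2 j)" "\<And>j. b j \<in> mod_hom R (M2 j) (M3 j)"
      "\<And>j. c j \<in> mod_hom R (M3 j) (M4 j)" "\<And>j. d j \<in> mod_hom R (M4 j) (M5 j)"
    and ex: "\<And>j. {x \<in> carrier (M2 j). b j x = \<zero>\<^bsub>M3 j\<^esub>} = a j ` carrier (M1 j)"
      "\<And>j. {x \<in> carrier (M3 j). c j x = \<zero>\<^bsub>M4 j\<^esub>} = b j ` carrier (M2 j)"
      "\<And>j. {x \<in> carrier (M4 j). d j x = \<zero>\<^bsub>M5 j\<^esub>} = c j ` carrier (M3 j)"
  shows "ess_in R A M3"
proof -
  have isoE: "\<exists>p. \<forall>j. p j \<in> mod_hom R (X j) (G j) \<and> bij_betw (p j) (carrier (X j)) (carrier (G j))"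
    if "gmod_isomorphic R X G" for X :: "('r, 'm) graded_module" and G :: "('r, 'u) graded_module"
    using that unfolding gmod_isomorphic_def gmod_hom_def by blast
  have ess': "\<exists>G p. G \<in> A \<and> (\<forall>j. p j \<in> mod_hom R (X j) (G j) \<and> bij_betw (p j) (carrier (X j)) (carrier (G j)))"
    if "ess_in R A X" for X :: "('r, 'm) graded_module"
    using that isoE unfolding ess_in_def by blast
  obtain G1 p1 where G1: "G1 \<in> A"
      and p1: "\<And>j. p1 j \<in> mod_hom R (M1 j) (G1 j)" "\<And>j. bij_betw (p1 j) (carrier (M1 j)) (carrier (G1 j))"
    using ess'[OF ess(1)] by blast
  obtain G2 p2 where G2: "G2 \<in> A"
      and p2: "\<And>j. p2 j \<in> mod_hom R (M2 j) (G2 j)" "\<And>j. bij_betw (p2 j) (carrier (M2 j)) (carrier (G2 j))"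
    using ess'[OF ess(2)] by blast
  obtain G4 p4 where G4: "G4 \<in> A"
      and p4: "\<And>j. p4 j \<in> mod_hom R (M4 j) (G4 j)" "\<And>j. bij_betw (p4 j) (carrier (M4 j)) (carrier (G4 j))"
    using ess'[OF ess(3)] by blast
  obtain G5 p5 where G5: "G5 \<in> A"
      and p5: "\<And>j. p5 j \<in> mod_hom R (M5 j) (G5 j)" "\<And>j. bij_betw (p5 j) (carrier (M5 j)) (carrier (G5 j))"
    using ess'[OF ess(4)] by blast
  \<comment> \<open>The four neighbours come with copies in \<open>A\<close>. The middle term does
    not, so its copy is made from smallness and its membership is then proved.\<close>
  have "\<forall>j. \<exists>G :: ('r, 'u) module. module R G \<and> |carrier G| <o \<kappa> \<and> mod_isomorphic R (M3 j) G"
    using module_transport[OF M(3) \<kappa> small] by blast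
  from choice[OF this] obtain G3 :: "('r, 'u) graded_module"
    where G3: "\<And>j. module R (G3 j)" "\<And>j. |carrier (G3 j)| <o \<kappa>" "\<And>j. mod_isomorphic R (M3 j) (G3 j)" by blast
  have G3g: "G3 \<in> graded_modules R \<kappa>" using G3(1,2) unfolding graded_modules_def by blast
  have iso3: "gmod_isomorphic R M3 G3" using G3(3) by (simp add: gmod_isomorphic_iff)
  obtain p3 where p3: "\<And>j. p3 j \<in> mod_hom R (M3 j) (G3 j)" "\<And>j. bij_betw (p3 j) (carrier (M3 j)) (carrier (G3 j))"
    using isoE[OF iso3] by blast
  define a' where "a' j x = p2 j (a j (inv_into (carrier (M1 j)) (p1 j) x))" for j x
  define b' where "b' j x = p3 j (b j (inv_into (carrier (M2 j)) (p2 j) x))" for j x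
  define c' where "c' j x = p4 j (c j (inv_into (carrier (M3 j)) (p3 j) x))" for j x
  define d' where "d' j x = p5 j (d j (inv_into (carrier (M4 j)) (p4 j) x))" for j x
  have a': "a' j \<in> mod_hom R (G1 j) (G2 j)" for j
    unfolding a'_def by (rule mod_hom_comp[OF mod_hom_comp[OF mod_hom_inverse[OF M(1) p1] hom(1)] p2(1)])
  have b': "b' j \<in> mod_hom R (G2 j) (G3 j)" for j
    unfolding b'_def by (rule mod_hom_comp[OF mod_hom_comp[OF mod_hom_inverse[OF M(2) p2] hom(2)] p3(1)])
  have c': "c' j \<in> mod_hom R (G3 j) (G4 j)" for j
    unfolding c'_def by (rule mod_hom_comp[OF mod_hom_comp[OF mod_hom_inverse[OF M(3) p3] hom(3)] p4(1)])
  have d': "d' j \<in> mod_hom R (G4 j) (G5 j)" for j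
    unfolding d'_def by (rule mod_hom_comp[OF mod_hom_comp[OF mod_hom_inverse[OF M(4) p4] hom(4)] p5(1)])
  have e1: "{x \<in> carrier (G2 j). b' j x = \<zero>\<^bsub>G3 j\<^esub>} = a' j ` carrier (G1 j)" for j
    unfolding a'_def b'_def by (rule exact_transport[OF M(1,2,3) G3(1) p1 p2 p3 hom(1,2) ex(1)])
  have e2: "{x \<in> carrier (G3 j). c' j x = \<zero>\<^bsub>G4 j\<^esub>} = b' j ` carrier (G2 j)" for j
    unfolding c'_def b'_def
        by (rule exact_transport[OF M(2,3,4) abelian_module[OF G4] p2 p3 p4 hom(2,3) ex(2)])
  have e3: "{x \<in> carrier (G4 j). d' j x = \<zero>\<^bsub>G5 j\<^esub>} = c' j ` carrier (G3 j)" for j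
    unfolding c'_def d'_def
        by (rule exact_transport[OF M(3,4,5) abelian_module[OF G5] p3 p4 p5 hom(3,4) ex(3)])
  define Q where "Q j = (G3 j)\<lparr>carrier := b' j ` carrier (G2 j)\<rparr>" for j
  define K where "K j = (G4 j)\<lparr>carrier := c' j ` carrier (G3 j)\<rparr>" for j
  have Qs: "carrier (Q j) = b' j ` carrier (G2 j)" "add (Q j) = add (G3 j)" "smult (Q j) = smult (G3 j)"
    "\<zero>\<^bsub>Q j\<^esub> = \<zero>\<^bsub>G3 j\<^esub>" for j by (simp_all add: Q_def)
  have Ks: "carrier (K j) = c' j ` carrier (G3 j)" "add (K j) = add (G4 j)" "smult (K j) = smult (G4 j)"
    "\<zero>\<^bsub>K j\<^esub> = \<zero>\<^bsub>G4 j\<^esub>" for j by (simp_all add: K_def)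
  have Qg: "Q \<in> graded_modules R \<kappa>"
    unfolding Q_def by (rule graded_image[OF abelian_module[OF G2] G3g b'])
  have Kg: "K \<in> graded_modules R \<kappa>"
    unfolding K_def by (rule graded_image[OF G3(1) subsetD[OF abelian_graded G4] c'])
  have b'Q: "b' j \<in> mod_hom R (G2 j) (Q j)" for j
    by (rule mod_homI) (simp_all add: Qs mod_homD[OF b'])
  have c'K: "c' j \<in> mod_hom R (G3 j) (K j)" for j
    by (rule mod_homI) (simp_all add: Ks mod_homD[OF c'])
  have iQ: "(\<lambda>x. x) \<in> mod_hom R (Q j) (G3 j)" for j
    by (rule mod_homI) (auto simp: Qs mod_homD[OF b'])
  have iK: "(\<lambda>x. x) \<in> mod_hom R (K j) (G4 j)" for j
    by (rule mod_homI) (auto simp: Ks mod_homD[OF c'])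
  have "is_gmod_cokernel R G1 G2 Q a' b'"
    unfolding is_gmod_cokernel_def gmod_hom_def using a' b'Q e1 by (simp add: Qs)
  then have QA: "Q \<in> A" by (rule abelian_cokernel[OF G1 G2 Qg])
  have "is_gmod_kernel R K G4 G5 (\<lambda>j x. x) d'"
    unfolding is_gmod_kernel_def gmod_hom_def using iK d' e3 by (simp add: Ks)
  then have KA: "K \<in> A" by (rule abelian_kernel[OF G4 G5 Kg])
  have "is_gmod_kernel R Q G3 K (\<lambda>j x. x) c'" "is_gmod_cokernel R Q G3 K (\<lambda>j x. x) c'"
    unfolding is_gmod_kernel_def is_gmod_cokernel_def gmod_hom_def using iQ c'K e2 by (simp_all add: Qs Ks)
  then have "G3 \<in> A" by (rule abelian_extension[OF QA KA G3g])
  then show ?thesis using iso3 unfolding ess_in_def by blast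
qed

end

section \<open>Restriction to categories of graded type\<close>

context triangulated_category
begin

abbreviation "unsh \<equiv> inv_into (obj C) (shift_obj C)"

lemma unshift: "X \<in> obj C \<Longrightarrow> unsh X \<in> obj C" "X \<in> obj C \<Longrightarrow> sh (unsh X) = X"
  using shift_obj_bij inv_into_into[of X sh "obj C"] f_inv_into_f[of X sh "obj C"]
      by (simp_all add: bij_betw_def)

lemma unshift_funpow_obj: "X \<in> obj C \<Longrightarrow> (unsh ^^ m) X \<in> obj C"
  by (induction m) (simp_all add: unshift)

lemma shift_funpow_obj: "X \<in> obj C \<Longrightarrow> (sh ^^ m) X \<in> obj C"
  by (induction m) (simp_all add: shift_obj_in)

lemma shift_pow_obj: "X \<in> obj C \<Longrightarrow> shift_pow C k X \<in> obj C"
  by (simp add: shift_pow_def unshift_funpow_obj shift_funpow_obj)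

lemma shift_shift_pow:
  assumes X: "X \<in> obj C" shows "sh (shift_pow C k X) = shift_pow C (k + 1) X"
proof (cases "0 \<le> k")
  case True
  then have "nat (k + 1) = Suc (nat k)" by simp
  then show ?thesis using True by (simp add: shift_pow_def)
next
  \<comment> \<open>For negative \<open>k\<close> one inverse shift is cancelled. The value
    \<open>k = -1\<close> is separate because \<open>k + 1 = 0\<close> falls under the other branch
    of \<open>shift_pow\<close>.\<close>
  case False
  define m where "m = nat (- (k + 1))"
  have k: "nat (- k) = Suc m" using False unfolding m_def by simp
  have "shift_pow C (k + 1) X = (unsh ^^ m) X" using False
      by (cases "k = -1") (simp_all add: shift_pow_def m_def)
  then show ?thesis using False k unshift(2)[OF unshift_funpow_obj[OF X]] by (simp add: shift_pow_def)
qed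

lemma shift_pow_induct:
  assumes X: "X \<in> obj C" and 0: "Q X" and sh: "\<And>Y. Y \<in> obj C \<Longrightarrow> Q (sh Y) \<longleftrightarrow> Q Y"
  shows "Q (shift_pow C k X)"
proof -
  have "Q ((sh ^^ m) X)" for m
    by (induction m) (simp_all add: 0 sh shift_funpow_obj[OF X])
  moreover have "Q ((unsh ^^ m) X)" for m
  proof (induction m)
    case (Suc m)
    have "sh (unsh ((unsh ^^ m) X)) = (unsh ^^ m) X" by (rule unshift(2)[OF unshift_funpow_obj[OF X]])
    then show ?case using Suc sh[OF unshift(1)[OF unshift_funpow_obj[OF X, of m]]] by simp
  qed (simp add: 0)
  ultimately show ?thesis by (simp add: shift_pow_def)
qed

lemma shift_pow_tri_subcat: "tri_subcat C S \<Longrightarrow> X \<in> S \<Longrightarrow> shift_pow C k X \<in> S"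
  using tri_subcatD(1,3,4)[of S] shift_pow_induct[of X "\<lambda>Y. Y \<in> S" k] by (metis subsetD)

lemma shift_pow_0: "shift_pow C 0 X = X"
  by (simp add: shift_pow_def)

lemma tri_shift_pow:
  assumes t: "tri X Y Z" shows "tri (shift_pow C k X) (shift_pow C k Y) (shift_pow C k Z)"
proof -
  note O = tri_obj[OF t]
  have step: "tri (shift_pow C (j + 1) X) (shift_pow C (j + 1) Y) (shift_pow C (j + 1) Z) \<longleftrightarrow>
      tri (shift_pow C j X) (shift_pow C j Y) (shift_pow C j Z)" for j
    using tri_shift[OF shift_pow_obj[OF O(1)] shift_pow_obj[OF O(2)] shift_pow_obj[OF O(3)]]
      shift_shift_pow[OF O(1)] shift_shift_pow[OF O(2)] shift_shift_pow[OF O(3)] by simp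
  show ?thesis
  proof (induction k rule: int_induct[where k = 0])
    case base
    show ?case using t by (simp add: shift_pow_0)
  next
    case (step1 i)
    then show ?case using step by blast
  next
    case (step2 i)
    then show ?case using step[of "i - 1"] by simp
  qed
qed

context
  fixes R :: "('r, 'y) ring_scheme" and sm :: "'r \<Rightarrow> 'm \<Rightarrow> 'm"
  assumes linear: "linear_structure R C sm"
begin

lemma hom_module_module: "X \<in> obj C \<Longrightarrow> Y \<in> obj C \<Longrightarrow> module R (hom_module C sm X Y)"
  using linear unfolding linear_structure_def by blast

lemma smult_cmp:
  assumes "r \<in> carrier R" "f \<in> Hom C X Y" "g \<in> Hom C Y Z"
  shows "sm r (g \<cdot> f) = sm r g \<cdot> f" "sm r (g \<cdot> f) = g \<cdot> sm r f"
  using linear assms unfolding linear_structure_def by blast+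

lemma precompose_mod_hom:
  assumes f: "f \<in> Hom C X Y"
  shows "(\<lambda>g. g \<cdot> f) \<in> mod_hom R (hom_module C sm Y Z) (hom_module C sm X Z)"
  by (rule mod_homI) (simp_all add: hom_module_def cmp_Hom[OF f] cmp_add_left[OF f] smult_cmp(1)[OF _ f])

lemma postcompose_mod_hom:
  assumes f: "f \<in> Hom C Y Z"
  shows "(\<lambda>g. f \<cdot> g) \<in> mod_hom R (hom_module C sm X Y) (hom_module C sm X Z)"
  by (rule mod_homI) (simp_all add: hom_module_def cmp_Hom[OF _ f] cmp_add_right[OF _ _ f] smult_cmp(2)[OF _ _ f])

lemma shift_mod_isomorphic:
  assumes "X \<in> obj C" "Y \<in> obj C"
  shows "mod_isomorphic R (hom_module C sm X Y) (hom_module C sm (sh X) (sh Y))"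
proof -
  have "sm r f \<in> Hom C X Y \<and> sa (sm r f) = sm r (sa f)" if "r \<in> carrier R" "f \<in> Hom C X Y" for r f
    using module_closed(3)[OF hom_module_module[OF assms], of r f] linear that
    unfolding linear_structure_def hom_module_def by (simp add: Hom_def)
  then have "sa \<in> mod_hom R (hom_module C sm X Y) (hom_module C sm (sh X) (sh Y))"
    by (intro mod_homI) (simp_all add: hom_module_def shift_Hom shift_add)
  moreover have "bij_betw sa (Hom C X Y) (Hom C (sh X) (sh Y))"
    unfolding bij_betw_def inj_on_def
  proof (intro conjI ballI impI equalityI subsetI)
    fix g assume "g \<in> Hom C (sh X) (sh Y)"
    then show "g \<in> sa ` Hom C X Y" using shift_arr_surj[OF _ assms] by blast
  next
    fix g assume "g \<in> sa ` Hom C X Y"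
    then show "g \<in> Hom C (sh X) (sh Y)" using shift_Hom by blast
  qed (rule shift_arr_inj)
  ultimately show ?thesis unfolding mod_isomorphic_def by (auto simp: hom_module_def)
qed

end

end

lemma T_sub_iff:
  "N \<in> T_sub R D sm T A \<longleftrightarrow> N \<in> obj D \<and>
    (\<forall>M \<in> T. ess_in R A (\<lambda>j. hom_module D sm (shift_pow D (- j) M) N))"
  by (simp add: T_sub_def ess_in_def)

section \<open>Stability of \<open>T_sub\<close> under truncation\<close>

context compact_semi_orth
begin

text \<open>Inside \<open>T\<close> the pieces with index at least \<open>k\<close> generate the
  left complement of \<open>T_{<k}\<close>. The part \<open>x\<close> lies in a hull of compact
  objects, so its orthogonality to \<open>T_{<k}\<close> extends to \<open>T_{<k}^\<Coprod>\<close>;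
  this makes \<open>D(m, c) \<rightarrow> D(M, c)\<close> bijective later.\<close>

lemma split_T:
  assumes k: "k \<le> Suc n" and M: "M \<in> T"
  shows "\<exists>x. \<exists>m \<in> hull_below S k. x \<in> T \<and> orth {x} (Ck k) \<and> tri x M m"
proof -
  let ?G = "\<Union>i \<in> {k..<Suc n}. S i" and ?L = "\<Union>i<k. S i"
  have GT: "?G \<subseteq> T" by (rule UN_least, rule piece(2)) simp
  have LT: "?L \<subseteq> T" by (rule UN_least, rule piece(2)) (use k in simp)
  note GO = order_trans[OF GT T_obj] and LO = order_trans[OF LT T_obj]
  have tG: "tri_subcat C (tri_hull C ?G)" by (rule tri_subcat_tri_hull[OF GO])
  have tL: "tri_subcat C (hull_below S k)" by (rule tri_subcat_hull_below_piece[OF k])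
  have hG: "tri_hull C ?G \<subseteq> T" by (rule tri_hull_least[OF T GT])
  have "orth (S i) (hull_below S k)" if "i \<in> {k..<Suc n}" for i
    unfolding hull_below_def
  proof (rule orth_tri_hull_right[OF _ piece(1) LO])
    have "orth (S i) (S j)" if "j < k" for j using piece_orth[of j i] that \<open>i \<in> {k..<Suc n}\<close> by simp
    then show "orth (S i) ?L" unfolding orth_def by blast
  qed (use that in simp)
  then have "orth ?G (hull_below S k)" unfolding orth_def by blast
  then have o: "orth (tri_hull C ?G) (hull_below S k)" by (rule orth_tri_hull_left[OF _ tL GO])
  have "{..<Suc n} = {k..<Suc n} \<union> {..<k}" using k by auto
  then have "T = tri_hull C (?G \<union> ?L)" using hull_pieces unfolding hull_below_def by (simp add: UN_Un)
  also have "\<dots> = star (tri_hull C ?G) (hull_below S k)"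
    using tri_hull_Un_hull[OF GO LO] tri_hull_Un[OF tL tG o] unfolding hull_below_def by simp
  finally obtain x m where xm: "x \<in> tri_hull C ?G" "m \<in> hull_below S k" "tri x M m"
    using M unfolding star_def by blast
  have "orth (tri_hull C ?G) (Ck k)"
    by (rule orth_coproduct_hull_right[OF o tG tri_subcatD(1)[OF tL] compact]) (use hG in blast)
  then have "orth {x} (Ck k)" using xm(1) unfolding orth_def by blast
  then show ?thesis using xm hG by blast
qed

context
  fixes R :: "'r ring" and sm :: "'r \<Rightarrow> 'm \<Rightarrow> 'm" and A :: "('r, 'u) graded_module set"
  assumes linear: "linear_structure R C sm" and exact: "exact_abelian_subcat R \<kappa> A"
      and st: "shift_stable R \<kappa> A"
begin

abbreviation "hm \<equiv> hom_module C sm"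
abbreviation "gh M N \<equiv> \<lambda>j. hm (shift_pow C (- j) M) N"
abbreviation "TA \<equiv> T_sub R C sm T A"

lemma card_order: "Card_order \<kappa>"
  using universe unfolding universe_card_def by blast

lemma carrier_hm [simp]: "carrier (hm X Y) = Hom C X Y" "\<zero>\<^bsub>hm X Y\<^esub> = zr X Y"
  by (simp_all add: hom_module_def)

lemma TA_D: "N \<in> TA \<Longrightarrow> M \<in> T \<Longrightarrow> ess_in R A (gh M N)" "N \<in> TA \<Longrightarrow> N \<in> obj C"
  unfolding T_sub_iff by blast+

lemma TA_I: "N \<in> obj C \<Longrightarrow> (\<And>M. M \<in> T \<Longrightarrow> ess_in R A (gh M N)) \<Longrightarrow> N \<in> TA"
  unfolding T_sub_iff by blast

lemma pow_T: "M \<in> T \<Longrightarrow> shift_pow C k M \<in> T"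
  by (rule shift_pow_tri_subcat[OF T])

lemma pow_obj: "M \<in> T \<Longrightarrow> shift_pow C k M \<in> obj C"
  using pow_T T_obj by blast

text \<open>\<open>D(M[-j], N[1])\<close> is \<open>D(M[-(j+1)], N)\<close>, so shifting
  \<open>N\<close> moves the graded module by one degree, and stability of \<open>A\<close> under
  shifts applies.\<close>

lemma ess_in_gh_shift:
  assumes M: "M \<in> T" and N: "N \<in> obj C" shows "ess_in R A (gh M (sh N)) \<longleftrightarrow> ess_in R A (gh M N)"
proof -
  have MO: "M \<in> obj C" using M T_obj by blast
  have "mod_isomorphic R (hm (shift_pow C (- (j + 1)) M) N) (hm (shift_pow C (- j) M) (sh N))" for j
    using shift_mod_isomorphic[OF linear pow_obj[OF M, of "- (j + 1)"] N] shift_shift_pow[OF MO, of "- (j + 1)"] by simp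
  note i = this mod_isomorphic_sym[OF hom_module_module[OF linear pow_obj[OF M] N] this]
  have "ess_in R A (gh M (sh N)) \<longleftrightarrow> ess_in R A (\<lambda>j. hm (shift_pow C (- (j + 1)) M) N)"
    using ess_in_iso i by meson
  also have "\<dots> \<longleftrightarrow> ess_in R A (gh M N)"
    using ess_in_shift[OF exact card_order st, of "gh M N"] by simp
  finally show ?thesis .
qed

text \<open>For cones, morphisms from the shifts of \<open>M\<close> turn
  \<open>N1 -> N2 -> N3 -> N1[1] -> N2[1]\<close> into a five-term exact sequence with four terms
  known. Local smallness from \<open>T\<close> provides the smallness of the middle term.\<close>

lemma tri_subcat_TA: "tri_subcat C TA"
proof (rule tri_subcatI)
  show "TA \<subseteq> obj C" using TA_D(2) by blast
  show "Z \<in> TA" if Z: "zero_obj C Z" for Z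
  proof (rule TA_I[OF zero_obj_in_obj[OF Z]])
    fix M assume M: "M \<in> T"
    obtain G where G: "G \<in> A" "\<And>j. carrier (G j) = {\<zero>\<^bsub>G j\<^esub>}" using abelian_zero[OF exact card_order] by blast
    have "mod_isomorphic R (gh M Z j) (G j)" for j
    proof -
      let ?X = "shift_pow C (- j) M"
      note X = pow_obj[OF M, of "- j"]
      interpret h: module R "gh M Z j" by (rule hom_module_module[OF linear X zero_obj_in_obj[OF Z]])
      interpret G: module R "G j" by (rule abelian_module[OF exact card_order G(1)])
      have H: "Hom C ?X Z = {zr ?X Z}" using Hom_to_zero_obj[OF Z] zero_Hom[OF X zero_obj_in_obj[OF Z]]
          by blast
      have "(\<lambda>_. \<zero>\<^bsub>G j\<^esub>) \<in> mod_hom R (gh M Z j) (G j)" by (rule mod_homI) (simp_all add: G.smult_r_null)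
      moreover have "bij_betw (\<lambda>_. \<zero>\<^bsub>G j\<^esub>) (carrier (gh M Z j)) (carrier (G j))"
        using H G(2)[of j] by (simp add: bij_betw_def)
      ultimately show ?thesis unfolding mod_isomorphic_def by blast
    qed
    then show "ess_in R A (gh M Z)" unfolding ess_in_def gmod_isomorphic_iff using G(1) by blast
  qed
  show "N' \<in> TA" if N: "N \<in> TA" and i: "isomorphic C N N'" for N N'
  proof (rule TA_I[OF isomorphic_in_obj(2)[OF i]])
    fix M assume M: "M \<in> T"
    obtain f g where f: "f \<in> Hom C N' N" and g: "g \<in> Hom C N N'" and gf: "g \<cdot> f = ident C N'"
        and fg: "f \<cdot> g = ident C N"
      using isomorphicD[OF isomorphic_sym[OF i]] by metis
    have "bij_betw (\<lambda>w. f \<cdot> w) (Hom C X N') (Hom C X N)" for X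
    proof (rule bij_betwI[where g = "\<lambda>w. g \<cdot> w"])
      show "(\<lambda>w. f \<cdot> w) \<in> Hom C X N' \<rightarrow> Hom C X N" "(\<lambda>w. g \<cdot> w) \<in> Hom C X N \<rightarrow> Hom C X N'"
        using cmp_Hom[OF _ f] cmp_Hom[OF _ g] by blast+
      show "g \<cdot> (f \<cdot> w) = w" if "w \<in> Hom C X N'" for w
        using cmp_assoc[OF that f g] gf cmp_ident_left[OF that] by simp
      show "f \<cdot> (g \<cdot> w) = w" if "w \<in> Hom C X N" for w
        using cmp_assoc[OF that g f] fg cmp_ident_left[OF that] by simp
    qed
    then have "mod_isomorphic R (gh M N' j) (gh M N j)" for j
      unfolding mod_isomorphic_def carrier_hm using postcompose_mod_hom[OF linear f] by blast
    then show "ess_in R A (gh M N')" by (rule ess_in_iso[OF TA_D(1)[OF N M]])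
  qed
  show "sh N \<in> TA" if N: "N \<in> TA" for N
    by (rule TA_I[OF shift_obj_in[OF TA_D(2)[OF N]]]) (use ess_in_gh_shift[OF _ TA_D(2)[OF N]] TA_D(1)[OF N] in blast)
  show "N \<in> TA" if N: "N \<in> obj C" "sh N \<in> TA" for N
    by (rule TA_I[OF N(1)]) (use ess_in_gh_shift[OF _ N(1)] TA_D(1)[OF N(2)] in blast)
  show "N3 \<in> TA" if N: "N1 \<in> TA" "N2 \<in> TA" and t: "tri N1 N2 N3" for N1 N2 N3
  proof (rule TA_I[OF tri_obj(3)[OF t]])
    fix M assume M: "M \<in> T"
    obtain f g h where d: "dist_triangle C N1 N2 N3 f g h" using t unfolding tri_def by blast
    note H = dist_Hom[OF d] and O = dist_obj[OF d]
    note s = shift_obj_in[OF O(1)] shift_obj_in[OF O(2)] and sf = shift_Hom[OF H(1)]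
    note mm = hom_module_module[OF linear pow_obj[OF M]]
    show "ess_in R A (gh M N3)"
    proof (rule ess_in_five_term[OF exact card_order])
      show "|carrier (gh M N3 j)| <o \<kappa>" for j
        using locally_small pow_T[OF M] O(3) unfolding locally_small_from_def by simp
      show "ess_in R A (gh M N1)" "ess_in R A (gh M N2)" using TA_D(1) N M by blast+
      show "ess_in R A (gh M (sh N1))" "ess_in R A (gh M (sh N2))"
        using ess_in_gh_shift[OF M] O TA_D(1) N M by blast+
      show "(\<lambda>w. f \<cdot> w) \<in> mod_hom R (gh M N1 j) (gh M N2 j)"
        "(\<lambda>w. g \<cdot> w) \<in> mod_hom R (gh M N2 j) (gh M N3 j)"
        "(\<lambda>w. h \<cdot> w) \<in> mod_hom R (gh M N3 j) (gh M (sh N1) j)"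
        "(\<lambda>w. sa f \<cdot> w) \<in> mod_hom R (gh M (sh N1) j) (gh M (sh N2) j)" for j
        by (rule postcompose_mod_hom[OF linear] H sf)+
      have gf0: "g \<cdot> (f \<cdot> w) = zr X N3" if "w \<in> Hom C X N1" for X w
        using cmp_assoc[OF that H(1,2)] dist_cmp_zero(1)[OF d] cmp_zero_left[OF that O(3)] by simp
      have hg0: "h \<cdot> (g \<cdot> w) = zr X (sh N1)" if "w \<in> Hom C X N2" for X w
        using cmp_assoc[OF that H(2,3)] dist_cmp_zero(2)[OF d] cmp_zero_left[OF that s(1)] by simp
      have fh0: "sa f \<cdot> (h \<cdot> w) = zr X (sh N2)" if "w \<in> Hom C X N3" for X w
        using cmp_assoc[OF that H(3) sf] dist_cmp_zero_shift[OF d] cmp_zero_left[OF that s(2)] by simp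
      fix j
      show "{x \<in> carrier (gh M N2 j). g \<cdot> x = \<zero>\<^bsub>gh M N3 j\<^esub>} = (\<lambda>w. f \<cdot> w) ` carrier (gh M N1 j)"
        unfolding carrier_hm using dist_lift[OF d] cmp_Hom[OF _ H(1)] gf0 by blast
      show "{x \<in> carrier (gh M N3 j). h \<cdot> x = \<zero>\<^bsub>gh M (sh N1) j\<^esub>} = (\<lambda>w. g \<cdot> w) ` carrier (gh M N2 j)"
        unfolding carrier_hm using dist_lift_mid[OF d] cmp_Hom[OF _ H(2)] hg0 by blast
      show "{x \<in> carrier (gh M (sh N1) j). sa f \<cdot> x = \<zero>\<^bsub>gh M (sh N2) j\<^esub>} = (\<lambda>w. h \<cdot> w) ` carrier (gh M N3 j)"
        unfolding carrier_hm using dist_lift_shift[OF d] cmp_Hom[OF _ H(3)] fh0 by blast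
    qed (rule mm O s)+
  qed
qed

text \<open>With \<open>m\<close> the \<open>\<T>\<^sub><\<^sub>k\<close>-part of \<open>M\<close>, both maps in \<open>D(M, c) \<leftarrow> D(m, c) \<rightarrow> D(m, N)\<close> are bijective.\<close>

lemma decomposes_TA:
  assumes es: "essentially_small \<kappa> C T" shows "decomposes TA"
  unfolding decomposes_def
proof (intro conjI allI impI ballI tri_subcat_TA)
  fix k N assume k: "k \<le> Suc n" and N: "N \<in> TA"
  obtain c d where cd: "c \<in> Ck k" "d \<in> Pk k" "tri c N d"
    using decomposes_obj[OF es] k TA_D(2)[OF N] unfolding decomposes_def by blast
  note O = tri_obj[OF cd(3)]
  obtain e p q where dN: "dist_triangle C c N d e p q" using cd(3) unfolding tri_def by blast
  note tL = tri_subcat_hull_below_piece[OF k]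
  have "c \<in> TA"
  proof (rule TA_I[OF O(1)])
    fix M assume M: "M \<in> T"
    obtain x m where xm: "x \<in> T" "m \<in> hull_below S k" "orth {x} (Ck k)" "tri x M m" using split_T[OF k M]
        by blast
    have mT: "m \<in> T" using hull_below_piece[OF k] xm(2) by blast
    have "{x} \<subseteq> obj C" using xm(1) T_obj by blast
    then have xp: "x \<in> left_perp (Ck k)" using orth_iff_left_perp[of "{x}"] xm(3) by blast
    \<comment> \<open>Orthogonality of \<open>x\<close> alone says nothing about its shifts. The
      left orthogonal of \<open>Ck k\<close> is triangulated, so it contains all of them, as needed
      in every degree \<open>j\<close>.\<close>
    note tlp = tri_subcat_left_perp[OF tri_subcat_Ck[OF k]]
    have "mod_isomorphic R (gh M c j) (gh m N j)" for j
    proof -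
      let ?x = "shift_pow C (- j) x" and ?M = "shift_pow C (- j) M" and ?m = "shift_pow C (- j) m"
      note mO = pow_obj[OF mT, of "- j"]
      obtain a u b where du: "dist_triangle C ?x ?M ?m a u b" using tri_shift_pow[OF xm(4)] unfolding tri_def
          by blast
      have x1: "?x \<in> left_perp (Ck k)" by (rule shift_pow_tri_subcat[OF tlp xp])
      have x2: "sh ?x \<in> left_perp (Ck k)" by (rule tri_subcatD(3)[OF tlp x1])
      have x0: "Hom C ?x c = {zr ?x c}" "Hom C (sh ?x) c = {zr (sh ?x) c}"
        using x1 x2 cd(1) unfolding left_perp_def by blast+
      have m1: "?m \<in> hull_below S k" by (rule shift_pow_tri_subcat[OF tL xm(2)])
      have m2: "sh ?m \<in> hull_below S k" by (rule tri_subcatD(3)[OF tL m1])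
      have m0: "Hom C ?m d = {zr ?m d}" "Hom C (sh ?m) d = {zr (sh ?m) d}"
        using m1 m2 cd(2) unfolding right_perp_def by blast+
      have "mod_isomorphic R (hm ?m c) (hm ?M c)"
        unfolding mod_isomorphic_def carrier_hm
        using precompose_mod_hom[OF linear dist_Hom(2)[OF du]] bij_betw_precompose[OF du O(1) x0] by blast
      then have "mod_isomorphic R (hm ?M c) (hm ?m c)"
        by (rule mod_isomorphic_sym[OF hom_module_module[OF linear mO O(1)]])
      moreover have "mod_isomorphic R (hm ?m c) (hm ?m N)"
        unfolding mod_isomorphic_def carrier_hm
        using postcompose_mod_hom[OF linear dist_Hom(1)[OF dN]] bij_betw_postcompose[OF dN mO m0] by blast
      ultimately show ?thesis by (rule mod_isomorphic_trans)
    qed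
    then show "ess_in R A (gh M c)" by (rule ess_in_iso[OF TA_D(1)[OF N mT]])
  qed
  moreover have "d \<in> TA" by (rule tri_subcatD(5)[OF tri_subcat_TA \<open>c \<in> TA\<close> N cd(3)])
  ultimately show "\<exists>c\<in>Ck k \<inter> TA. \<exists>d\<in>Pk k \<inter> TA. tri c N d" using cd by blast
qed

end

end

theorem theorem4p2p3:
  fixes \<kappa> :: "'u rel"
    and D :: "('o, 'm) tri_cat_data"
    and T :: "'o set"
    and S :: "nat \<Rightarrow> 'o set"
    and n :: nat
  assumes "universe_card \<kappa>"
    and "triangulated_category D"
    and "locally_small_from \<kappa> D T"
    and "has_small_coproducts \<kappa> D"
    and "tri_subcat D T"
    and "\<And>M. M \<in> T \<Longrightarrow> compact_obj \<kappa> D M"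
    and "coproduct_hull \<kappa> D T = obj D"
    and "n \<ge> 1"
    and "semi_orth_dec (full_sub D T) n S"
  shows
    \<comment> \<open>I.1\<close>
    "semi_orth_dec D n (\<lambda>i. coproduct_hull \<kappa> D (S i)) \<and>
     \<comment> \<open>I.2\<close>
     (essentially_small \<kappa> D T \<longrightarrow>
        compactly_generates \<kappa> D T \<and>
        semi_orth_dec D n (hat_family \<kappa> D T n S) \<and>
        (\<forall>i. 1 \<le> i \<and> i < n \<longrightarrow>
           tri_le D n (hat_family \<kappa> D T n S) (int i - 1) \<subseteq> tri_le D n (hat_family \<kappa> D T n S) (int i) \<and>
           tri_ge D n (hat_family \<kappa> D T n S) (int n + 1 - int i)
             \<subseteq> tri_ge D n (hat_family \<kappa> D T n S) (int n - int i)) \<and>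
        (\<forall>i. 1 \<le> i \<and> i \<le> n \<longrightarrow>
           left_admissible D (tri_le D n (hat_family \<kappa> D T n S) (int i - 1)) \<and>
           tri_le D n (hat_family \<kappa> D T n S) (int i - 1)
             = right_perp D (tri_le (full_sub D T) n S (int n - int i)) (obj D) \<and>
           right_admissible D (tri_ge D n (hat_family \<kappa> D T n S) (int n + 1 - int i)) \<and>
           tri_ge D n (hat_family \<kappa> D T n S) (int n + 1 - int i)
             = coproduct_hull \<kappa> D (tri_le (full_sub D T) n S (int i - 1)))) \<and>
     \<comment> \<open>I.3\<close>
     (\<forall>T0. essentially_small \<kappa> D T \<and> restricts_to D n (hat_family \<kappa> D T n S) T0 \<longrightarrow>
        restricts_to D n (hat_family \<kappa> D T n S) (coproduct_hull \<kappa> D T0) \<and>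
        (\<forall>i \<le> n. hat_family \<kappa> D T n S i \<inter> coproduct_hull \<kappa> D T0
                  = coproduct_hull \<kappa> D (hat_family \<kappa> D T n S i \<inter> T0))) \<and>
     \<comment> \<open>II\<close>
     (\<forall>(R :: 'r ring) sm (A :: ('r, 'u) graded_module set).
        essentially_small \<kappa> D T \<and> cring R \<and> linear_structure R D sm \<and>
        exact_abelian_subcat R \<kappa> A \<and> shift_stable R \<kappa> A \<longrightarrow>
        restricts_to D n (hat_family \<kappa> D T n S) (T_sub R D sm T A))"
proof -
  interpret triangulated_category D by (rule assms(2))
  interpret compact_semi_orth D \<kappa> T n S
    by unfold_locales (rule assms(1,3,4,5,7,9) | erule assms(6))+
  let ?hat = "hat_family \<kappa> D T n S"
  have I2: "compactly_generates \<kappa> D T \<and> semi_orth_dec D n ?hat \<and>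
      (\<forall>i. 1 \<le> i \<and> i < n \<longrightarrow>
         tri_le D n ?hat (int i - 1) \<subseteq> tri_le D n ?hat (int i) \<and>
         tri_ge D n ?hat (int n + 1 - int i) \<subseteq> tri_ge D n ?hat (int n - int i)) \<and>
      (\<forall>i. 1 \<le> i \<and> i \<le> n \<longrightarrow>
         left_admissible D (tri_le D n ?hat (int i - 1)) \<and>
         tri_le D n ?hat (int i - 1) = right_perp D (tri_le (full_sub D T) n S (int n - int i)) (obj D) \<and>
         right_admissible D (tri_ge D n ?hat (int n + 1 - int i)) \<and>
         tri_ge D n ?hat (int n + 1 - int i) = coproduct_hull \<kappa> D (tri_le (full_sub D T) n S (int i - 1)))"
    if es: "essentially_small \<kappa> D T"
  proof (intro conjI allI impI; (elim conjE)?)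
    show "compactly_generates \<kappa> D T" unfolding compactly_generates_def using es assms(6,7) by blast
    show "semi_orth_dec D n ?hat" by (rule semi_orth_dec_hat[OF es])
    fix i
    show "tri_le D n ?hat (int i - 1) \<subseteq> tri_le D n ?hat (int i)"
      unfolding tri_le_def by (rule tri_hull_mono) fastforce
    show "tri_ge D n ?hat (int n + 1 - int i) \<subseteq> tri_ge D n ?hat (int n - int i)"
      unfolding tri_ge_def by (rule tri_hull_mono) fastforce
    assume i: "1 \<le> i" "i \<le> n"
    \<comment> \<open>At index \<open>i\<close> the left chain sits at level
      \<open>n + 1 - i\<close>, because \<open>T_{<n+1-i}\<close> is \<open>T_{<=n-i}\<close>, and
      the right chain sits at level \<open>i\<close>.\<close>
    then have le: "tri_le D n ?hat (int i - 1) = Pk (Suc n - i)" and ge: "tri_ge D n ?hat (int n + 1 - int i) = Ck i"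
      using tri_le_hat[OF es, of i] tri_ge_hat[OF es, of i] by simp_all
    show "left_admissible D (tri_le D n ?hat (int i - 1))" unfolding le by (rule left_admissible_Pk[OF es]) simp
    show "right_admissible D (tri_ge D n ?hat (int n + 1 - int i))"
      unfolding ge by (rule right_admissible_Ck[OF es]) (use i in simp)
    have "tri_le (full_sub D T) n S (int n - int i) = hull_below S (Suc n - i)"
      using tri_le_T[of "Suc n - i"] i by (simp add: of_nat_diff)
    then show "tri_le D n ?hat (int i - 1) = right_perp D (tri_le (full_sub D T) n S (int n - int i)) (obj D)"
      by (simp only: le)
    have "tri_le (full_sub D T) n S (int i - 1) = hull_below S i" by (rule tri_le_T) (use i in simp)
    then show "tri_ge D n ?hat (int n + 1 - int i) = coproduct_hull \<kappa> D (tri_le (full_sub D T) n S (int i - 1))"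
      by (simp only: ge)
  qed
  have II: "restricts_to D n ?hat (T_sub R D sm T A)"
    if "essentially_small \<kappa> D T" "linear_structure R D sm" "exact_abelian_subcat R \<kappa> A" "shift_stable R \<kappa> A"
    for R :: "'r ring" and sm and A :: "('r, 'u) graded_module set"
    by (rule decomposes_restricts[OF decomposes_TA[OF that(2-4,1)]])
  show ?thesis
    by (rule conjI[OF semi_orth_dec_coproduct_hulls conjI[OF impI conjI]], rule I2, assumption)
      (intro allI impI conjI; elim conjE; rule restricts_to_coproduct_hull II; assumption)+
qed

end
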